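(* Let $\tau$ be in the limit circle case at both $a$ and $b$, with boundary condition bases $\{\phi_a,\psi_a\}$ at $a$ and $\{\phi_b,\psi_b\}$ at $b$, and let $T_{0,0}$, $T_{R,\eta}$ and $u_{z,1},u_{z,2}$ be as in the context. Let $\eta\in[0,\pi)$ and $R\in \mathrm{SL}_2(\mathbb R)$. If $R_{1,2}=0$, then the maximal common part of $T_{R,\eta}$ and $T_{0,0}$ is the restriction of $T_{\max}$ to the set $$\mathcal S_{R,\eta}=\{y\in\operatorname{dom}(T_{\max}): [y,\phi_a](a)=[y,\phi_b](b)=0,\ [y,\psi_b](b)=e^{i\eta}R_{2,2}[y,\psi_a](a)\}.$$ Moreover, for $z\in\rho(T_{0,0})$ put $$u_{z,R,\eta}:=e^{-i\eta}R_{2,2}\,u_{z,2}+u_{z,1}.$$ Then for each $z\in\rho(T_{R,\eta})\cap\rho(T_{0,0})$ the scalar $$k_{R,\eta}(z)=R_{2,1}R_{2,2}+e^{i\eta}R_{2,2}[u_{z,R,\eta},\psi_a](a)-[u_{z,R,\eta},\psi_b](b)$$ is nonzero, and $$(T_{R,\eta}-zI)^{-1}=(T_{0,0}-zI)^{-1}+k_{R,\eta}(z)^{-1}\langle u_{\overline z,R,\eta},\,\cdot\,\rangle\,u_{z,R,\eta}.$$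
   Context: Setting. Let $-\infty\le a<b\le\infty$ and let $p,q,r$ be real-valued Lebesgue measurable functions on $(a,b)$ with $p>0$, $r>0$ a.e. and $p^{-1},q,r\in L^1_{\mathrm{loc}}((a,b);dx)$. Let $\mathfrak D(a,b)$ be the set of $f\in AC_{\mathrm{loc}}(a,b)$ (complex-valued) with $pf'\in AC_{\mathrm{loc}}(a,b)$, and $\tau f=\frac1r[-(pf')'+qf]$ for $f\in\mathfrak D(a,b)$. The Lagrange bracket is $[f,g](x)=f(x)\overline{(pg')(x)}-(pf')(x)\overline{g(x)}$ for $f,g\in\mathfrak D(a,b)$. $I$ and $\langle\cdot,\cdot\rangle$ (linear in the second argument) are the identity and inner product of $L^2((a,b);r(x)\,dx)$. $\mathrm{SL}_2(\mathbb R)$ is the set of real $2\times2$ matrices with determinant $1$. The maximal operator is $T_{\max}f=\tau f$ with $\operatorname{dom}(T_{\max})=\{g\in\mathfrak D(a,b): g,\tau g\in L^2((a,b);r\,dx)\}$; it is densely defined, and the minimal operator is $T_{\min}:=(T_{\max})^*$, which is closed, symmetric, densely defined, with $(T_{\min})^*=T_{\max}$. For $f,g\in\operatorname{dom}(T_{\max})$ the limits $[f,g](a)=\lim_{x\downarrow a}[f,g](x)$ and $[f,g](b)=\lim_{x\uparrow b}[f,g](x)$ exist and are finite. $\tau$ is in the limit circle case at an endpoint if for each $z\in\mathbb C$ all solutions $y\in\mathfrak D(a,b)$ of $\tau y=zy$ are square integrable w.r.t. $r\,dx$ near that endpoint. A boundary condition basis at $c\in\{a,b\}$ is a pair of real-valued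 functions $\phi,\psi\in\operatorname{dom}(T_{\max})$ with $[\psi,\phi](c)=1$. $T_{0,0}$ is the restriction of $T_{\max}$ to $\{g\in\operatorname{dom}(T_{\max}): [g,\phi_a](a)=[g,\phi_b](b)=0\}$. For $\eta\in[0,\pi)$ and $R\in\mathrm{SL}_2(\mathbb R)$, $T_{R,\eta}$ is the restriction of $T_{\max}$ to the set of $g\in\operatorname{dom}(T_{\max})$ with $$\begin{pmatrix}[g,\phi_b](b)\\ [g,\psi_b](b)\end{pmatrix}=e^{i\eta}R\begin{pmatrix}[g,\phi_a](a)\\ [g,\psi_a](a)\end{pmatrix}.$$ Both are known to be self-adjoint extensions of $T_{\min}$. For $z\in\rho(T_{0,0})$, $u_{z,1},u_{z,2}$ are the solutions of $\tau u=zu$ satisfying $$[u_{z,1},\phi_a](a)=0,\ [u_{z,1},\phi_b](b)=1,\qquad [u_{z,2},\phi_a](a)=1,\ [u_{z,2},\phi_b](b)=0.$$ For self-adjoint extensions $T,T'$ of $T_{\min}$, the maximal common part of $T$ and $T'$ is the restriction of $T$ to $\{f\in\operatorname{dom}(T)\cap\operatorname{dom}(T'): Tf=T'f\}$. *)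

theory Defs
  imports "HOL-Analysis.Analysis"
begin

section \<open>The space \<open>L\<^sup>2(M)\<close> and partially defined operators on it\<close>

text \<open>Elements of \<open>L\<^sup>2(M)\<close> are classes of square integrable functions modulo equality almost
  everywhere.\<close>

definition L2_fun :: "'a measure \<Rightarrow> ('a \<Rightarrow> complex) set" where
  "L2_fun M = {f \<in> borel_measurable M. integrable M (\<lambda>x. (cmod (f x))\<^sup>2)}"

definition L2_class :: "'a measure \<Rightarrow> ('a \<Rightarrow> complex) \<Rightarrow> ('a \<Rightarrow> complex) set" where
  "L2_class M f = {g \<in> L2_fun M. AE x in M. g x = f x}"

definition L2_space :: "'a measure \<Rightarrow> ('a \<Rightarrow> complex) set set" where
  "L2_space M = L2_class M ` L2_fun M"

definition L2_rep :: "('a \<Rightarrow> complex) set \<Rightarrow> 'a \<Rightarrow> complex" where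
  "L2_rep F = (SOME f. f \<in> F)"

definition L2_add :: "'a measure \<Rightarrow> ('a \<Rightarrow> complex) set \<Rightarrow> ('a \<Rightarrow> complex) set \<Rightarrow> ('a \<Rightarrow> complex) set" where
  "L2_add M F G = L2_class M (\<lambda>x. L2_rep F x + L2_rep G x)"

definition L2_scale :: "'a measure \<Rightarrow> complex \<Rightarrow> ('a \<Rightarrow> complex) set \<Rightarrow> ('a \<Rightarrow> complex) set" where
  "L2_scale M c F = L2_class M (\<lambda>x. c * L2_rep F x)"

definition L2_inner :: "'a measure \<Rightarrow> ('a \<Rightarrow> complex) set \<Rightarrow> ('a \<Rightarrow> complex) set \<Rightarrow> complex" where
  "L2_inner M F G = (LINT x|M. cnj (L2_rep F x) * L2_rep G x)"

definition L2_norm :: "'a measure \<Rightarrow> ('a \<Rightarrow> complex) set \<Rightarrow> real" where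
  "L2_norm M F = sqrt (Re (L2_inner M F F))"

text \<open>An operator is a partial map from classes to classes: \<open>dom T\<close> is its domain, \<open>ran T\<close> its
  range, \<open>T |` D\<close> its restriction to \<open>D\<close>, and equality of operators includes equality of domains.\<close>

type_synonym 'a L2_op = "('a \<Rightarrow> complex) set \<rightharpoonup> ('a \<Rightarrow> complex) set"

definition op_add :: "'a measure \<Rightarrow> 'a L2_op \<Rightarrow> 'a L2_op \<Rightarrow> 'a L2_op" where
  "op_add M A B =
     (\<lambda>F. if F \<in> dom A \<inter> dom B then Some (L2_add M (the (A F)) (the (B F))) else None)"

definition op_scale :: "'a measure \<Rightarrow> complex \<Rightarrow> 'a L2_op \<Rightarrow> 'a L2_op" where
  "op_scale M c A = (\<lambda>F. map_option (L2_scale M c) (A F))"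

definition op_id :: "'a measure \<Rightarrow> 'a L2_op" where
  "op_id M = (\<lambda>F. if F \<in> L2_space M then Some F else None)"

definition op_shift :: "'a measure \<Rightarrow> 'a L2_op \<Rightarrow> complex \<Rightarrow> 'a L2_op" where
  "op_shift M A z = op_add M A (op_scale M (- z) (op_id M))"

text \<open>The inverse is only meaningful for \<open>A\<close> injective on its domain.\<close>

definition op_inv :: "'a L2_op \<Rightarrow> 'a L2_op" where
  "op_inv A = (\<lambda>G. if G \<in> ran A then Some (THE F. A F = Some G) else None)"

definition rank_one :: "'a measure \<Rightarrow> ('a \<Rightarrow> complex) set \<Rightarrow> ('a \<Rightarrow> complex) set \<Rightarrow> 'a L2_op" where
  "rank_one M U V =
     (\<lambda>G. if G \<in> L2_space M then Some (L2_scale M (L2_inner M U G) V) else None)"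

definition resolvent_op :: "'a measure \<Rightarrow> 'a L2_op \<Rightarrow> complex \<Rightarrow> 'a L2_op" where
  "resolvent_op M A z = op_inv (op_shift M A z)"

definition resolvent_set :: "'a measure \<Rightarrow> 'a L2_op \<Rightarrow> complex set" where
  "resolvent_set M A = {z. inj_on (op_shift M A z) (dom (op_shift M A z))
     \<and> ran (op_shift M A z) = L2_space M
     \<and> (\<exists>C. \<forall>G\<in>L2_space M. L2_norm M (the (resolvent_op M A z G)) \<le> C * L2_norm M G)}"

definition maximal_common_part :: "'a L2_op \<Rightarrow> 'a L2_op \<Rightarrow> 'a L2_op" where
  "maximal_common_part T T' = T |` {F \<in> dom T \<inter> dom T'. T F = T' F}"

section \<open>Local absolute continuity\<close>

definition absolutely_cont_on :: "real \<Rightarrow> real \<Rightarrow> (real \<Rightarrow> complex) \<Rightarrow> bool" where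
  "absolutely_cont_on c d f \<longleftrightarrow>
     (\<forall>\<epsilon>>0. \<exists>\<delta>>0. \<forall>(n::nat) s t.
        (\<forall>i<n. c \<le> s i \<and> s i \<le> t i \<and> t i \<le> d) \<longrightarrow>
        disjoint_family_on (\<lambda>i. {s i<..<t i}) {..<n} \<longrightarrow>
        (\<Sum>i<n. t i - s i) < \<delta> \<longrightarrow>
        (\<Sum>i<n. cmod (f (t i) - f (s i))) < \<epsilon>)"

definition AC_loc :: "real set \<Rightarrow> (real \<Rightarrow> complex) set" where
  "AC_loc J = {f. \<forall>c d. c \<le> d \<longrightarrow> {c..d} \<subseteq> J \<longrightarrow> absolutely_cont_on c d f}"

definition L1_loc :: "real set \<Rightarrow> (real \<Rightarrow> real) set" where
  "L1_loc J = {f. \<forall>c d. c \<le> d \<longrightarrow> {c..d} \<subseteq> J \<longrightarrow> f absolutely_integrable_on {c..d}}"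

section \<open>The Sturm--Liouville expression\<close>

text \<open>The variable \<open>\<tau>\<close> below stands for the data \<open>(a, b, p, q, r)\<close>. Functions on \<open>(a, b)\<close> are
  rendered as functions on the reals whose values outside the interval never matter.\<close>

record sturm_liouville =
  left_end :: ereal
  right_end :: ereal
  coeff_p :: "real \<Rightarrow> real"
  coeff_q :: "real \<Rightarrow> real"
  coeff_r :: "real \<Rightarrow> real"

definition sl_int :: "sturm_liouville \<Rightarrow> real set" where
  "sl_int \<tau> = {x. left_end \<tau> < ereal x \<and> ereal x < right_end \<tau>}"

definition sl_coefficients :: "sturm_liouville \<Rightarrow> bool" where
  "sl_coefficients \<tau> \<longleftrightarrow>
     left_end \<tau> < right_end \<tau>
     \<and> coeff_p \<tau> \<in> borel_measurable (lebesgue_on (sl_int \<tau>))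
     \<and> coeff_q \<tau> \<in> borel_measurable (lebesgue_on (sl_int \<tau>))
     \<and> coeff_r \<tau> \<in> borel_measurable (lebesgue_on (sl_int \<tau>))
     \<and> (AE x in lebesgue_on (sl_int \<tau>). coeff_p \<tau> x > 0)
     \<and> (AE x in lebesgue_on (sl_int \<tau>). coeff_r \<tau> x > 0)
     \<and> (\<lambda>x. inverse (coeff_p \<tau> x)) \<in> L1_loc (sl_int \<tau>)
     \<and> coeff_q \<tau> \<in> L1_loc (sl_int \<tau>)
     \<and> coeff_r \<tau> \<in> L1_loc (sl_int \<tau>)"

definition sl_measure :: "sturm_liouville \<Rightarrow> real measure" where
  "sl_measure \<tau> = density (lebesgue_on (sl_int \<tau>)) (\<lambda>x. ennreal (coeff_r \<tau> x))"

text \<open>The product \<open>p f'\<close> is only determined almost everywhere, so \<open>p f' \<in> AC_loc\<close> means that it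
  agrees almost everywhere with a locally absolutely continuous function. This function is unique
  on the interval, and it is the one that occurs in the Lagrange bracket.\<close>

definition is_quasi_deriv :: "sturm_liouville \<Rightarrow> (real \<Rightarrow> complex) \<Rightarrow> (real \<Rightarrow> complex) \<Rightarrow> bool" where
  "is_quasi_deriv \<tau> f h \<longleftrightarrow> h \<in> AC_loc (sl_int \<tau>) \<and>
     (AE x in lebesgue_on (sl_int \<tau>).
        h x = complex_of_real (coeff_p \<tau> x) * vector_derivative f (at x))"

definition quasi_deriv :: "sturm_liouville \<Rightarrow> (real \<Rightarrow> complex) \<Rightarrow> real \<Rightarrow> complex" where
  "quasi_deriv \<tau> f = (SOME h. is_quasi_deriv \<tau> f h)"

definition sl_domain :: "sturm_liouville \<Rightarrow> (real \<Rightarrow> complex) set" where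
  "sl_domain \<tau> = {f \<in> AC_loc (sl_int \<tau>). \<exists>h. is_quasi_deriv \<tau> f h}"

definition sl_expr :: "sturm_liouville \<Rightarrow> (real \<Rightarrow> complex) \<Rightarrow> real \<Rightarrow> complex" where
  "sl_expr \<tau> f x = (- vector_derivative (quasi_deriv \<tau> f) (at x)
     + complex_of_real (coeff_q \<tau> x) * f x) / complex_of_real (coeff_r \<tau> x)"

definition sl_solution :: "sturm_liouville \<Rightarrow> complex \<Rightarrow> (real \<Rightarrow> complex) \<Rightarrow> bool" where
  "sl_solution \<tau> z y \<longleftrightarrow> y \<in> sl_domain \<tau> \<and>
     (AE x in lebesgue_on (sl_int \<tau>). sl_expr \<tau> y x = z * y x)"

definition lagrange_bracket ::
    "sturm_liouville \<Rightarrow> (real \<Rightarrow> complex) \<Rightarrow> (real \<Rightarrow> complex) \<Rightarrow> real \<Rightarrow> complex" where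
  "lagrange_bracket \<tau> f g x = f x * cnj (quasi_deriv \<tau> g x) - quasi_deriv \<tau> f x * cnj (g x)"

definition bracket_left ::
    "sturm_liouville \<Rightarrow> (real \<Rightarrow> complex) \<Rightarrow> (real \<Rightarrow> complex) \<Rightarrow> complex" where
  "bracket_left \<tau> f g = Lim (at_right (left_end \<tau>)) (lagrange_bracket \<tau> f g \<circ> real_of_ereal)"

definition bracket_right ::
    "sturm_liouville \<Rightarrow> (real \<Rightarrow> complex) \<Rightarrow> (real \<Rightarrow> complex) \<Rightarrow> complex" where
  "bracket_right \<tau> f g = Lim (at_left (right_end \<tau>)) (lagrange_bracket \<tau> f g \<circ> real_of_ereal)"

definition limit_circle_left :: "sturm_liouville \<Rightarrow> bool" where
  "limit_circle_left \<tau> \<longleftrightarrow> (\<forall>z y. sl_solution \<tau> z y \<longrightarrow>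
     (\<exists>c\<in>sl_int \<tau>. set_integrable (sl_measure \<tau>) {..<c} (\<lambda>x. (cmod (y x))\<^sup>2)))"

definition limit_circle_right :: "sturm_liouville \<Rightarrow> bool" where
  "limit_circle_right \<tau> \<longleftrightarrow> (\<forall>z y. sl_solution \<tau> z y \<longrightarrow>
     (\<exists>c\<in>sl_int \<tau>. set_integrable (sl_measure \<tau>) {c<..} (\<lambda>x. (cmod (y x))\<^sup>2)))"

section \<open>The operators\<close>

definition dom_max :: "sturm_liouville \<Rightarrow> (real \<Rightarrow> complex) set" where
  "dom_max \<tau> = {g \<in> sl_domain \<tau>. g \<in> L2_fun (sl_measure \<tau>) \<and> sl_expr \<tau> g \<in> L2_fun (sl_measure \<tau>)}"

text \<open>A class contains representatives from \<open>dom_max\<close> that agree on the interval, so the choice of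
  \<open>y\<close> does not matter.\<close>

definition T_max :: "sturm_liouville \<Rightarrow> real L2_op" where
  "T_max \<tau> = (\<lambda>F. if F \<in> L2_class (sl_measure \<tau>) ` dom_max \<tau>
     then Some (L2_class (sl_measure \<tau>)
            (sl_expr \<tau> (SOME y. y \<in> dom_max \<tau> \<and> F = L2_class (sl_measure \<tau>) y)))
     else None)"

definition T_max_restr :: "sturm_liouville \<Rightarrow> (real \<Rightarrow> complex) set \<Rightarrow> real L2_op" where
  "T_max_restr \<tau> D = T_max \<tau> |` (L2_class (sl_measure \<tau>) ` D)"

definition bc_basis_left :: "sturm_liouville \<Rightarrow> (real \<Rightarrow> complex) \<Rightarrow> (real \<Rightarrow> complex) \<Rightarrow> bool" where
  "bc_basis_left \<tau> \<phi> \<psi> \<longleftrightarrow> \<phi> \<in> dom_max \<tau> \<and> \<psi> \<in> dom_max \<tau>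
     \<and> (\<forall>x\<in>sl_int \<tau>. \<phi> x \<in> \<real> \<and> \<psi> x \<in> \<real>) \<and> bracket_left \<tau> \<psi> \<phi> = 1"

definition bc_basis_right :: "sturm_liouville \<Rightarrow> (real \<Rightarrow> complex) \<Rightarrow> (real \<Rightarrow> complex) \<Rightarrow> bool" where
  "bc_basis_right \<tau> \<phi> \<psi> \<longleftrightarrow> \<phi> \<in> dom_max \<tau> \<and> \<psi> \<in> dom_max \<tau>
     \<and> (\<forall>x\<in>sl_int \<tau>. \<phi> x \<in> \<real> \<and> \<psi> x \<in> \<real>) \<and> bracket_right \<tau> \<psi> \<phi> = 1"

definition T_zero :: "sturm_liouville \<Rightarrow> (real \<Rightarrow> complex) \<Rightarrow> (real \<Rightarrow> complex) \<Rightarrow> real L2_op" where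
  "T_zero \<tau> \<phi>a \<phi>b =
     T_max_restr \<tau> {g \<in> dom_max \<tau>. bracket_left \<tau> g \<phi>a = 0 \<and> bracket_right \<tau> g \<phi>b = 0}"

definition T_coupled :: "sturm_liouville \<Rightarrow> (real \<Rightarrow> complex) \<Rightarrow> (real \<Rightarrow> complex)
    \<Rightarrow> (real \<Rightarrow> complex) \<Rightarrow> (real \<Rightarrow> complex) \<Rightarrow> real^2^2 \<Rightarrow> real \<Rightarrow> real L2_op" where
  "T_coupled \<tau> \<phi>a \<psi>a \<phi>b \<psi>b R \<eta> = T_max_restr \<tau>
     {g \<in> dom_max \<tau>.
        (vector [bracket_right \<tau> g \<phi>b, bracket_right \<tau> g \<psi>b] :: complex^2) =
        exp (\<i> * of_real \<eta>) *s
          ((\<chi> i j. complex_of_real (R $ i $ j)) *v vector [bracket_left \<tau> g \<phi>a, bracket_left \<tau> g \<psi>a])}"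

definition common_dom :: "sturm_liouville \<Rightarrow> (real \<Rightarrow> complex) \<Rightarrow> (real \<Rightarrow> complex)
    \<Rightarrow> (real \<Rightarrow> complex) \<Rightarrow> (real \<Rightarrow> complex) \<Rightarrow> real^2^2 \<Rightarrow> real \<Rightarrow> (real \<Rightarrow> complex) set" where
  "common_dom \<tau> \<phi>a \<psi>a \<phi>b \<psi>b R \<eta> =
     {y \<in> dom_max \<tau>. bracket_left \<tau> y \<phi>a = 0 \<and> bracket_right \<tau> y \<phi>b = 0 \<and>
        bracket_right \<tau> y \<psi>b = exp (\<i> * of_real \<eta>) * of_real (R $ 2 $ 2) * bracket_left \<tau> y \<psi>a}"

definition u_coupled :: "(complex \<Rightarrow> real \<Rightarrow> complex) \<Rightarrow> (complex \<Rightarrow> real \<Rightarrow> complex)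
    \<Rightarrow> real^2^2 \<Rightarrow> real \<Rightarrow> complex \<Rightarrow> real \<Rightarrow> complex" where
  "u_coupled u1 u2 R \<eta> z x = exp (- \<i> * of_real \<eta>) * of_real (R $ 2 $ 2) * u2 z x + u1 z x"

definition k_coupled :: "sturm_liouville \<Rightarrow> (real \<Rightarrow> complex) \<Rightarrow> (real \<Rightarrow> complex) \<Rightarrow>
    (complex \<Rightarrow> real \<Rightarrow> complex) \<Rightarrow> (complex \<Rightarrow> real \<Rightarrow> complex)
    \<Rightarrow> real^2^2 \<Rightarrow> real \<Rightarrow> complex \<Rightarrow> complex" where
  "k_coupled \<tau> \<psi>a \<psi>b u1 u2 R \<eta> z =
     of_real (R $ 2 $ 1 * R $ 2 $ 2)
     + exp (\<i> * of_real \<eta>) * of_real (R $ 2 $ 2) * bracket_left \<tau> (u_coupled u1 u2 R \<eta> z) \<psi>a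
     - bracket_right \<tau> (u_coupled u1 u2 R \<eta> z) \<psi>b"

end

theory Submission
  imports Defs
begin

text \<open>Fix \<open>z\<close> in both resolvent sets and a right-hand side \<open>g\<close>, and let \<open>f\<close> and \<open>f\<^sub>0\<close> be the images of
  \<open>g\<close> under the two resolvents. Their difference solves \<open>\<tau> w = z w\<close>, and subtracting
  \<open>[w,\<phi>\<^sub>b](b) u\<^sub>1 + [w,\<phi>\<^sub>a](a) u\<^sub>2\<close> from \<open>f\<close> gives a function that satisfies the boundary conditions of
  \<open>T\<^sub>0\<^sub>,\<^sub>0\<close> and is still mapped to \<open>g\<close>; injectivity of \<open>T\<^sub>0\<^sub>,\<^sub>0 - z\<close> identifies it with \<open>f\<^sub>0\<close>. Since
  \<open>R\<^sub>1\<^sub>2 = 0\<close> forces \<open>R\<^sub>1\<^sub>1 R\<^sub>2\<^sub>2 = 1\<close>, the first coupled boundary condition makes the two coefficients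
  proportional, so that \<open>f = f\<^sub>0 + c u\<close> with the single solution \<open>u = u\<^sub>z\<^sub>,\<^sub>R\<^sub>,\<^sub>\<eta>\<close>. The second coupled
  condition then reads \<open>c k = [f\<^sub>0,\<psi>\<^sub>b](b) - e\<^sup>i\<^sup>\<eta> R\<^sub>2\<^sub>2 [f\<^sub>0,\<psi>\<^sub>a](a)\<close>.

  The right-hand side is the inner product of \<open>g\<close> with the solution \<open>u'\<close> at \<open>cnj z\<close>: the Lagrange identity
  turns that inner product into \<open>[f\<^sub>0,u'](b) - [f\<^sub>0,u'](a)\<close> (lemma \<open>resolvent_pairing\<close>), and the
  Pluecker identity, in the limit at an endpoint, expresses each of these brackets through the
  brackets with \<open>\<phi>\<close> and \<open>\<psi>\<close> (lemma \<open>blim_pluecker\<close>). Hence \<open>c k = \<langle>u',g\<rangle>\<close>. If \<open>k\<close> were zero,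
  \<open>u\<close> itself would satisfy the coupled boundary conditions and be an eigenfunction of \<open>T\<^sub>R\<^sub>,\<^sub>\<eta>\<close> for \<open>z\<close>, which
  is impossible as \<open>[u,\<phi>\<^sub>b](b) = 1\<close>. That the solutions at \<open>cnj z\<close> are at our disposal follows
  from the reality of the coefficients and of \<open>\<phi>\<^sub>a\<close>, \<open>\<phi>\<^sub>b\<close>: complex conjugation commutes with
  \<open>T\<^sub>0\<^sub>,\<^sub>0\<close>, so its resolvent set is symmetric (lemma \<open>resolvent_set_cnj\<close>).

  The analytic input is the Lagrange identity for functions that are merely locally absolutely
  continuous. It rests on two facts about an absolutely continuous function: it is differentiable almost
  everywhere (lemma \<open>AC_real_differentiable_AE\<close>, from the Vitali covering theorem) and it is the integral of
  its derivative (\<open>AC_fundamental_theorem_of_calculus\<close>, a gauge argument). Existence of the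
  bracket limits at the endpoints is then dominated convergence.\<close>


section \<open>Absolute continuity in terms of divisions\<close>

text \<open>Absolute continuity phrased with finite sets of non-overlapping intervals instead of indexed
  families: this is the form in which the increments of a function can be refined and regrouped
  with the library's divisions.\<close>

definition AC_divisions :: "real \<Rightarrow> real \<Rightarrow> (real \<Rightarrow> 'a::real_normed_vector) \<Rightarrow> bool" where
  "AC_divisions c d f \<longleftrightarrow>
     (\<forall>\<epsilon>>0. \<exists>\<delta>>0. \<forall>p. p division_of \<Union>p \<longrightarrow> \<Union>p \<subseteq> {c..d} \<longrightarrow> sum (measure lborel) p < \<delta> \<longrightarrow>
        (\<Sum>K\<in>p. norm (f (Sup K) - f (Inf K))) < \<epsilon>)"

lemma division_real_interval:
  fixes p :: "real set set"
  assumes "p division_of S" "K \<in> p"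
  shows "Inf K \<le> Sup K" "K = {Inf K..Sup K}" "measure lborel K = Sup K - Inf K"
    "interior K = {Inf K<..<Sup K}" "Inf K \<in> K" "Sup K \<in> K"
proof -
  obtain a b where K: "K = {a..b}"
    using division_ofD(4)[OF assms] by auto
  have "K \<noteq> {}" using division_ofD(3)[OF assms] .
  then have "a \<le> b" using K by simp
  with K show "Inf K \<le> Sup K" "K = {Inf K..Sup K}" "measure lborel K = Sup K - Inf K"
    "interior K = {Inf K<..<Sup K}" "Inf K \<in> K" "Sup K \<in> K"
    by (auto simp: interior_atLeastAtMost_real)
qed

lemma absolutely_cont_on_imp_AC_divisions:
  assumes "absolutely_cont_on c d f"
  shows "AC_divisions c d f"
  unfolding AC_divisions_def
proof (intro allI impI)
  fix \<epsilon> :: real assume "\<epsilon> > 0"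
  with assms obtain \<delta> where "\<delta> > 0" and \<delta>': "\<forall>(n::nat) s t.
        (\<forall>i<n. c \<le> s i \<and> s i \<le> t i \<and> t i \<le> d) \<longrightarrow>
        disjoint_family_on (\<lambda>i. {s i<..<t i}) {..<n} \<longrightarrow>
        (\<Sum>i<n. t i - s i) < \<delta> \<longrightarrow>
        (\<Sum>i<n. cmod (f (t i) - f (s i))) < \<epsilon>"
    unfolding absolutely_cont_on_def by blast
  note \<delta> = \<delta>'[rule_format]
  show "\<exists>\<delta>>0. \<forall>p. p division_of \<Union>p \<longrightarrow> \<Union>p \<subseteq> {c..d} \<longrightarrow> sum (measure lborel) p < \<delta> \<longrightarrow>
        (\<Sum>K\<in>p. norm (f (Sup K) - f (Inf K))) < \<epsilon>"
  proof (intro exI[of _ \<delta>] conjI allI impI \<open>\<delta> > 0\<close>)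
    fix p :: "real set set"
    assume p: "p division_of \<Union>p" and sub: "\<Union>p \<subseteq> {c..d}" and small: "sum (measure lborel) p < \<delta>"
    have "finite p" using p by (rule division_of_finite)
    then obtain h where h: "bij_betw h {0..<card p} p" using ex_bij_betw_nat_finite by blast
    then have hp: "h i \<in> p" if "i < card p" for i
      using that by (auto simp: bij_betw_def)
    have ints: "\<forall>i<card p. c \<le> Inf (h i) \<and> Inf (h i) \<le> Sup (h i) \<and> Sup (h i) \<le> d"
    proof (intro allI impI)
      fix i assume "i < card p"
      with hp have K: "h i \<in> p" by blast
      with sub have "h i \<subseteq> {c..d}" by blast
      then show "c \<le> Inf (h i) \<and> Inf (h i) \<le> Sup (h i) \<and> Sup (h i) \<le> d"
        using division_real_interval[OF p K] by auto
    qed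
    have disj: "disjoint_family_on (\<lambda>i. {Inf (h i)<..<Sup (h i)}) {..<card p}"
      unfolding disjoint_family_on_def
    proof (intro ballI impI)
      fix i j assume ij: "i \<in> {..<card p}" "j \<in> {..<card p}" "i \<noteq> j"
      then have "h i \<noteq> h j" using h by (auto simp: bij_betw_def inj_on_def)
      moreover have "h i \<in> p" "h j \<in> p" using hp ij by auto
      ultimately have "interior (h i) \<inter> interior (h j) = {}"
        using division_ofD(5)[OF p] by blast
      then show "{Inf (h i)<..<Sup (h i)} \<inter> {Inf (h j)<..<Sup (h j)} = {}"
        using division_real_interval(4)[OF p \<open>h i \<in> p\<close>] division_real_interval(4)[OF p \<open>h j \<in> p\<close>]
        by simp
    qed
    have "(\<Sum>i<card p. Sup (h i) - Inf (h i)) = sum (measure lborel) p"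
      using sum.reindex_bij_betw[OF h, of "measure lborel"] division_real_interval(3)[OF p hp]
      by (simp add: lessThan_atLeast0)
    then have "(\<Sum>i<card p. cmod (f (Sup (h i)) - f (Inf (h i)))) < \<epsilon>"
      using \<delta>[of "card p" "\<lambda>i. Inf (h i)" "\<lambda>i. Sup (h i)"] ints disj small by simp
    then show "(\<Sum>K\<in>p. norm (f (Sup K) - f (Inf K))) < \<epsilon>"
      using sum.reindex_bij_betw[OF h, of "\<lambda>K. norm (f (Sup K) - f (Inf K))"]
      by (simp add: lessThan_atLeast0)
  qed
qed

lemma AC_divisions_Re:
  assumes "AC_divisions c d f" shows "AC_divisions c d (\<lambda>x. Re (f x))"
proof -
  have "(\<Sum>K\<in>p. norm (Re (f (Sup K)) - Re (f (Inf K)))) \<le> (\<Sum>K\<in>p. norm (f (Sup K) - f (Inf K)))" for p :: "real set set"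
    by (intro sum_mono) (metis abs_Re_le_cmod minus_complex.sel(1) real_norm_def)
  then show ?thesis using assms unfolding AC_divisions_def by (meson le_less_trans)
qed

lemma AC_divisions_Im:
  assumes "AC_divisions c d f" shows "AC_divisions c d (\<lambda>x. Im (f x))"
proof -
  have "(\<Sum>K\<in>p. norm (Im (f (Sup K)) - Im (f (Inf K)))) \<le> (\<Sum>K\<in>p. norm (f (Sup K) - f (Inf K)))" for p :: "real set set"
    by (intro sum_mono) (metis abs_Im_le_cmod minus_complex.sel(2) real_norm_def)
  then show ?thesis using assms unfolding AC_divisions_def by (meson le_less_trans)
qed

lemma division_lmeasurable:
  fixes p :: "real set set"
  assumes "p division_of S"
  shows "S \<in> lmeasurable"
proof -
  have "compact (\<Union>p)"
  proof (rule compact_Union)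
    show "finite p" using assms by (rule division_of_finite)
    show "compact K" if "K \<in> p" for K
      using division_ofD(4)[OF assms that] by (metis compact_cbox)
  qed
  then show ?thesis
    using division_ofD(6)[OF assms] lmeasurable_compact by simp
qed

lemma sum_content_division_measure:
  fixes p :: "real set set"
  assumes "p division_of S"
  shows "sum (measure lborel) p = measure lebesgue S"
proof -
  have "((\<lambda>x. 1::real) has_integral sum (measure lborel) p) S"
    using assms
  proof (rule has_integral_combine_division)
    fix K assume "K \<in> p"
    then obtain a b where "K = cbox a b" using division_ofD(4)[OF assms] by blast
    then show "((\<lambda>x. 1::real) has_integral measure lborel K) K"
      using has_integral_const[of "1::real" a b] by simp
  qed
  moreover have "((\<lambda>x. 1::real) has_integral measure lebesgue S) S"
    using division_lmeasurable[OF assms]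
    by (simp add: has_integral_iff lmeasurable_iff_integrable_on lmeasure_integral)
  ultimately show ?thesis
    by (rule has_integral_unique)
qed

lemma sum_content_division_le:
  fixes p :: "real set set"
  assumes "p division_of \<Union>p" "\<Union>p \<subseteq> U" "U \<in> lmeasurable"
  shows "sum (measure lborel) p \<le> measure lebesgue U"
proof -
  have "\<Union>p \<in> lmeasurable"
    by (rule division_lmeasurable[OF assms(1)])
  then show ?thesis
    using sum_content_division_measure[OF assms(1)] measure_mono_fmeasurable[OF assms(2) _ assms(3)]
    by (simp add: fmeasurableD)
qed

lemma sum_increments_division:
  fixes f :: "real \<Rightarrow> 'a::real_normed_vector"
  assumes "a \<le> b" "q division_of {a..b}"
  shows "(\<Sum>K\<in>q. f (Sup K) - f (Inf K)) = f b - f a"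
proof -
  let ?p = "(\<lambda>K. (Inf K, K)) ` q"
  have "?p tagged_division_of {a..b}"
  proof (rule tagged_division_ofI)
    show "finite ?p" using division_ofD(1)[OF assms(2)] by simp
  next
    fix x K assume "(x, K) \<in> ?p"
    then have K: "K \<in> q" "x = Inf K" by auto
    show "x \<in> K" using division_real_interval(5)[OF assms(2) K(1)] K(2) by simp
    show "K \<subseteq> {a..b}" using division_ofD(2)[OF assms(2) K(1)] .
    show "\<exists>a b. K = cbox a b" using division_ofD(4)[OF assms(2) K(1)] .
  next
    fix x1 K1 x2 K2 assume "(x1, K1) \<in> ?p" "(x2, K2) \<in> ?p" "(x1, K1) \<noteq> (x2, K2)"
    then have "K1 \<in> q" "K2 \<in> q" "K1 \<noteq> K2" by auto
    then show "interior K1 \<inter> interior K2 = {}" using division_ofD(5)[OF assms(2)] by blast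
  next
    have "{K. \<exists>x. (x, K) \<in> ?p} = q" by auto
    then show "\<Union>{K. \<exists>x. (x, K) \<in> ?p} = {a..b}" using division_ofD(6)[OF assms(2)] by simp
  qed
  then have "sum (\<lambda>(x,K). f(Sup K) - f(Inf K)) ?p = f b - f a"
    by (rule additive_tagged_division_1[OF assms(1)])
  moreover have "inj_on (\<lambda>K::real set. (Inf K, K)) q" by (auto simp: inj_on_def)
  ultimately show ?thesis by (simp add: sum.reindex)
qed

section \<open>Differentiability almost everywhere\<close>

text \<open>The Vitali covering theorem, cut down to finitely many intervals: the countable disjoint family
  that covers \<open>S\<close> up to a null set has a finite subfamily of almost the same length.\<close>

lemma Vitali_covering_intervals:
  fixes S U :: "real set" and P :: "real \<Rightarrow> real \<Rightarrow> bool"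
  assumes S: "S \<in> lmeasurable" "S \<subseteq> U" and U: "open U" "U \<in> lmeasurable" and "\<eta> > 0"
    and P: "\<And>x e. x \<in> S \<Longrightarrow> e > 0 \<Longrightarrow> \<exists>s t. s < t \<and> t - s < e \<and> x \<in> {s..t} \<and> P s t"
  obtains D where "D division_of \<Union>D" "\<Union>D \<subseteq> U" "pairwise disjnt D"
    "\<And>K. K \<in> D \<Longrightarrow> P (Inf K) (Sup K)" "measure lebesgue S - \<eta> < sum (measure lborel) D"
proof -
  define I where "I = {(s,t). s < t \<and> {s..t} \<subseteq> U \<and> P s t}"
  have ball: "cball ((fst i + snd i) / 2) ((snd i - fst i) / 2) = {fst i..snd i}" for i :: "real \<times> real"
    by (simp add: cball_eq_atLeastAtMost field_simps)
  have rpos: "0 < (snd i - fst i) / 2" if "i \<in> I" for i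
    using that by (auto simp: I_def)
  have fine: "\<exists>i. i \<in> I \<and> x \<in> cball ((fst i + snd i) / 2) ((snd i - fst i) / 2) \<and> (snd i - fst i) / 2 < e"
    if x: "x \<in> S" and "e > 0" for x e
  proof -
    obtain e0 where e0: "e0 > 0" "ball x e0 \<subseteq> U"
      using S(2) U(1) x by (meson openE subsetD)
    obtain s t where st: "s < t" "t - s < min e e0" "x \<in> {s..t}" "P s t"
      using P[OF x, of "min e e0"] e0 \<open>e > 0\<close> by auto
    have "{s..t} \<subseteq> ball x e0" using st by (auto simp: dist_real_def)
    then have "(s,t) \<in> I" using e0 st by (auto simp: I_def)
    then show ?thesis using st \<open>e > 0\<close> unfolding ball
      by (intro exI[of _ "(s,t)"]) auto
  qed
  obtain C where C: "countable C" "C \<subseteq> I"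
     "pairwise (\<lambda>i j. disjnt {fst i..snd i} {fst j..snd j}) C"
     "negligible (S - (\<Union>i \<in> C. {fst i..snd i}))"
    using Vitali_covering_theorem_cballs[of I "\<lambda>i. (snd i - fst i) / 2" S "\<lambda>i. (fst i + snd i) / 2", OF rpos fine]
    unfolding ball by blast
  let ?D0 = "(\<lambda>i. {fst i..snd i}) ` C"
  have D0U: "\<Union>?D0 \<subseteq> U" using C(2) unfolding I_def by fastforce
  have D0m: "\<Union>?D0 \<in> lmeasurable"
  proof (rule fmeasurableI2[OF U(2) D0U])
    show "\<Union>?D0 \<in> sets lebesgue" using C(1) by (auto intro!: sets.countable_UN')
  qed
  have fin_le: "measure lebesgue (\<Union>D') \<le> measure lebesgue U" if "D' \<subseteq> ?D0" "finite D'" for D'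
  proof (rule measure_mono_fmeasurable[OF _ _ U(2)])
    show "\<Union>D' \<subseteq> U" using that D0U by blast
    show "\<Union>D' \<in> sets lebesgue" using that by (intro sets.finite_Union) auto
  qed
  obtain D where D: "D \<subseteq> ?D0" "finite D" "measure lebesgue (\<Union>?D0) - \<eta> < measure lebesgue (\<Union>D)"
    using measure_countable_Union_approachable[OF _ \<open>\<eta> > 0\<close> _ fin_le, of ?D0] C(1) by auto
  have DI: "\<exists>s t. K = {s..t} \<and> (s,t) \<in> C" if "K \<in> D" for K using D(1) that by force
  have dis: "pairwise disjnt D"
  proof (rule pairwiseI)
    fix K L assume KL: "K \<in> D" "L \<in> D" "K \<noteq> L"
    obtain i j where "i \<in> C" "j \<in> C" "K = {fst i..snd i}" "L = {fst j..snd j}" using KL D(1) by blast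
    moreover from this have "i \<noteq> j" using KL(3) by auto
    ultimately show "disjnt K L" using pairwiseD[OF C(3), of i j] by simp
  qed
  have "D division_of \<Union>D"
  proof (rule division_ofI)
    fix K assume "K \<in> D"
    then obtain s t where st: "K = {s..t}" "(s,t) \<in> C" using DI by blast
    then show "K \<noteq> {}" using C(2) by (auto simp: I_def)
    show "\<exists>a b. K = cbox a b" using st by auto
  next
    fix K L assume KL: "K \<in> D" "L \<in> D" "K \<noteq> L"
    then have "disjnt K L" using dis by (auto simp: pairwise_def)
    then show "interior K \<inter> interior L = {}"
      using interior_subset[of K] interior_subset[of L] unfolding disjnt_def by blast
  qed (use D in auto)
  moreover have "P (Inf K) (Sup K)" if "K \<in> D" for K
  proof -
    obtain s t where "K = {s..t}" "(s,t) \<in> C" using DI \<open>K \<in> D\<close> by blast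
    then show ?thesis using C(2) by (auto simp: I_def)
  qed
  moreover have "measure lebesgue S \<le> measure lebesgue (\<Union>?D0)"
  proof -
    have "measure lebesgue (S \<inter> \<Union>?D0) = measure lebesgue S"
    proof (rule measure_negligible_symdiff)
      show "S \<in> lmeasurable" by fact
      show "negligible (sym_diff S (S \<inter> \<Union>?D0))"
        by (rule negligible_subset[OF C(4)]) auto
    qed
    moreover have "measure lebesgue (S \<inter> \<Union>?D0) \<le> measure lebesgue (\<Union>?D0)"
      using S(1) D0m by (intro measure_mono_fmeasurable) (auto simp: fmeasurableD)
    ultimately show ?thesis by simp
  qed
  ultimately show ?thesis
  proof -
    assume a: "D division_of \<Union>D" "\<And>K. K \<in> D \<Longrightarrow> P (Inf K) (Sup K)"
      "measure lebesgue S \<le> measure lebesgue (\<Union>?D0)"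
    have "\<Union>D \<subseteq> U" using D(1) D0U by blast
    moreover have "measure lebesgue S - \<eta> < sum (measure lborel) D"
      using D(3) a(3) sum_content_division_measure[OF a(1)] by linarith
    ultimately show ?thesis using that[OF a(1) _ dis a(2)] by blast
  qed
qed


text \<open>Suppose that arbitrarily short intervals at each point of \<open>E\<close> have slope at most \<open>s\<close>, and others slope
  at least \<open>t > s\<close>. Vitali gives disjoint intervals \<open>B\<close> of slope \<open>\<le> s\<close> inside a tight open
  neighbourhood of \<open>E\<close>, and, inside these, intervals \<open>A\<close> of slope \<open>\<ge> t\<close> that still exhaust almost all of \<open>E\<close>.
  The gaps \<open>B - A\<close> have small total length, so by absolute continuity \<open>f\<close> increases over \<open>A\<close>
  and over \<open>B\<close> by nearly the same amount. But the increase is at most \<open>s \<bar>B\<bar>\<close> and at least \<open>t \<bar>A\<bar>\<close>, and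
  both lengths are close to the measure of \<open>E\<close>, which must therefore vanish.\<close>

lemma two_slopes_negligible:
  fixes f :: "real \<Rightarrow> real"
  assumes AC: "AC_divisions c d f" and "s < t"
    and E: "E \<in> sets lebesgue" "E \<subseteq> {c<..<d}"
    and low: "\<And>x e. x \<in> E \<Longrightarrow> e > 0 \<Longrightarrow> \<exists>u v. u < v \<and> v - u < e \<and> x \<in> {u..v} \<and> f v - f u \<le> s * (v - u)"
    and high: "\<And>x e. x \<in> E \<Longrightarrow> e > 0 \<Longrightarrow> \<exists>u v. u < v \<and> v - u < e \<and> x \<in> {u..v} \<and> f v - f u \<ge> t * (v - u)"
  shows "negligible E"
proof (rule ccontr)
  let ?\<mu> = "measure lebesgue"
  assume "\<not> negligible E"
  have Elm: "E \<in> lmeasurable"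
    using E bounded_set_imp_lmeasurable bounded_subset[OF bounded_box, of E c d] by (simp add: box_real)
  define m where "m = ?\<mu> E"
  have "m > 0"
    using \<open>\<not> negligible E\<close> Elm unfolding m_def
    by (metis completion.complete_measure_axioms measure_nonneg negligible_iff_measure order_le_imp_less_or_eq)
  \<comment> \<open>Together the errors must stay below \<open>(t - s) m\<close>. The errors are \<open>\<epsilon>\<close> from the gaps, at most \<open>4 \<eta>\<close> between \<open>\<bar>A\<bar>\<close> and \<open>\<bar>B\<bar>\<close>, and \<open>3 \<eta>\<close> between \<open>\<bar>A\<bar>\<close> and \<open>m\<close>.\<close>
  define \<epsilon> where "\<epsilon> = (t - s) * m / 4"
  have "\<epsilon> > 0" using \<open>s < t\<close> \<open>m > 0\<close> by (simp add: \<epsilon>_def)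
  then obtain \<delta> where "\<delta> > 0" and \<delta>: "\<And>p. p division_of \<Union>p \<Longrightarrow> \<Union>p \<subseteq> {c..d} \<Longrightarrow> sum (measure lborel) p < \<delta> \<Longrightarrow>
        (\<Sum>K\<in>p. norm (f (Sup K) - f (Inf K))) < \<epsilon>"
    using AC unfolding AC_divisions_def by blast
  define \<eta> where "\<eta> = min (\<delta> / 8) (min (m / 12) ((t - s) * m / (16 * (\<bar>s\<bar> + 1))))"
  have "\<eta> > 0" using \<open>\<delta> > 0\<close> \<open>m > 0\<close> \<open>s < t\<close> by (simp add: \<eta>_def)
  have \<eta>1: "4 * \<eta> < \<delta>" "3 * \<eta> \<le> m / 4"
  proof -
    have "\<eta> \<le> \<delta> / 8" "\<eta> \<le> m / 12" unfolding \<eta>_def by linarith+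
    then show "4 * \<eta> < \<delta>" "3 * \<eta> \<le> m / 4" using \<open>\<delta> > 0\<close> by linarith+
  qed
  have "\<eta> \<le> (t - s) * m / (16 * (\<bar>s\<bar> + 1))" by (simp add: \<eta>_def)
  then have "4 * (\<bar>s\<bar> + 1) * \<eta> \<le> (t - s) * m / 4" by (simp add: field_simps)
  then have \<eta>2: "\<bar>s\<bar> * (4 * \<eta>) \<le> (t - s) * m / 4" using \<open>\<eta> > 0\<close> by (simp add: algebra_simps)
  obtain T where T: "open T" "E \<subseteq> T" "T - E \<in> lmeasurable" "emeasure lebesgue (T - E) < ennreal \<eta>"
    using sets_lebesgue_outer_open[OF E(1) \<open>\<eta> > 0\<close>] .
  define U where "U = T \<inter> {c<..<d}"
  have U: "open U" "E \<subseteq> U" "U \<subseteq> {c..d}" using T E by (auto simp: U_def)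
  have Ulm: "U \<in> lmeasurable"
    using U bounded_subset[OF bounded_closed_interval[of c d]] lmeasurable_open by (auto simp: box_real)
  have UE: "?\<mu> U \<le> m + \<eta>"
  proof -
    have "?\<mu> U = ?\<mu> E + ?\<mu> (U - E)"
      using measure_Un2[OF Elm Ulm] U(2) by (simp add: Un_absorb1)
    moreover have "?\<mu> (U - E) \<le> ?\<mu> (T - E)"
      using T(3) Ulm Elm by (intro measure_mono_fmeasurable) (auto simp: U_def fmeasurableD)
    moreover have "?\<mu> (T - E) \<le> \<eta>"
      using T(3,4) \<open>\<eta> > 0\<close> by (simp add: emeasure_eq_measure2 ennreal_less_iff)
    ultimately show ?thesis by (simp add: m_def)
  qed
  obtain B where B: "B division_of \<Union>B" "\<Union>B \<subseteq> U" "pairwise disjnt B"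
    "\<And>K. K \<in> B \<Longrightarrow> f (Sup K) - f (Inf K) \<le> s * (Sup K - Inf K)" "m - \<eta> < sum (measure lborel) B"
    unfolding m_def by (rule Vitali_covering_intervals[OF Elm U(2,1) Ulm \<open>\<eta> > 0\<close> low]) auto
  note finB = division_of_finite[OF B(1)]
  \<comment> \<open>The second covering is taken inside the interiors, so that each of its intervals lies in a single member of \<open>B\<close>.\<close>
  define V where "V = (\<Union>K\<in>B. interior K)"
  have V: "open V" "V \<subseteq> \<Union>B" using interior_subset by (auto simp: V_def)
  have Vlm: "V \<in> lmeasurable"
    using V bounded_subset[OF elementary_bounded[OF B(1)]] by (intro lmeasurable_open) auto
  have "?\<mu> (E \<inter> V) \<ge> m - 2 * \<eta>"
  proof -
    have "negligible (\<Union>B - V)"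
    proof (rule negligible_subset)
      show "negligible (\<Union>K\<in>B. {Inf K, Sup K})" using finB by (intro negligible_Union[of "_ ` B", simplified]) auto
      show "\<Union>B - V \<subseteq> (\<Union>K\<in>B. {Inf K, Sup K})"
      proof
        fix x assume "x \<in> \<Union>B - V"
        then obtain K where K: "K \<in> B" "x \<in> K" "x \<notin> interior K" by (auto simp: V_def)
        then have "x = Inf K \<or> x = Sup K"
          using division_real_interval(2,4)[OF B(1) K(1)] by (metis atLeastAtMost_iff greaterThanLessThan_iff less_eq_real_def)
        then show "x \<in> (\<Union>K\<in>B. {Inf K, Sup K})" using K(1) by blast
      qed
    qed
    moreover have "sym_diff V (\<Union>B) = \<Union>B - V" using V(2) by blast
    ultimately have "?\<mu> V = ?\<mu> (\<Union>B)"
      using measure_negligible_symdiff[OF Vlm, of "\<Union>B"] by simp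
    then have "m - \<eta> < ?\<mu> V" using B(5) sum_content_division_measure[OF B(1)] by simp
    moreover have "?\<mu> V + ?\<mu> E = ?\<mu> (V \<union> E) + ?\<mu> (V \<inter> E)"
      using measure_Un3[of V lebesgue E] Vlm Elm by simp
    moreover have "?\<mu> (V \<union> E) \<le> ?\<mu> U"
      using V B(2) U Ulm Vlm Elm by (intro measure_mono_fmeasurable) (auto simp: fmeasurableD)
    ultimately show ?thesis using UE by (simp add: m_def Int_commute)
  qed
  obtain A where A: "A division_of \<Union>A" "\<Union>A \<subseteq> V" "pairwise disjnt A"
    "\<And>J. J \<in> A \<Longrightarrow> f (Sup J) - f (Inf J) \<ge> t * (Sup J - Inf J) \<and> (\<exists>K\<in>B. {Inf J..Sup J} \<subseteq> K)"
    "?\<mu> (E \<inter> V) - \<eta> < sum (measure lborel) A"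
  proof (rule Vitali_covering_intervals[where S = "E \<inter> V" and U = V and \<eta> = \<eta> and
       P = "\<lambda>u v. f v - f u \<ge> t * (v - u) \<and> (\<exists>K\<in>B. {u..v} \<subseteq> K)"])
    show "E \<inter> V \<in> lmeasurable" using Elm Vlm by (simp add: fmeasurable.Int)
    fix x e :: real assume x: "x \<in> E \<inter> V" and "e > 0"
    then obtain K where K: "K \<in> B" "x \<in> interior K" by (auto simp: V_def)
    then obtain e0 where e0: "e0 > 0" "ball x e0 \<subseteq> K"
      by (meson interior_subset mem_interior)
    obtain u v where uv: "u < v" "v - u < min e e0" "x \<in> {u..v}" "f v - f u \<ge> t * (v - u)"
      using high[of x "min e e0"] x e0 \<open>e > 0\<close> by auto
    have "{u..v} \<subseteq> ball x e0" using uv by (auto simp: dist_real_def)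
    then show "\<exists>u v. u < v \<and> v - u < e \<and> x \<in> {u..v} \<and> f v - f u \<ge> t * (v - u) \<and> (\<exists>K\<in>B. {u..v} \<subseteq> K)"
      using uv e0 K by (intro exI[of _ u] exI[of _ v]) auto
  qed (use V Vlm \<open>\<eta> > 0\<close> in auto)
  define AK where "AK K = {J \<in> A. J \<subseteq> K}" for K
  have finA: "finite A" by (rule division_of_finite[OF A(1)])
  have AK_div: "AK K division_of \<Union>(AK K)" for K
    by (rule division_of_subset[OF A(1)]) (auto simp: AK_def)
  have "\<exists>q. AK K \<subseteq> q \<and> q division_of K" if "K \<in> B" for K
  proof -
    obtain a b where "K = cbox a b" using division_ofD(4)[OF B(1) \<open>K \<in> B\<close>] by blast
    moreover have "\<Union>(AK K) \<subseteq> K" by (auto simp: AK_def)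
    ultimately show ?thesis
      using partial_division_extend_interval[OF AK_div] by metis
  qed
  then obtain q where q: "\<And>K. K \<in> B \<Longrightarrow> AK K \<subseteq> q K" "\<And>K. K \<in> B \<Longrightarrow> q K division_of K" by metis
  \<comment> \<open>Each \<open>K \<in> B\<close> is divided into its members of \<open>A\<close> and further intervals; \<open>G\<close> collects these gaps.\<close>
  define G where "G = (\<Union>K\<in>B. q K - AK K)"
  have finq: "finite (q K)" if "K \<in> B" for K using q(2)[OF that] by (rule division_of_finite)
  have sep: "K = L" if "K \<in> B" "L \<in> B" "J \<subseteq> K" "J \<subseteq> L" "J \<noteq> {}" for J K L
  proof (rule ccontr)
    assume "K \<noteq> L"
    then have "K \<inter> L = {}" using pairwiseD[OF B(3)] that(1,2) by (simp add: disjnt_def)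
    then show False using that(3-5) by blast
  qed
  have qne: "J \<noteq> {}" "J \<subseteq> K" if "K \<in> B" "J \<in> q K" for J K
    using division_ofD(2,3)[OF q(2)[OF that(1)] that(2)] by auto
  have sumB: "sum g B' = sum g A + sum g G"
    if g: "\<And>K. K \<in> B \<Longrightarrow> g K = sum g (q K)" and "B' = B" for g :: "real set \<Rightarrow> real" and B'
  proof -
    have "sum g B = (\<Sum>K\<in>B. sum g (AK K) + sum g (q K - AK K))"
      using g q(1) finq by (intro sum.cong refl) (metis add.commute sum.subset_diff)
    also have "\<dots> = (\<Sum>K\<in>B. sum g (AK K)) + (\<Sum>K\<in>B. sum g (q K - AK K))"
      by (rule sum.distrib)
    also have "(\<Sum>K\<in>B. sum g (AK K)) = sum g (\<Union>K\<in>B. AK K)"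
    proof (rule sum.UNION_disjoint[symmetric, OF finB])
      show "\<forall>K\<in>B. \<forall>L\<in>B. K \<noteq> L \<longrightarrow> AK K \<inter> AK L = {}"
      proof (intro ballI impI)
        fix K L assume KL: "K \<in> B" "L \<in> B" "K \<noteq> L"
        show "AK K \<inter> AK L = {}"
          using sep[OF KL(1,2)] KL(3) division_ofD(3)[OF A(1)] unfolding AK_def by blast
      qed
    qed (use finA in \<open>auto simp: AK_def\<close>)
    also have "(\<Union>K\<in>B. AK K) = A"
    proof -
      have "\<exists>K\<in>B. J \<subseteq> K" if "J \<in> A" for J
        using A(4)[OF that] division_real_interval(2)[OF A(1) that] by metis
      then show ?thesis by (auto simp: AK_def)
    qed
    also have "(\<Sum>K\<in>B. sum g (q K - AK K)) = sum g G"
      unfolding G_def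
    proof (rule sum.UNION_disjoint[symmetric, OF finB])
      show "\<forall>K\<in>B. \<forall>L\<in>B. K \<noteq> L \<longrightarrow> (q K - AK K) \<inter> (q L - AK L) = {}"
      proof (intro ballI impI)
        fix K L assume KL: "K \<in> B" "L \<in> B" "K \<noteq> L"
        show "(q K - AK K) \<inter> (q L - AK L) = {}"
        proof (rule ccontr)
          assume "(q K - AK K) \<inter> (q L - AK L) \<noteq> {}"
          then obtain J where J: "J \<in> q K" "J \<in> q L" by blast
          show False
            using sep[OF KL(1,2) qne(2)[OF KL(1) J(1)] qne(2)[OF KL(2) J(2)] qne(1)[OF KL(1) J(1)]] KL(3)
            by contradiction
        qed
      qed
    qed (use finq in auto)
    finally show ?thesis using that by simp
  qed
  have G_div: "G division_of \<Union>G"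
  proof (rule division_ofI)
    show "finite G" using finB finq by (auto simp: G_def)
    fix J assume "J \<in> G"
    then obtain K where K: "K \<in> B" "J \<in> q K" by (auto simp: G_def)
    show "J \<subseteq> \<Union>G" using \<open>J \<in> G\<close> by blast
    show "J \<noteq> {}" using qne(1)[OF K] .
    show "\<exists>a b. J = cbox a b" using division_ofD(4)[OF q(2)[OF K(1)] K(2)] .
    fix J' assume "J' \<in> G" "J \<noteq> J'"
    then obtain L where L: "L \<in> B" "J' \<in> q L" by (auto simp: G_def)
    show "interior J \<inter> interior J' = {}"
    proof (cases "K = L")
      case True
      then show ?thesis using division_ofD(5)[OF q(2)[OF K(1)] K(2)] L \<open>J \<noteq> J'\<close> by blast
    next
      case False
      then have "K \<inter> L = {}" using pairwiseD[OF B(3)] K(1) L(1) by (simp add: disjnt_def)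
      then show ?thesis using qne(2)[OF K] qne(2)[OF L] interior_subset by blast
    qed
  qed auto
  have G_sub: "\<Union>G \<subseteq> {c..d}"
  proof -
    have "\<Union>G \<subseteq> \<Union>B" using qne(2) unfolding G_def by blast
    then show ?thesis using B(2) U(3) by blast
  qed
  have content_split: "sum (measure lborel) B = sum (measure lborel) A + sum (measure lborel) G"
  proof (rule sumB[OF _ refl])
    fix K assume "K \<in> B"
    then obtain a b where "K = cbox a b" using division_ofD(4)[OF B(1)] by blast
    then show "measure lborel K = sum (measure lborel) (q K)"
      using additive_content_division[of "q K" a b] q(2)[OF \<open>K \<in> B\<close>] by simp
  qed
  have f_split: "(\<Sum>K\<in>B. f (Sup K) - f (Inf K)) = (\<Sum>K\<in>A. f (Sup K) - f (Inf K)) + (\<Sum>K\<in>G. f (Sup K) - f (Inf K))"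
  proof (rule sumB[OF _ refl])
    fix K assume "K \<in> B"
    note K = division_real_interval(1,2)[OF B(1) this]
    have "q K division_of {Inf K..Sup K}" using q(2)[OF \<open>K \<in> B\<close>] K(2) by simp
    from sum_increments_division[OF K(1) this, of f]
    show "f (Sup K) - f (Inf K) = (\<Sum>J\<in>q K. f (Sup J) - f (Inf J))" by (rule sym)
  qed
  define \<beta> where "\<beta> = sum (measure lborel) B"
  define \<alpha> where "\<alpha> = sum (measure lborel) A"
  have "\<beta> \<le> m + \<eta>" using sum_content_division_le[OF B(1,2) Ulm] UE by (simp add: \<beta>_def)
  have "\<alpha> > m - 3 * \<eta>" using A(5) \<open>?\<mu> (E \<inter> V) \<ge> m - 2 * \<eta>\<close> by (simp add: \<alpha>_def)
  have "\<alpha> \<le> \<beta>" using content_split sum_nonneg[of G "measure lborel"] by (simp add: \<alpha>_def \<beta>_def)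
  have "sum (measure lborel) G < \<delta>" using content_split \<open>\<beta> \<le> m + \<eta>\<close> \<open>\<alpha> > m - 3 * \<eta>\<close> \<eta>1(1)
    by (simp add: \<alpha>_def \<beta>_def)
  from \<delta>[OF G_div G_sub this] have "\<bar>\<Sum>K\<in>G. f (Sup K) - f (Inf K)\<bar> < \<epsilon>"
    using sum_abs[of "\<lambda>K. f (Sup K) - f (Inf K)" G] unfolding real_norm_def by linarith
  moreover have "(\<Sum>K\<in>B. f (Sup K) - f (Inf K)) \<le> s * \<beta>"
    unfolding \<beta>_def sum_distrib_left
    by (intro sum_mono) (use B(4) division_real_interval(3)[OF B(1)] in auto)
  moreover have "t * \<alpha> \<le> (\<Sum>K\<in>A. f (Sup K) - f (Inf K))"
    unfolding \<alpha>_def sum_distrib_left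
    by (intro sum_mono) (use A(4) division_real_interval(3)[OF A(1)] in auto)
  ultimately have "t * \<alpha> - \<epsilon> < s * \<beta>" using f_split by linarith
  moreover have "s * (\<beta> - \<alpha>) \<le> \<bar>s\<bar> * (4 * \<eta>)"
  proof -
    have "s * (\<beta> - \<alpha>) \<le> \<bar>s\<bar> * (\<beta> - \<alpha>)" using \<open>\<alpha> \<le> \<beta>\<close> by (intro mult_right_mono) auto
    also have "\<dots> \<le> \<bar>s\<bar> * (4 * \<eta>)" using \<open>\<beta> \<le> m + \<eta>\<close> \<open>\<alpha> > m - 3 * \<eta>\<close> by (intro mult_left_mono) auto
    finally show ?thesis .
  qed
  ultimately have "t * \<alpha> - s * \<alpha> < 2 * \<epsilon>"
    using \<eta>2 unfolding right_diff_distrib \<epsilon>_def[symmetric] by linarith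
  then have "(t - s) * \<alpha> < (t - s) * m / 2" by (simp add: \<epsilon>_def left_diff_distrib)
  moreover have "(t - s) * (3 * m / 4) \<le> (t - s) * \<alpha>"
    using \<open>s < t\<close> \<open>\<alpha> > m - 3 * \<eta>\<close> \<eta>1(2) by (intro mult_left_mono) auto
  moreover have "(t - s) * m > 0" using \<open>s < t\<close> \<open>m > 0\<close> by simp
  moreover have "(t - s) * (3 * m / 4) = 3 / 4 * ((t - s) * m)" by simp
  ultimately show False by linarith
qed

text \<open>On a piece of length below the \<open>\<delta>\<close> that belongs to \<open>\<epsilon> = 1\<close> the increments over disjoint
  intervals add up to less than \<open>1\<close>. Disjoint intervals of slope at least \<open>2 / m\<close> that cover half of a
  set of measure \<open>m\<close> would contradict this.\<close>

lemma unbounded_slopes_negligible: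
  fixes f :: "real \<Rightarrow> real"
  assumes AC: "AC_divisions c d f"
    and E: "E \<in> sets lebesgue" "E \<subseteq> {c<..<d}"
    and steep: "\<And>x e M. x \<in> E \<Longrightarrow> e > 0 \<Longrightarrow> \<exists>u v. u < v \<and> v - u < e \<and> x \<in> {u..v} \<and> M * (v - u) \<le> \<bar>f v - f u\<bar>"
  shows "negligible E"
proof -
  obtain \<delta> where "\<delta> > 0" and \<delta>: "\<And>p. p division_of \<Union>p \<Longrightarrow> \<Union>p \<subseteq> {c..d} \<Longrightarrow> sum (measure lborel) p < \<delta> \<Longrightarrow>
        (\<Sum>K\<in>p. norm (f (Sup K) - f (Inf K))) < 1"
    using AC unfolding AC_divisions_def by (metis zero_less_one)
  have piece: "negligible (E \<inter> ball y (\<delta> / 4))" for y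
  proof (rule ccontr)
    let ?F = "E \<inter> ball y (\<delta> / 4)"
    let ?U = "{c<..<d} \<inter> ball y (\<delta> / 4)"
    assume nn: "\<not> negligible ?F"
    have U: "open ?U" "?U \<in> lmeasurable" "?F \<subseteq> ?U"
      using E by (auto intro!: lmeasurable_open bounded_Int)
    have Flm: "?F \<in> lmeasurable"
      using E by (intro bounded_set_imp_lmeasurable) (auto intro!: bounded_Int)
    define m where "m = measure lebesgue ?F"
    have "m > 0" using nn Flm unfolding m_def
      by (metis measure_nonneg negligible_iff_measure order_le_imp_less_or_eq)
    obtain D where D: "D division_of \<Union>D" "\<Union>D \<subseteq> ?U"
      "\<And>K. K \<in> D \<Longrightarrow> 2 / m * (Sup K - Inf K) \<le> \<bar>f (Sup K) - f (Inf K)\<bar>" "m - m / 2 < sum (measure lborel) D"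
      unfolding m_def
    proof (rule Vitali_covering_intervals[OF Flm U(3,1,2)])
      show "0 < measure lebesgue ?F / 2" using \<open>m > 0\<close> by (simp add: m_def)
      show "\<exists>u v. u < v \<and> v - u < e \<and> x \<in> {u..v} \<and> 2 / measure lebesgue ?F * (v - u) \<le> \<bar>f v - f u\<bar>"
        if "x \<in> ?F" "e > 0" for x e using steep that by blast
    qed auto
    have "sum (measure lborel) D \<le> measure lebesgue (ball y (\<delta> / 4))"
      using D(2) by (intro sum_content_division_le[OF D(1)]) auto
    also have "\<dots> = \<delta> / 2" using \<open>\<delta> > 0\<close> by (simp add: ball_eq_greaterThanLessThan)
    finally have "sum (measure lborel) D < \<delta>" using \<open>\<delta> > 0\<close> by simp
    moreover have "\<Union>D \<subseteq> {c..d}" using D(2) by force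
    ultimately have "(\<Sum>K\<in>D. \<bar>f (Sup K) - f (Inf K)\<bar>) < 1" using \<delta>[OF D(1)] by simp
    moreover have "2 / m * sum (measure lborel) D \<le> (\<Sum>K\<in>D. \<bar>f (Sup K) - f (Inf K)\<bar>)"
      unfolding sum_distrib_left
      by (intro sum_mono) (use D(3) division_real_interval(3)[OF D(1)] in auto)
    ultimately have "2 / m * sum (measure lborel) D < 1" by linarith
    then have "2 * sum (measure lborel) D < m" using \<open>m > 0\<close> by (simp add: field_simps)
    then show False using D(4) by simp
  qed
  have "negligible (\<Union>y\<in>\<rat>. E \<inter> ball y (\<delta> / 4))"
    using piece countable_rat by (intro negligible_countable_Union) auto
  moreover have "E \<subseteq> (\<Union>y\<in>\<rat>. E \<inter> ball y (\<delta> / 4))"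
  proof
    fix x assume "x \<in> E"
    obtain y where "y \<in> \<rat>" "x - \<delta> / 4 < y" "y < x + \<delta> / 4"
      using Rats_dense_in_real[of "x - \<delta> / 4" "x + \<delta> / 4"] \<open>\<delta> > 0\<close> by auto
    moreover from this have "\<bar>y - x\<bar> < \<delta> / 4" by (simp only: abs_less_iff) linarith
    ultimately show "x \<in> (\<Union>y\<in>\<rat>. E \<inter> ball y (\<delta> / 4))"
      using \<open>x \<in> E\<close> by (intro UN_I[of y] IntI) (simp_all add: dist_real_def)
  qed
  ultimately show ?thesis by (rule negligible_subset)
qed


lemma AC_divisions_interval:
  assumes "AC_divisions c d f" "\<epsilon> > 0"
  shows "\<exists>\<delta>>0. \<forall>x\<in>{c..d}. \<forall>y\<in>{c..d}. \<bar>y - x\<bar> < \<delta> \<longrightarrow> norm (f y - f x) < \<epsilon>"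
proof -
  obtain \<delta> where "\<delta> > 0" and \<delta>: "\<And>p. p division_of \<Union>p \<Longrightarrow> \<Union>p \<subseteq> {c..d} \<Longrightarrow> sum (measure lborel) p < \<delta> \<Longrightarrow>
        (\<Sum>K\<in>p. norm (f (Sup K) - f (Inf K))) < \<epsilon>"
    using assms unfolding AC_divisions_def by blast
  have *: "norm (f y - f x) < \<epsilon>" if "c \<le> x" "x \<le> y" "y \<le> d" "y - x < \<delta>" for x y
  proof -
    have "{{x..y}} division_of {x..y}" using that division_of_self[of x y] by (simp add: box_real)
    then show ?thesis using \<delta>[of "{{x..y}}"] that by simp
  qed
  have "norm (f y - f x) < \<epsilon>" if "x \<in> {c..d}" "y \<in> {c..d}" "\<bar>y - x\<bar> < \<delta>" for x y
    using *[of x y] *[of y x] that by (cases "x \<le> y") (auto simp: norm_minus_commute)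
  then show ?thesis using \<open>\<delta> > 0\<close> by blast
qed

lemma AC_divisions_continuous_on:
  assumes "AC_divisions c d f"
  shows "continuous_on {c..d} f"
  unfolding continuous_on_iff
proof (intro ballI allI impI)
  fix x \<epsilon> :: real assume "x \<in> {c..d}" "\<epsilon> > 0"
  then show "\<exists>\<delta>>0. \<forall>y\<in>{c..d}. dist y x < \<delta> \<longrightarrow> dist (f y) (f x) < \<epsilon>"
    using AC_divisions_interval[OF assms \<open>\<epsilon> > 0\<close>] unfolding dist_norm real_norm_def by blast
qed

text \<open>A bounded quantity that does not oscillate across any two rationals \<open>s < t\<close> converges;
  the limit is its limes inferior, written as a supremum of eventual lower bounds.\<close>

lemma eventually_between_imp_tendsto:
  fixes q :: "'a \<Rightarrow> real"
  assumes F: "F \<noteq> bot"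
    and bdd: "\<forall>\<^sub>F y in F. \<bar>q y\<bar> \<le> M"
    and dich: "\<And>s t. s \<in> \<rat> \<Longrightarrow> t \<in> \<rat> \<Longrightarrow> s < t \<Longrightarrow> (\<forall>\<^sub>F y in F. s \<le> q y) \<or> (\<forall>\<^sub>F y in F. q y \<le> t)"
  shows "\<exists>L. (q \<longlongrightarrow> L) F"
proof -
  define A where "A = {s. \<forall>\<^sub>F y in F. s \<le> q y}"
  have A1: "- M \<in> A" unfolding A_def using bdd by (auto elim: eventually_mono)
  have A2: "s \<le> M" if "s \<in> A" for s
  proof -
    have "\<forall>\<^sub>F y in F. s \<le> M"
      using that bdd unfolding A_def by (auto elim: eventually_elim2)
    then show ?thesis using F by (simp add: eventually_const_iff)
  qed
  have bA: "bdd_above A" using A2 by (rule bdd_aboveI)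
  have lower: "\<forall>\<^sub>F y in F. s < q y" if "s < Sup A" for s
  proof -
    obtain s' where s': "s' \<in> A" "s < s'" using less_cSupD[of A s] \<open>s < Sup A\<close> A1 by blast
    then have "\<forall>\<^sub>F y in F. s' \<le> q y" by (simp add: A_def)
    then show ?thesis by (rule eventually_mono) (use s'(2) in simp)
  qed
  have upper: "\<forall>\<^sub>F y in F. q y < u" if "Sup A < u" for u
  proof -
    obtain s where s: "s \<in> \<rat>" "Sup A < s" "s < u" using Rats_dense_in_real[OF \<open>Sup A < u\<close>] by blast
    obtain t where t: "t \<in> \<rat>" "s < t" "t < u" using Rats_dense_in_real[OF s(3)] by blast
    have "s \<notin> A" using cSup_upper[OF _ bA, of s] s(2) by auto
    then have "\<forall>\<^sub>F y in F. q y \<le> t" using dich[OF s(1) t(1,2)] by (auto simp: A_def)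
    then show ?thesis by (rule eventually_mono) (use t(3) in simp)
  qed
  have "(q \<longlongrightarrow> Sup A) F" using lower upper by (rule order_tendstoI)
  then show ?thesis by blast
qed

lemma slope_interval:
  fixes f :: "real \<Rightarrow> real"
  assumes "y \<noteq> x"
  shows "\<exists>u v. u < v \<and> v - u = \<bar>y - x\<bar> \<and> x \<in> {u..v} \<and> (f v - f u) = (f y - f x) / (y - x) * (v - u)"
proof (cases "x < y")
  case True
  then show ?thesis by (intro exI[of _ x] exI[of _ y]) (simp add: divide_simps)
next
  case False
  then show ?thesis using assms by (intro exI[of _ y] exI[of _ x]) (simp add: field_simps)
qed

text \<open>At a point without derivative the difference quotients either are unbounded or oscillate across two
  rationals \<open>s < t\<close>. Both kinds of points form null sets (\<open>unbounded_slopes_negligible\<close>,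
  \<open>two_slopes_negligible\<close>), and there are only countably many pairs of rationals.\<close>

lemma AC_real_differentiable_AE:
  fixes f :: "real \<Rightarrow> real"
  assumes AC: "AC_divisions c d f"
  shows "\<exists>N. negligible N \<and> (\<forall>x\<in>{c<..<d} - N. f differentiable (at x))"
proof -
  let ?I = "{c<..<d}"
  let ?q = "\<lambda>x y. (f y - f x) / (y - x)"
  define near where "near P = {x\<in>?I. \<forall>e>0. \<exists>y\<in>?I. y \<noteq> x \<and> \<bar>y - x\<bar> < e \<and> P (?q x y)}" for P :: "real \<Rightarrow> bool"
  have contf: "continuous_on ?I f"
    using AC_divisions_continuous_on[OF AC] by (rule continuous_on_subset) auto
  \<comment> \<open>For fixed \<open>y\<close> the condition on the slope is open in \<open>x\<close> by continuity, which makes \<open>near P\<close> a \<open>G\<^sub>\<delta>\<close> set.\<close>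
  have near_borel: "near P \<in> sets borel" if P: "open {r. P r}" for P
  proof -
    define W where "W n y = ?I \<inter> {x\<in>?I - {y}. \<bar>y - x\<bar> < 1 / real (Suc n) \<and> P (?q x y)}" for n y
    have "open (W n y)" for n y
    proof -
      have 1: "open (?I - {y})" by (simp add: open_delete)
      have "continuous_on (?I - {y}) (\<lambda>x. ?q x y)"
        by (intro continuous_intros continuous_on_subset[OF contf]) auto
      then have "open ((?I - {y}) \<inter> (\<lambda>x. ?q x y) -` {r. P r})"
        using continuous_open_preimage[OF _ 1 P] by blast
      moreover have "W n y = ((?I - {y}) \<inter> (\<lambda>x. ?q x y) -` {r. P r}) \<inter> ball y (1 / real (Suc n))"
        by (auto simp: W_def dist_real_def)
      ultimately show ?thesis using open_Int[OF _ open_ball] by metis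
    qed
    then have "(\<Inter>n. \<Union>y\<in>?I. W n y) \<in> sets borel"
      by (intro sets.countable_INT') (auto intro!: borel_open)
    moreover have "near P = (\<Inter>n. \<Union>y\<in>?I. W n y)"
    proof (intro set_eqI iffI)
      fix x assume x: "x \<in> near P"
      have "\<exists>y\<in>?I. x \<in> W n y" for n
      proof -
        have "0 < 1 / real (Suc n)" by simp
        with x obtain y where "y \<in> ?I" "y \<noteq> x" "\<bar>y - x\<bar> < 1 / real (Suc n)" "P (?q x y)"
          unfolding near_def by blast
        then show ?thesis using x by (intro bexI[of _ y]) (auto simp: W_def near_def)
      qed
      then show "x \<in> (\<Inter>n. \<Union>y\<in>?I. W n y)" by blast
    next
      fix x assume x: "x \<in> (\<Inter>n. \<Union>y\<in>?I. W n y)"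
      then have "x \<in> ?I" by (auto simp: W_def)
      moreover have "\<exists>y\<in>?I. y \<noteq> x \<and> \<bar>y - x\<bar> < e \<and> P (?q x y)" if "e > 0" for e
      proof -
        obtain n where n: "1 / real (Suc n) < e" by (rule nat_approx_posE[OF \<open>e > 0\<close>])
        obtain y where "y \<in> ?I" "x \<in> W n y" using x by blast
        then show ?thesis using n by (intro bexI[of _ y]) (auto simp: W_def)
      qed
      ultimately show "x \<in> near P" by (auto simp: near_def)
    qed
    ultimately show ?thesis by simp
  qed
  have near_leb: "near P \<in> sets lebesgue" "near P \<subseteq> ?I" if "open {r. P r}" for P
    using near_borel[OF that] by (auto simp: near_def)
  have near_interval: "\<exists>u v. u < v \<and> v - u < e \<and> x \<in> {u..v} \<and> Q (f v - f u) (v - u)"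
    if "x \<in> near P" "e > 0" and Q: "\<And>r h. P r \<Longrightarrow> h > 0 \<Longrightarrow> Q (r * h) h"
    for x e P and Q :: "real \<Rightarrow> real \<Rightarrow> bool"
  proof -
    from \<open>x \<in> near P\<close> \<open>e > 0\<close> obtain y where y: "y \<noteq> x" "\<bar>y - x\<bar> < e" "P (?q x y)"
      unfolding near_def by blast
    obtain u v where uv: "u < v" "v - u = \<bar>y - x\<bar>" "x \<in> {u..v}" "f v - f u = ?q x y * (v - u)"
      using slope_interval[OF y(1)] by blast
    show ?thesis
      using uv y Q[OF y(3), of "v - u"] by (intro exI[of _ u] exI[of _ v]) auto
  qed
  define bad where "bad s t = near (\<lambda>r. r < s) \<inter> near (\<lambda>r. t < r)" for s t :: real
  define steep where "steep = (\<Inter>n::nat. near (\<lambda>r. \<bar>r\<bar> > real n))"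
  have op: "open {r. r < s}" "open {r. t < r}" "open {r. \<bar>r\<bar> > a}" for s t a :: real
    by (auto intro!: open_Collect_less continuous_intros)
  have neg_bad: "negligible (bad s t)" if "s < t" for s t
  proof (rule two_slopes_negligible[OF AC that])
    show "bad s t \<in> sets lebesgue" "bad s t \<subseteq> ?I" using near_leb[OF op(1)] near_leb[OF op(2)] by (auto simp: bad_def)
    fix x e :: real assume x: "x \<in> bad s t" and "e > 0"
    show "\<exists>u v. u < v \<and> v - u < e \<and> x \<in> {u..v} \<and> f v - f u \<le> s * (v - u)"
      by (rule near_interval[where P = "\<lambda>r. r < s" and Q = "\<lambda>a h. a \<le> s * h"]) (use x \<open>e > 0\<close> in \<open>auto simp: bad_def\<close>)
    show "\<exists>u v. u < v \<and> v - u < e \<and> x \<in> {u..v} \<and> f v - f u \<ge> t * (v - u)"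
      by (rule near_interval[where P = "\<lambda>r. t < r" and Q = "\<lambda>a h. a \<ge> t * h"]) (use x \<open>e > 0\<close> in \<open>auto simp: bad_def\<close>)
  qed
  have neg_steep: "negligible steep"
  proof (rule unbounded_slopes_negligible[OF AC])
    show "steep \<in> sets lebesgue" using near_leb(1)[OF op(3)] unfolding steep_def by (intro sets.countable_INT') auto
    show "steep \<subseteq> ?I" using near_leb(2)[OF op(3)] by (auto simp: steep_def)
    fix x e M :: real assume x: "x \<in> steep" and "e > 0"
    obtain n :: nat where n: "M \<le> real n" using real_arch_simple by blast
    show "\<exists>u v. u < v \<and> v - u < e \<and> x \<in> {u..v} \<and> M * (v - u) \<le> \<bar>f v - f u\<bar>"
    proof (rule near_interval[where P = "\<lambda>r. \<bar>r\<bar> > real n" and Q = "\<lambda>a h. M * h \<le> \<bar>a\<bar>"])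
      show "M * h \<le> \<bar>r * h\<bar>" if "real n < \<bar>r\<bar>" "h > 0" for r h
        using that n by (simp add: abs_mult)
    qed (use x \<open>e > 0\<close> in \<open>auto simp: steep_def\<close>)
  qed
  define N where "N = steep \<union> (\<Union>(s,t)\<in>{(s,t). s \<in> \<rat> \<and> t \<in> \<rat> \<and> s < t}. bad s t)"
  have "countable {(s,t). s \<in> \<rat> \<and> t \<in> \<rat> \<and> s < (t::real)}"
    by (rule countable_subset[of _ "\<rat> \<times> \<rat>"]) (auto intro!: countable_SIGMA countable_rat)
  then have "negligible N"
    unfolding N_def using neg_steep neg_bad
    by (intro negligible_Un negligible_countable_Union) auto
  moreover have "f differentiable (at x)" if x: "x \<in> ?I - N" for x
  proof -
    have notnear: "\<forall>\<^sub>F y in at x. \<not> P (?q x y)" if "x \<notin> near P" for P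
    proof -
      obtain e where e: "e > 0" "\<And>y. y \<in> ?I \<Longrightarrow> y \<noteq> x \<Longrightarrow> \<bar>y - x\<bar> < e \<Longrightarrow> \<not> P (?q x y)"
        using \<open>x \<notin> near P\<close> x unfolding near_def by blast
      have "\<forall>\<^sub>F y in at x. y \<in> ?I" using x by (intro eventually_at_in_open') auto
      moreover have "\<forall>\<^sub>F y in at x. y \<noteq> x \<and> \<bar>y - x\<bar> < e"
        using e(1) by (auto simp: eventually_at dist_real_def)
      ultimately show ?thesis by eventually_elim (use e(2) in auto)
    qed
    obtain n where n: "x \<notin> near (\<lambda>r. \<bar>r\<bar> > real n)" using x by (auto simp: N_def steep_def)
    have "\<exists>L. (?q x \<longlongrightarrow> L) (at x)"
    proof (rule eventually_between_imp_tendsto)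
      show "\<forall>\<^sub>F y in at x. \<bar>?q x y\<bar> \<le> real n" using notnear[OF n] by (simp add: not_less)
      fix s t :: real assume st: "s \<in> \<rat>" "t \<in> \<rat>" "s < t"
      then have "x \<notin> bad s t" using x by (auto simp: N_def)
      then consider "x \<notin> near (\<lambda>r. r < s)" | "x \<notin> near (\<lambda>r. t < r)" by (auto simp: bad_def)
      then show "(\<forall>\<^sub>F y in at x. s \<le> ?q x y) \<or> (\<forall>\<^sub>F y in at x. ?q x y \<le> t)"
      proof cases
        case 1
        show ?thesis using notnear[OF 1] by (simp add: not_less)
      next
        case 2
        show ?thesis using notnear[OF 2] by (simp add: not_less)
      qed
    qed simp
    then obtain L where "(f has_field_derivative L) (at x)"
      unfolding has_field_derivative_iff by blast
    then show ?thesis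
      using real_differentiable_def by blast
  qed
  ultimately show ?thesis by blast
qed

lemma AC_complex_differentiable_AE:
  fixes f :: "real \<Rightarrow> complex"
  assumes AC: "AC_divisions c d f"
  shows "\<exists>N. negligible N \<and> (\<forall>x\<in>{c<..<d} - N. f differentiable (at x))"
proof -
  obtain N1 where N1: "negligible N1" "\<And>x. x \<in> {c<..<d} - N1 \<Longrightarrow> (\<lambda>x. Re (f x)) differentiable (at x)"
    using AC_real_differentiable_AE[OF AC_divisions_Re[OF AC]] by blast
  obtain N2 where N2: "negligible N2" "\<And>x. x \<in> {c<..<d} - N2 \<Longrightarrow> (\<lambda>x. Im (f x)) differentiable (at x)"
    using AC_real_differentiable_AE[OF AC_divisions_Im[OF AC]] by blast
  have "f differentiable (at x)" if "x \<in> {c<..<d} - (N1 \<union> N2)" for x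
  proof -
    have "x \<in> {c<..<d} - N1" "x \<in> {c<..<d} - N2" using that by auto
    then obtain a b where a: "((\<lambda>x. Re (f x)) has_field_derivative a) (at x)"
        and b: "((\<lambda>x. Im (f x)) has_field_derivative b) (at x)"
      using N1(2) N2(2) real_differentiableE by metis
    have "((\<lambda>x. Re (f x) *\<^sub>R 1 + Im (f x) *\<^sub>R \<i>) has_vector_derivative (a *\<^sub>R 1 + b *\<^sub>R \<i>)) (at x)"
      by (intro has_vector_derivative_add has_vector_derivative_scaleR[OF a, of "\<lambda>_. 1" 0, simplified]
          has_vector_derivative_scaleR[OF b, of "\<lambda>_. \<i>" 0, simplified])
    moreover have "(\<lambda>x. Re (f x) *\<^sub>R 1 + Im (f x) *\<^sub>R \<i>) = f"
      by (simp add: fun_eq_iff complex_eq_iff)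
    ultimately    show ?thesis
      by (metis differentiableI_vector)
  qed
  then show ?thesis using N1(1) N2(1) negligible_Un by blast
qed

section \<open>The fundamental theorem of calculus for absolutely continuous functions\<close>

text \<open>A gauge argument. At a point with a derivative, the gauge is so small that
  the increment over a tagged interval is the derivative times the length up to a multiple of the
  length. At a point of the null set \<open>N\<close> the gauge keeps the interval inside an open set of measure less
  than \<open>\<delta>\<close> around \<open>N\<close>, so that absolute continuity bounds the sum of these increments.\<close>

theorem AC_fundamental_theorem_of_calculus:
  fixes f g :: "real \<Rightarrow> 'a::euclidean_space"
  assumes AC: "AC_divisions c d f" and "c \<le> d" and N: "negligible N"
    and der: "\<And>x. x \<in> {c..d} - N \<Longrightarrow> (f has_vector_derivative g x) (at x)"
  shows "(g has_integral f d - f c) {c..d}"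
proof -
  let ?g = "\<lambda>x. if x \<in> N then 0 else g x"
  have "(?g has_integral f d - f c) (cbox c d)"
    unfolding has_integral
  proof (intro allI impI)
    fix e :: real assume "e > 0"
    \<comment> \<open>The summand \<open>1\<close> keeps the denominator positive when \<open>c = d\<close>.\<close>
    define e1 where "e1 = e / (2 * (d - c + 1))"
    have "e1 > 0" using \<open>e > 0\<close> \<open>c \<le> d\<close> by (simp add: e1_def)
    obtain \<delta> where "\<delta> > 0" and \<delta>: "\<And>p. p division_of \<Union>p \<Longrightarrow> \<Union>p \<subseteq> {c..d} \<Longrightarrow> sum (measure lborel) p < \<delta> \<Longrightarrow>
          (\<Sum>K\<in>p. norm (f (Sup K) - f (Inf K))) < e / 2"
      using AC \<open>e > 0\<close> unfolding AC_divisions_def by (meson half_gt_zero)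
    obtain T where T: "open T" "N \<subseteq> T" "T - N \<in> lmeasurable" "emeasure lebesgue (T - N) < ennreal \<delta>"
      using sets_lebesgue_outer_open[OF negligible_imp_sets[OF N] \<open>\<delta> > 0\<close>] .
    have Tlm: "T \<in> lmeasurable"
      using T(2,3) negligible_imp_measurable[OF N] fmeasurable.Un[of N _ "T - N"] by (simp add: Un_absorb1)
    have Tm: "measure lebesgue T < \<delta>"
    proof -
      have "measure lebesgue T = measure lebesgue (T - N)"
        using measure_Diff_null_set[of T lebesgue N] N Tlm by (simp add: negligible_iff_null_sets fmeasurableD)
      then show ?thesis using T(3,4) \<open>\<delta> > 0\<close> by (simp add: emeasure_eq_measure2 ennreal_less_iff)
    qed
    have "\<exists>r>0. if x \<in> N then ball x r \<subseteq> T
        else x \<in> {c..d} \<longrightarrow> (\<forall>y. \<bar>y - x\<bar> < r \<longrightarrow> norm (f y - f x - (y - x) *\<^sub>R g x) \<le> e1 * \<bar>y - x\<bar>)" for x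
    proof (cases "x \<in> N \<or> x \<notin> {c..d}")
      case True
      moreover have "\<exists>r>0. ball x r \<subseteq> T" if "x \<in> N" for x
        using T(1,2) that by (meson openE subsetD)
      ultimately show ?thesis by (cases "x \<in> N") (auto intro!: exI[of _ 1])
    next
      case False
      then have "(f has_vector_derivative g x) (at x)" using der by blast
      then obtain r where "r > 0" "\<And>y. norm (y - x) < r \<Longrightarrow> norm (f y - f x - (y - x) *\<^sub>R g x) \<le> e1 * norm (y - x)"
        using \<open>e1 > 0\<close> unfolding has_vector_derivative_def has_derivative_at_alt by blast
      then show ?thesis using False by (intro exI[of _ r]) auto
    qed
    then obtain r where r: "\<And>x. r x > 0" "\<And>x. x \<in> N \<Longrightarrow> ball x (r x) \<subseteq> T"
      "\<And>x y. x \<notin> N \<Longrightarrow> x \<in> {c..d} \<Longrightarrow> \<bar>y - x\<bar> < r x \<Longrightarrow> norm (f y - f x - (y - x) *\<^sub>R g x) \<le> e1 * \<bar>y - x\<bar>"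
      by metis
    show "\<exists>\<gamma>. gauge \<gamma> \<and> (\<forall>\<D>. \<D> tagged_division_of cbox c d \<and> \<gamma> fine \<D> \<longrightarrow>
            norm ((\<Sum>(x, k)\<in>\<D>. measure lborel k *\<^sub>R ?g x) - (f d - f c)) < e)"
    proof (intro exI[of _ "\<lambda>x. ball x (r x)"] conjI allI impI)
      show "gauge (\<lambda>x. ball x (r x))" using r(1) by (intro gauge_ball_dependent) auto
      fix \<D> assume "\<D> tagged_division_of cbox c d \<and> (\<lambda>x. ball x (r x)) fine \<D>"
      then have tag: "\<D> tagged_division_of {c..d}" and fine: "(\<lambda>x. ball x (r x)) fine \<D>" by auto
      note D = tagged_division_ofD[OF tag]
      let ?t = "\<lambda>(x, K). measure lborel K *\<^sub>R ?g x - (f (Sup K) - f (Inf K))"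
      have snd_div: "snd ` \<D> division_of {c..d}" using tag by (rule division_of_tagged_division)
      have K: "K \<in> snd ` \<D>" if "(x, K) \<in> \<D>" for x K using that by force
      have e1: "norm (?t (x, K)) \<le> e1 * measure lborel K" if "(x, K) \<in> \<D>" "x \<notin> N" for x K
      proof -
        note dr = division_real_interval[OF snd_div K[OF that(1)]]
        have x: "x \<in> {Inf K..Sup K}" "x \<in> {c..d}" using dr(2) D(2,3)[OF that(1)] by auto
        have ball: "K \<subseteq> ball x (r x)" using fine that(1) by (auto simp: fine_def)
        then have "\<bar>Sup K - x\<bar> < r x" "\<bar>Inf K - x\<bar> < r x" using dr(5,6) by (auto simp: dist_real_def abs_minus_commute subset_iff)
        then have 1: "norm (f (Sup K) - f x - (Sup K - x) *\<^sub>R g x) \<le> e1 * \<bar>Sup K - x\<bar>"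
          and 2: "norm (f (Inf K) - f x - (Inf K - x) *\<^sub>R g x) \<le> e1 * \<bar>Inf K - x\<bar>"
          using r(3)[OF that(2) x(2)] by auto
        have eq: "?t (x, K) = (f (Inf K) - f x - (Inf K - x) *\<^sub>R g x) - (f (Sup K) - f x - (Sup K - x) *\<^sub>R g x)"
          using that(2) by (simp add: dr(3) scaleR_diff_left)
        have "norm (?t (x, K)) \<le> e1 * \<bar>Inf K - x\<bar> + e1 * \<bar>Sup K - x\<bar>"
          unfolding eq using 1 2 norm_triangle_ineq4[of "f (Inf K) - f x - (Inf K - x) *\<^sub>R g x" "f (Sup K) - f x - (Sup K - x) *\<^sub>R g x"]
          by linarith
        also have "\<dots> = e1 * measure lborel K" using x(1) unfolding dr(3) by (simp add: algebra_simps)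
        finally show ?thesis .
      qed
      define D1 where "D1 = {p \<in> \<D>. fst p \<notin> N}"
      define D2 where "D2 = {p \<in> \<D>. fst p \<in> N}"
      have "(\<Sum>p\<in>D1. norm (?t p)) \<le> (\<Sum>p\<in>\<D>. e1 * measure lborel (snd p))"
      proof -
        have "(\<Sum>p\<in>D1. norm (?t p)) \<le> (\<Sum>p\<in>D1. e1 * measure lborel (snd p))"
          using e1 by (intro sum_mono) (auto simp: D1_def)
        also have "\<dots> \<le> (\<Sum>p\<in>\<D>. e1 * measure lborel (snd p))"
          using D(1) \<open>e1 > 0\<close> by (intro sum_mono2) (auto simp: D1_def)
        finally show ?thesis .
      qed
      also have "\<dots> = e1 * (d - c)"
        using additive_content_tagged_division[of \<D> c d] tag \<open>c \<le> d\<close>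
        by (simp add: sum_distrib_left[symmetric] case_prod_unfold box_real)
      also have "\<dots> < e / 2"
        using \<open>e > 0\<close> \<open>c \<le> d\<close> by (simp add: e1_def field_simps)
      finally have S1: "(\<Sum>p\<in>D1. norm (?t p)) < e / 2" .
      have S2: "(\<Sum>p\<in>D2. norm (?t p)) < e / 2"
      proof -
        define P where "P = {K \<in> snd ` D2. Inf K < Sup K}"
        have "P \<subseteq> snd ` \<D>" by (auto simp: P_def D2_def)
        then have Pdiv: "P division_of \<Union>P" using division_of_subset[OF division_of_union_self[OF snd_div]] by blast
        have Psub: "\<Union>P \<subseteq> {c..d}" using D(3) unfolding P_def D2_def by force
        have "\<Union>P \<subseteq> T"
          using fine r(2) unfolding P_def D2_def fine_def by fastforce
        then have "sum (measure lborel) P < \<delta>"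
          using sum_content_division_le[OF Pdiv _ Tlm] Tm by linarith
        then have lt: "(\<Sum>K\<in>P. norm (f (Sup K) - f (Inf K))) < e / 2" using \<delta>[OF Pdiv Psub] by simp
        define D3 where "D3 = {p \<in> D2. Inf (snd p) < Sup (snd p)}"
        have finD2: "finite D2" using D(1) by (simp add: D2_def)
        \<comment> \<open>Different tags may carry the same degenerate interval, which contributes nothing; among the others the interval determines the tag.\<close>
        have inj: "inj_on snd D3"
        proof (rule inj_onI)
          fix p p' assume p: "p \<in> D3" "p' \<in> D3" "snd p = snd p'"
          then have pD: "p \<in> \<D>" "p' \<in> \<D>" "Inf (snd p) < Sup (snd p)" by (auto simp: D3_def D2_def)
          show "p = p'"
          proof (rule ccontr)
            assume "p \<noteq> p'"
            then have "interior (snd p) \<inter> interior (snd p') = {}"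
              using D(5)[of "fst p" "snd p" "fst p'" "snd p'"] pD by auto
            then have "interior (snd p) = {}" using p(3) by simp
            moreover have "interior (snd p) = {Inf (snd p)<..<Sup (snd p)}"
              using division_real_interval(4)[OF snd_div] pD(1) by blast
            ultimately show False using pD(3) by simp
          qed
        qed
        have "snd ` D3 = P" by (auto simp: D3_def P_def)
        have "(\<Sum>p\<in>D2. norm (?t p)) = (\<Sum>p\<in>D2. norm (f (Sup (snd p)) - f (Inf (snd p))))"
          by (intro sum.cong) (auto simp: D2_def norm_minus_commute)
        also have "\<dots> = (\<Sum>p\<in>D3. norm (f (Sup (snd p)) - f (Inf (snd p))))"
        proof (rule sum.mono_neutral_right[OF finD2])
          show "\<forall>p\<in>D2 - D3. norm (f (Sup (snd p)) - f (Inf (snd p))) = 0"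
          proof
            fix p assume p: "p \<in> D2 - D3"
            then have "snd p \<in> snd ` \<D>" by (auto simp: D2_def)
            from division_real_interval(1)[OF snd_div this] p show "norm (f (Sup (snd p)) - f (Inf (snd p))) = 0"
              by (auto simp: D3_def)
          qed
        qed (auto simp: D3_def)
        also have "\<dots> = (\<Sum>K\<in>P. norm (f (Sup K) - f (Inf K)))"
          using sum.reindex[OF inj, of "\<lambda>K. norm (f (Sup K) - f (Inf K))"] \<open>snd ` D3 = P\<close> by simp
        finally show ?thesis using lt by simp
      qed
      have eq: "(\<Sum>(x, k)\<in>\<D>. measure lborel k *\<^sub>R ?g x) - (f d - f c) = (\<Sum>p\<in>\<D>. ?t p)"
        using additive_tagged_division_1[OF \<open>c \<le> d\<close> tag, of f, symmetric]
        by (simp add: sum_subtractf[symmetric] case_prod_unfold)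
      have "norm (\<Sum>p\<in>\<D>. ?t p) \<le> (\<Sum>p\<in>D1. norm (?t p)) + (\<Sum>p\<in>D2. norm (?t p))"
      proof -
        have "\<D> = D1 \<union> D2" "D1 \<inter> D2 = {}" by (auto simp: D1_def D2_def)
        moreover have "finite D1" "finite D2" using D(1) by (auto simp: D1_def D2_def)
        ultimately have "(\<Sum>p\<in>\<D>. norm (?t p)) = (\<Sum>p\<in>D1. norm (?t p)) + (\<Sum>p\<in>D2. norm (?t p))"
          using sum.union_disjoint[of D1 D2 "\<lambda>p. norm (?t p)"] by simp
        then show ?thesis using norm_sum[of ?t \<D>] by simp
      qed
      then show "norm ((\<Sum>(x, k)\<in>\<D>. measure lborel k *\<^sub>R ?g x) - (f d - f c)) < e"
        unfolding eq using S1 S2 by linarith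
    qed
  qed
  then show ?thesis
    using has_integral_spike[OF N, of "{c..d}" g ?g] by (simp add: box_real)
qed

section \<open>Locally absolutely continuous functions\<close>

text \<open>Linear combinations and, on a compact interval, products inherit absolute continuity in this
  way, because their increments are dominated by those of the two functions.\<close>

lemma absolutely_cont_on_dominated:
  assumes f: "absolutely_cont_on c d f" and g: "absolutely_cont_on c d g" and "A > 0"
    and h: "\<And>s t. s \<in> {c..d} \<Longrightarrow> t \<in> {c..d} \<Longrightarrow>
      cmod (h t - h s) \<le> A * cmod (f t - f s) + A * cmod (g t - g s)"
  shows "absolutely_cont_on c d h"
  unfolding absolutely_cont_on_def
proof (intro allI impI)
  fix \<epsilon> :: real assume "\<epsilon> > 0"
  then have e: "\<epsilon> / (2 * A) > 0" using \<open>A > 0\<close> by simp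
  obtain \<delta>1 where "\<delta>1 > 0" and \<delta>1: "\<forall>(n::nat) s t. (\<forall>i<n. c \<le> s i \<and> s i \<le> t i \<and> t i \<le> d) \<longrightarrow>
        disjoint_family_on (\<lambda>i. {s i<..<t i}) {..<n} \<longrightarrow> (\<Sum>i<n. t i - s i) < \<delta>1 \<longrightarrow>
        (\<Sum>i<n. cmod (f (t i) - f (s i))) < \<epsilon> / (2 * A)"
    using f e unfolding absolutely_cont_on_def by blast
  obtain \<delta>2 where "\<delta>2 > 0" and \<delta>2: "\<forall>(n::nat) s t. (\<forall>i<n. c \<le> s i \<and> s i \<le> t i \<and> t i \<le> d) \<longrightarrow>
        disjoint_family_on (\<lambda>i. {s i<..<t i}) {..<n} \<longrightarrow> (\<Sum>i<n. t i - s i) < \<delta>2 \<longrightarrow>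
        (\<Sum>i<n. cmod (g (t i) - g (s i))) < \<epsilon> / (2 * A)"
    using g e unfolding absolutely_cont_on_def by blast
  show "\<exists>\<delta>>0. \<forall>(n::nat) s t. (\<forall>i<n. c \<le> s i \<and> s i \<le> t i \<and> t i \<le> d) \<longrightarrow>
        disjoint_family_on (\<lambda>i. {s i<..<t i}) {..<n} \<longrightarrow> (\<Sum>i<n. t i - s i) < \<delta> \<longrightarrow>
        (\<Sum>i<n. cmod (h (t i) - h (s i))) < \<epsilon>"
  proof (intro exI[of _ "min \<delta>1 \<delta>2"] conjI allI impI)
    show "min \<delta>1 \<delta>2 > 0" using \<open>\<delta>1 > 0\<close> \<open>\<delta>2 > 0\<close> by simp
    fix n :: nat and s t :: "nat \<Rightarrow> real"
    assume st: "\<forall>i<n. c \<le> s i \<and> s i \<le> t i \<and> t i \<le> d" "disjoint_family_on (\<lambda>i. {s i<..<t i}) {..<n}"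
      "(\<Sum>i<n. t i - s i) < min \<delta>1 \<delta>2"
    have "(\<Sum>i<n. cmod (h (t i) - h (s i))) \<le> (\<Sum>i<n. A * cmod (f (t i) - f (s i)) + A * cmod (g (t i) - g (s i)))"
    proof (rule sum_mono)
      fix i assume "i \<in> {..<n}"
      then have "c \<le> s i" "s i \<le> t i" "t i \<le> d" using st(1) by auto
      then show "cmod (h (t i) - h (s i)) \<le> A * cmod (f (t i) - f (s i)) + A * cmod (g (t i) - g (s i))"
        by (intro h) auto
    qed
    also have "\<dots> = A * (\<Sum>i<n. cmod (f (t i) - f (s i))) + A * (\<Sum>i<n. cmod (g (t i) - g (s i)))"
      by (simp add: sum.distrib sum_distrib_left)
    also have "\<dots> < A * (\<epsilon> / (2 * A)) + A * (\<epsilon> / (2 * A))"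
      using \<delta>1[rule_format, of n s t] \<delta>2[rule_format, of n s t] st \<open>A > 0\<close>
      by (intro add_strict_mono mult_strict_left_mono) auto
    also have "\<dots> = \<epsilon>" using \<open>A > 0\<close> by (simp add: field_simps)
    finally show "(\<Sum>i<n. cmod (h (t i) - h (s i))) < \<epsilon>" .
  qed
qed

lemma absolutely_cont_on_continuous_on: "absolutely_cont_on c d f \<Longrightarrow> continuous_on {c..d} f"
  by (rule AC_divisions_continuous_on[OF absolutely_cont_on_imp_AC_divisions])

lemma AC_loc_lincomb:
  assumes "f \<in> AC_loc J" "g \<in> AC_loc J"
  shows "(\<lambda>x. \<alpha> * f x + \<beta> * g x) \<in> AC_loc J"
  unfolding AC_loc_def
proof (intro CollectI allI impI)
  fix c d :: real assume cd: "c \<le> d" "{c..d} \<subseteq> J"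
  define A where "A = cmod \<alpha> + cmod \<beta> + 1"
  have A: "A > 0" "cmod \<alpha> \<le> A" "cmod \<beta> \<le> A" by (simp_all add: A_def add_nonneg_pos)
  show "absolutely_cont_on c d (\<lambda>x. \<alpha> * f x + \<beta> * g x)"
  proof (rule absolutely_cont_on_dominated[where f = f and g = g and A = A])
    fix s t
    have "cmod (\<alpha> * f t + \<beta> * g t - (\<alpha> * f s + \<beta> * g s)) = cmod (\<alpha> * (f t - f s) + \<beta> * (g t - g s))"
      by (simp add: algebra_simps)
    also have "\<dots> \<le> cmod \<alpha> * cmod (f t - f s) + cmod \<beta> * cmod (g t - g s)"
      by (metis norm_mult norm_triangle_ineq)
    also have "\<dots> \<le> A * cmod (f t - f s) + A * cmod (g t - g s)"
      using A by (intro add_mono mult_right_mono) auto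
    finally show "cmod (\<alpha> * f t + \<beta> * g t - (\<alpha> * f s + \<beta> * g s)) \<le> A * cmod (f t - f s) + A * cmod (g t - g s)" .
  qed (use assms cd A in \<open>auto simp: AC_loc_def\<close>)
qed

lemma AC_loc_cnj:
  assumes "f \<in> AC_loc J" shows "(\<lambda>x. cnj (f x)) \<in> AC_loc J"
proof -
  have "cmod (cnj a - cnj b) = cmod (a - b)" for a b
    by (metis complex_cnj_diff complex_mod_cnj)
  then show ?thesis using assms by (simp add: AC_loc_def absolutely_cont_on_def)
qed

lemma AC_loc_mult:
  assumes "f \<in> AC_loc J" "g \<in> AC_loc J"
  shows "(\<lambda>x. f x * g x) \<in> AC_loc J"
  unfolding AC_loc_def
proof (intro CollectI allI impI)
  fix c d :: real assume cd: "c \<le> d" "{c..d} \<subseteq> J"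
  have ac: "absolutely_cont_on c d f" "absolutely_cont_on c d g"
    using assms cd by (auto simp: AC_loc_def)
  have "bounded (f ` {c..d})" "bounded (g ` {c..d})"
    using ac by (auto intro!: compact_imp_bounded compact_continuous_image absolutely_cont_on_continuous_on)
  then obtain B1 B2 where B: "\<forall>x\<in>{c..d}. cmod (f x) \<le> B1" "\<forall>x\<in>{c..d}. cmod (g x) \<le> B2"
    unfolding bounded_iff by (metis imageI)
  define A where "A = \<bar>B1\<bar> + \<bar>B2\<bar> + 1"
  have "A > 0" by (simp add: A_def add_nonneg_pos)
  have A: "cmod (f x) \<le> A" "cmod (g x) \<le> A" if "x \<in> {c..d}" for x
    using B(1)[rule_format, OF that] B(2)[rule_format, OF that] abs_ge_self[of B1] abs_ge_self[of B2]
      abs_ge_zero[of B1] abs_ge_zero[of B2] unfolding A_def by linarith+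
  show "absolutely_cont_on c d (\<lambda>x. f x * g x)"
  proof (rule absolutely_cont_on_dominated[OF ac \<open>A > 0\<close>])
    fix s t assume st: "s \<in> {c..d}" "t \<in> {c..d}"
    have "f t * g t - f s * g s = g t * (f t - f s) + f s * (g t - g s)" by (simp add: algebra_simps)
    then have "cmod (f t * g t - f s * g s) \<le> cmod (g t) * cmod (f t - f s) + cmod (f s) * cmod (g t - g s)"
      by (metis norm_mult norm_triangle_ineq)
    also have "\<dots> \<le> A * cmod (f t - f s) + A * cmod (g t - g s)"
      using A st by (intro add_mono mult_right_mono) auto
    finally show "cmod (f t * g t - f s * g s) \<le> A * cmod (f t - f s) + A * cmod (g t - g s)" .
  qed
qed

lemma AC_loc_cong:
  assumes "\<And>x. x \<in> J \<Longrightarrow> f x = g x" "f \<in> AC_loc J"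
  shows "g \<in> AC_loc J"
  unfolding AC_loc_def
proof (intro CollectI allI impI)
  fix c d :: real assume cd: "c \<le> d" "{c..d} \<subseteq> J"
  show "absolutely_cont_on c d g"
  proof (rule absolutely_cont_on_dominated[of c d f f])
    show "absolutely_cont_on c d f" "absolutely_cont_on c d f" using assms(2) cd by (auto simp: AC_loc_def)
    fix s t assume "s \<in> {c..d}" "t \<in> {c..d}"
    then have "s \<in> J" "t \<in> J" using cd by auto
    then show "cmod (g t - g s) \<le> 1 * cmod (f t - f s) + 1 * cmod (f t - f s)"
      using assms(1)[of s] assms(1)[of t] by simp
  qed simp
qed

lemma open_interval_around:
  assumes "open J" "x \<in> J"
  obtains c d :: real where "c \<in> \<rat>" "d \<in> \<rat>" "c < x" "x < d" "{c..d} \<subseteq> J"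
proof -
  obtain e where e: "e > 0" "ball x e \<subseteq> J" using assms by (meson openE)
  obtain c where c: "c \<in> \<rat>" "x - e < c" "c < x" using Rats_dense_in_real[of "x - e" x] e(1) by auto
  obtain d where d: "d \<in> \<rat>" "x < d" "d < x + e" using Rats_dense_in_real[of x "x + e"] e(1) by auto
  have "{c..d} \<subseteq> ball x e" using c d by (auto simp: dist_real_def)
  then show ?thesis using that[OF c(1) d(1) c(3) d(2)] e(2) by blast
qed

lemma AC_loc_continuous_on:
  assumes "open J" "f \<in> AC_loc J"
  shows "continuous_on J f"
proof (rule continuous_at_imp_continuous_on, rule ballI)
  fix x assume "x \<in> J"
  then obtain c d where cd: "c < x" "x < d" "{c..d} \<subseteq> J" using open_interval_around[OF assms(1)] by metis
  then have "continuous_on {c..d} f"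
    using assms(2) by (intro absolutely_cont_on_continuous_on) (auto simp: AC_loc_def)
  then have "continuous_on {c<..<d} f" by (rule continuous_on_subset) auto
  then show "isCont f x" using cd continuous_on_eq_continuous_at[of "{c<..<d}" f] by auto
qed

lemma AE_lebesgue_on_iff_negligible:
  fixes J :: "'a::euclidean_space set"
  assumes "J \<in> sets lebesgue"
  shows "(AE x in lebesgue_on J. P x) \<longleftrightarrow> negligible {x \<in> J. \<not> P x}"
proof -
  have "(AE x in lebesgue_on J. P x) \<longleftrightarrow> (AE x in lebesgue. x \<in> J \<longrightarrow> P x)"
    using assms by (intro AE_restrict_space_iff) auto
  also have "\<dots> \<longleftrightarrow> negligible {x \<in> J. \<not> P x}"
    by (simp add: completion.AE_iff_null_sets negligible_iff_null_sets)
  finally show ?thesis .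
qed

lemma AC_loc_differentiable_AE:
  assumes "open J" "f \<in> AC_loc J"
  shows "AE x in lebesgue_on J. f differentiable (at x)"
proof -
  have J: "J \<in> sets lebesgue" using assms(1) by auto
  define R where "R = {(c,d). c \<in> \<rat> \<and> d \<in> \<rat> \<and> c < d \<and> {c..d} \<subseteq> J}"
  have "\<exists>N. negligible N \<and> (\<forall>x\<in>{fst I<..<snd I} - N. f differentiable (at x))" if "I \<in> R" for I
    using that assms(2)
    by (intro AC_complex_differentiable_AE absolutely_cont_on_imp_AC_divisions) (auto simp: R_def AC_loc_def)
  then obtain N where N: "\<And>I. I \<in> R \<Longrightarrow> negligible (N I)"
      "\<And>I x. I \<in> R \<Longrightarrow> x \<in> {fst I<..<snd I} - N I \<Longrightarrow> f differentiable (at x)" by metis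
  have "countable R"
    by (rule countable_subset[of _ "\<rat> \<times> \<rat>"]) (auto simp: R_def intro!: countable_SIGMA countable_rat)
  then have "negligible (\<Union>I\<in>R. N I)" using N(1) by (intro negligible_countable_Union) auto
  moreover have "{x \<in> J. \<not> f differentiable (at x)} \<subseteq> (\<Union>I\<in>R. N I)"
  proof
    fix x assume x: "x \<in> {x \<in> J. \<not> f differentiable (at x)}"
    then obtain c d where cd: "c \<in> \<rat>" "d \<in> \<rat>" "c < x" "x < d" "{c..d} \<subseteq> J"
      using open_interval_around[OF assms(1), of x] by auto
    then have "(c,d) \<in> R" by (auto simp: R_def)
    then show "x \<in> (\<Union>I\<in>R. N I)" using N(2)[of "(c,d)" x] x cd by auto
  qed
  ultimately show ?thesis
    unfolding AE_lebesgue_on_iff_negligible[OF J] by (rule negligible_subset)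
qed

lemma AC_loc_has_integral:
  assumes "open J" "f \<in> AC_loc J" "AE x in lebesgue_on J. (f has_vector_derivative g x) (at x)"
    and "c \<le> d" "{c..d} \<subseteq> J"
  shows "(g has_integral f d - f c) {c..d}"
proof -
  have J: "J \<in> sets lebesgue" using assms(1) by auto
  show ?thesis
  proof (rule AC_fundamental_theorem_of_calculus)
    show "AC_divisions c d f"
      using assms by (intro absolutely_cont_on_imp_AC_divisions) (auto simp: AC_loc_def)
    show "negligible {x \<in> J. \<not> (f has_vector_derivative g x) (at x)}"
      using assms(3) unfolding AE_lebesgue_on_iff_negligible[OF J] .
  qed (use assms in auto)
qed

text \<open>The set where the functions differ is open and null, hence empty. This makes quasi-derivatives unique and
  lets a class in \<open>L\<^sup>2\<close> determine its continuous representative.\<close>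

lemma continuous_AE_eq_imp_eq:
  fixes f g :: "'a::euclidean_space \<Rightarrow> 'b::real_normed_vector"
  assumes "open J" "continuous_on J f" "continuous_on J g" "AE x in lebesgue_on J. f x = g x" "x \<in> J"
  shows "f x = g x"
proof (rule ccontr)
  assume "f x \<noteq> g x"
  have "continuous_on J (\<lambda>x. f x - g x)" using assms by (intro continuous_intros)
  then have "open (J \<inter> (\<lambda>x. f x - g x) -` (- {0}))"
    using continuous_open_preimage assms(1) by blast
  moreover have "J \<inter> (\<lambda>x. f x - g x) -` (- {0}) = {x \<in> J. f x \<noteq> g x}" by auto
  ultimately have "open {x \<in> J. f x \<noteq> g x}" by simp
  moreover have "J \<in> sets lebesgue" using assms(1) by auto
  then have "negligible {x \<in> J. f x \<noteq> g x}"
    using assms(4) by (simp add: AE_lebesgue_on_iff_negligible)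
  ultimately have "{x \<in> J. f x \<noteq> g x} = {}" using open_not_negligible by blast
  then show False using \<open>f x \<noteq> g x\<close> assms(5) by blast
qed

lemma borel_measurable_lebesgue_on_AE:
  fixes f g :: "'a::euclidean_space \<Rightarrow> 'b::euclidean_space"
  assumes J: "J \<in> sets lebesgue" and f: "f \<in> borel_measurable (lebesgue_on J)"
    and eq: "AE x in lebesgue_on J. f x = g x"
  shows "g \<in> borel_measurable (lebesgue_on J)"
proof -
  have "(\<lambda>x. if x \<in> J then f x else 0) \<in> borel_measurable lebesgue"
    using f J by (simp add: borel_measurable_if)
  moreover have "AE x in lebesgue. (if x \<in> J then f x else 0) = (if x \<in> J then g x else 0)"
    using eq J by (subst (asm) AE_restrict_space_iff) auto
  ultimately have "(\<lambda>x. if x \<in> J then g x else 0) \<in> borel_measurable lebesgue"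
    by (rule borel_measurable_AE)
  then show ?thesis using J by (simp add: borel_measurable_if)
qed

section \<open>Quasi-derivatives\<close>

locale sturm_liouville_expression =
  fixes \<tau> :: sturm_liouville
  assumes coeffs: "sl_coefficients \<tau>"
begin

abbreviation "S \<equiv> sl_int \<tau>"
abbreviation "M \<equiv> sl_measure \<tau>"
abbreviation "p \<equiv> coeff_p \<tau>"
abbreviation "q \<equiv> coeff_q \<tau>"
abbreviation "r \<equiv> coeff_r \<tau>"
abbreviation "qder \<equiv> quasi_deriv \<tau>"
abbreviation "expr \<equiv> sl_expr \<tau>"

lemma open_S [simp]: "open S"
proof -
  have "S = ereal -` {left_end \<tau><..<right_end \<tau>}" by (auto simp: sl_int_def)
  moreover have "continuous_on UNIV ereal" by (simp add: continuous_on_ereal)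
  ultimately show ?thesis by (metis open_greaterThanLessThan open_vimage)
qed

lemma S_sets [simp]: "S \<in> sets lebesgue" by auto

lemma S_interval: "c \<in> S \<Longrightarrow> d \<in> S \<Longrightarrow> {c..d} \<subseteq> S"
  by (auto simp: sl_int_def) (meson ereal_less_eq(3) less_le_trans le_less_trans)+

lemma p_pos: "AE x in lebesgue_on S. p x > 0" and r_pos: "AE x in lebesgue_on S. r x > 0"
  and r_meas [measurable]: "r \<in> borel_measurable (lebesgue_on S)"
  and r_loc: "r \<in> L1_loc S" and ends_less: "left_end \<tau> < right_end \<tau>"
  using coeffs by (auto simp: sl_coefficients_def)

lemma AC_has_vector_derivative_AE: "f \<in> AC_loc S \<Longrightarrow> AE x in lebesgue_on S. (f has_vector_derivative vector_derivative f (at x)) (at x)"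
  using AC_loc_differentiable_AE[OF open_S, of f] by (auto simp: vector_derivative_works)

lemma AC_continuous_on_S: "f \<in> AC_loc S \<Longrightarrow> continuous_on S f"
  by (rule AC_loc_continuous_on[OF open_S])

text \<open>The defining equation uses \<open>vector_derivative\<close>, which says nothing about \<open>f\<close> where \<open>f\<close> is not
  differentiable. Almost everywhere differentiability turns it into a statement about actual
  derivatives.\<close>

lemma quasi_deriv_iff:
  assumes "f \<in> AC_loc S"
  shows "is_quasi_deriv \<tau> f h \<longleftrightarrow> h \<in> AC_loc S \<and>
    (AE x in lebesgue_on S. (f has_vector_derivative h x / complex_of_real (p x)) (at x))"
proof -
  have "(AE x in lebesgue_on S. h x = complex_of_real (p x) * vector_derivative f (at x)) \<longleftrightarrow>
    (AE x in lebesgue_on S. (f has_vector_derivative h x / complex_of_real (p x)) (at x))"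
  proof
    assume "AE x in lebesgue_on S. h x = complex_of_real (p x) * vector_derivative f (at x)"
    with AC_has_vector_derivative_AE[OF assms] p_pos
    show "AE x in lebesgue_on S. (f has_vector_derivative h x / complex_of_real (p x)) (at x)"
      by eventually_elim auto
  next
    assume "AE x in lebesgue_on S. (f has_vector_derivative h x / complex_of_real (p x)) (at x)"
    with p_pos show "AE x in lebesgue_on S. h x = complex_of_real (p x) * vector_derivative f (at x)"
      by eventually_elim (simp add: vector_derivative_at)
  qed
  then show ?thesis unfolding is_quasi_deriv_def by simp
qed

lemma quasi_deriv_unique:
  assumes "is_quasi_deriv \<tau> f h" "is_quasi_deriv \<tau> f h'" "x \<in> S"
  shows "h x = h' x"
proof (rule continuous_AE_eq_imp_eq[OF open_S _ _ _ assms(3)])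
  show "continuous_on S h" "continuous_on S h'" using assms AC_continuous_on_S by (auto simp: is_quasi_deriv_def)
  show "AE x in lebesgue_on S. h x = h' x"
    using assms(1,2) unfolding is_quasi_deriv_def by (auto elim: AE_mp)
qed

lemma sl_domain_AC: "f \<in> sl_domain \<tau> \<Longrightarrow> f \<in> AC_loc S"
  by (simp add: sl_domain_def)

lemma is_quasi_deriv_quasi_deriv:
  assumes "f \<in> sl_domain \<tau>" shows "is_quasi_deriv \<tau> f (qder f)"
proof -
  have "\<exists>h. is_quasi_deriv \<tau> f h" using assms by (simp add: sl_domain_def)
  then show ?thesis unfolding quasi_deriv_def by (rule someI_ex)
qed

lemma quasi_deriv_AC: "f \<in> sl_domain \<tau> \<Longrightarrow> qder f \<in> AC_loc S"
  using is_quasi_deriv_quasi_deriv by (simp add: is_quasi_deriv_def)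

lemma sl_domain_has_derivative: "f \<in> sl_domain \<tau> \<Longrightarrow>
    AE x in lebesgue_on S. (f has_vector_derivative qder f x / complex_of_real (p x)) (at x)"
  using is_quasi_deriv_quasi_deriv quasi_deriv_iff sl_domain_AC by blast

lemma quasi_deriv_has_derivative: "f \<in> sl_domain \<tau> \<Longrightarrow>
    AE x in lebesgue_on S. (qder f has_vector_derivative
      complex_of_real (q x) * f x - complex_of_real (r x) * expr f x) (at x)"
proof -
  assume f: "f \<in> sl_domain \<tau>"
  show ?thesis using AC_has_vector_derivative_AE[OF quasi_deriv_AC[OF f]] r_pos
    by eventually_elim (simp add: sl_expr_def)
qed

lemma sl_expr_eqI:
  assumes "AE x in lebesgue_on S. (qder f has_vector_derivative D x) (at x)"
  shows "AE x in lebesgue_on S. expr f x = (- D x + complex_of_real (q x) * f x) / complex_of_real (r x)"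
  using assms by eventually_elim (simp add: sl_expr_def vector_derivative_at)

lemma sl_domainI:
  assumes "f \<in> AC_loc S" "h \<in> AC_loc S"
    "AE x in lebesgue_on S. (f has_vector_derivative h x / complex_of_real (p x)) (at x)"
  shows "f \<in> sl_domain \<tau>" "\<And>x. x \<in> S \<Longrightarrow> qder f x = h x"
proof -
  have h: "is_quasi_deriv \<tau> f h" using quasi_deriv_iff assms by blast
  then show dom: "f \<in> sl_domain \<tau>" using assms by (auto simp: sl_domain_def)
  show "qder f x = h x" if "x \<in> S" for x
    using quasi_deriv_unique[OF is_quasi_deriv_quasi_deriv[OF dom] h that] .
qed

lemma has_vector_derivative_on_S:
  assumes "\<And>x. x \<in> S \<Longrightarrow> f x = g x" "(f has_vector_derivative D) (at x)" "x \<in> S"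
  shows "(g has_vector_derivative D) (at x)"
  using has_vector_derivative_transform_within_open[OF assms(2) open_S assms(3)] assms(1) by blast

lemma AE_S: "AE x in lebesgue_on S. x \<in> S"
  by (rule AE_I2) simp

text \<open>Linearity of \<open>\<tau>\<close> holds only almost everywhere: at a point where a function is
  not differentiable, the value of \<open>vector_derivative\<close> is arbitrary and not additive.\<close>

lemma sl_domain_lincomb:
  fixes \<alpha> \<beta> :: complex
  assumes f: "f \<in> sl_domain \<tau>" and g: "g \<in> sl_domain \<tau>"
  defines "h \<equiv> \<lambda>x. \<alpha> * f x + \<beta> * g x"
  shows "h \<in> sl_domain \<tau>" "\<And>x. x \<in> S \<Longrightarrow> qder h x = \<alpha> * qder f x + \<beta> * qder g x"
    "AE x in lebesgue_on S. expr h x = \<alpha> * expr f x + \<beta> * expr g x"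
proof -
  have ac: "h \<in> AC_loc S" "(\<lambda>x. \<alpha> * qder f x + \<beta> * qder g x) \<in> AC_loc S"
    unfolding h_def by (rule AC_loc_lincomb[OF sl_domain_AC[OF f] sl_domain_AC[OF g]], rule AC_loc_lincomb[OF quasi_deriv_AC[OF f] quasi_deriv_AC[OF g]])
  have d: "AE x in lebesgue_on S. (h has_vector_derivative (\<alpha> * qder f x + \<beta> * qder g x) / complex_of_real (p x)) (at x)"
    using sl_domain_has_derivative[OF f] sl_domain_has_derivative[OF g]
  proof eventually_elim
    case (elim x)
    then have "(h has_vector_derivative \<alpha> * (qder f x / complex_of_real (p x)) + \<beta> * (qder g x / complex_of_real (p x))) (at x)"
      unfolding h_def by (intro has_vector_derivative_add has_vector_derivative_mult_right)
    then show ?case by (simp add: add_divide_distrib)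
  qed
  show dom: "h \<in> sl_domain \<tau>" and qdh: "\<And>x. x \<in> S \<Longrightarrow> qder h x = \<alpha> * qder f x + \<beta> * qder g x"
    using sl_domainI[OF ac d] by auto
  have "AE x in lebesgue_on S. (qder h has_vector_derivative
     \<alpha> * (complex_of_real (q x) * f x - complex_of_real (r x) * expr f x) +
     \<beta> * (complex_of_real (q x) * g x - complex_of_real (r x) * expr g x)) (at x)"
    using quasi_deriv_has_derivative[OF f] quasi_deriv_has_derivative[OF g] AE_S
  proof eventually_elim
    case (elim x)
    then have "((\<lambda>x. \<alpha> * qder f x + \<beta> * qder g x) has_vector_derivative
     \<alpha> * (complex_of_real (q x) * f x - complex_of_real (r x) * expr f x) +
     \<beta> * (complex_of_real (q x) * g x - complex_of_real (r x) * expr g x)) (at x)"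
      by (intro has_vector_derivative_add has_vector_derivative_mult_right)
    then show ?case by (rule has_vector_derivative_on_S[rotated]) (use elim qdh in auto)
  qed
  from sl_expr_eqI[OF this] r_pos
  show "AE x in lebesgue_on S. expr h x = \<alpha> * expr f x + \<beta> * expr g x"
  proof eventually_elim
    case (elim x)
    have "- (\<alpha> * (complex_of_real (q x) * f x - complex_of_real (r x) * expr f x) +
        \<beta> * (complex_of_real (q x) * g x - complex_of_real (r x) * expr g x)) + complex_of_real (q x) * h x
      = complex_of_real (r x) * (\<alpha> * expr f x + \<beta> * expr g x)"
      by (simp add: h_def algebra_simps)
    then show ?case using elim by simp
  qed
qed

lemma has_vector_derivative_cnj_comp:
  "(f has_vector_derivative D) (at x) \<Longrightarrow> ((\<lambda>x. cnj (f x)) has_vector_derivative cnj D) (at x)"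
  using bounded_linear.has_vector_derivative[OF bounded_linear_cnj] .

lemma sl_domain_cnj:
  assumes f: "f \<in> sl_domain \<tau>"
  shows "(\<lambda>x. cnj (f x)) \<in> sl_domain \<tau>" "\<And>x. x \<in> S \<Longrightarrow> qder (\<lambda>x. cnj (f x)) x = cnj (qder f x)"
    "AE x in lebesgue_on S. expr (\<lambda>x. cnj (f x)) x = cnj (expr f x)"
proof -
  have ac: "(\<lambda>x. cnj (f x)) \<in> AC_loc S" "(\<lambda>x. cnj (qder f x)) \<in> AC_loc S"
    by (rule AC_loc_cnj[OF sl_domain_AC[OF f]], rule AC_loc_cnj[OF quasi_deriv_AC[OF f]])
  have d: "AE x in lebesgue_on S. ((\<lambda>x. cnj (f x)) has_vector_derivative cnj (qder f x) / complex_of_real (p x)) (at x)"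
    using sl_domain_has_derivative[OF f]
  proof eventually_elim
    case (elim x)
    from has_vector_derivative_cnj_comp[OF this] show ?case by simp
  qed
  show dom: "(\<lambda>x. cnj (f x)) \<in> sl_domain \<tau>" and qdh: "\<And>x. x \<in> S \<Longrightarrow> qder (\<lambda>x. cnj (f x)) x = cnj (qder f x)"
    using sl_domainI[OF ac d] by auto
  have "AE x in lebesgue_on S. (qder (\<lambda>x. cnj (f x)) has_vector_derivative
     cnj (complex_of_real (q x) * f x - complex_of_real (r x) * expr f x)) (at x)"
    using quasi_deriv_has_derivative[OF f] AE_S
  proof eventually_elim
    case (elim x)
    show ?case by (rule has_vector_derivative_on_S[OF _ has_vector_derivative_cnj_comp[OF elim(1)]]) (use elim qdh in auto)
  qed
  from sl_expr_eqI[OF this] r_pos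
  show "AE x in lebesgue_on S. expr (\<lambda>x. cnj (f x)) x = cnj (expr f x)"
    by eventually_elim (simp add: field_simps)
qed

text \<open>Values outside the interval never matter. This is needed because representatives of a class are
  only determined on the interval.\<close>

lemma sl_domain_cong:
  assumes "\<And>x. x \<in> S \<Longrightarrow> f x = g x" "f \<in> sl_domain \<tau>"
  shows "g \<in> sl_domain \<tau>" "\<And>x. x \<in> S \<Longrightarrow> qder g x = qder f x" "AE x in lebesgue_on S. expr g x = expr f x"
proof -
  have ac: "g \<in> AC_loc S" by (rule AC_loc_cong[OF assms(1) sl_domain_AC[OF assms(2)]])
  have d: "AE x in lebesgue_on S. (g has_vector_derivative qder f x / complex_of_real (p x)) (at x)"
    using sl_domain_has_derivative[OF assms(2)] AE_S
  proof eventually_elim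
    case (elim x)
    show ?case by (rule has_vector_derivative_on_S[OF assms(1) elim])
  qed
  show dom: "g \<in> sl_domain \<tau>" and qdh: "\<And>x. x \<in> S \<Longrightarrow> qder g x = qder f x"
    using sl_domainI[OF ac quasi_deriv_AC[OF assms(2)] d] by auto
  have "AE x in lebesgue_on S. (qder g has_vector_derivative
     (complex_of_real (q x) * f x - complex_of_real (r x) * expr f x)) (at x)"
    using quasi_deriv_has_derivative[OF assms(2)] AE_S
  proof eventually_elim
    case (elim x)
    show ?case by (rule has_vector_derivative_on_S[OF qdh[symmetric] elim])
  qed
  from sl_expr_eqI[OF this] r_pos AE_S
  show "AE x in lebesgue_on S. expr g x = expr f x"
  proof eventually_elim
    case (elim x)
    then show ?case using assms(1)[of x] by simp
  qed
qed


lemma sets_M: "sets M = sets (lebesgue_on S)" and space_M: "space M = S"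
  by (simp_all add: sl_measure_def)

lemma measurable_M: "f \<in> borel_measurable M \<longleftrightarrow> f \<in> borel_measurable (lebesgue_on S)"
  by (simp add: measurable_def sets_M space_M)

section \<open>The weighted measure\<close>

text \<open>Since the weight \<open>r\<close> is positive almost everywhere, the weighted measure has the same null
  sets as Lebesgue measure on the interval.\<close>

lemma AE_M: "(AE x in M. P x) \<longleftrightarrow> (AE x in lebesgue_on S. P x)"
proof -
  have "(AE x in M. P x) \<longleftrightarrow> (AE x in lebesgue_on S. 0 < ennreal (r x) \<longrightarrow> P x)"
    unfolding sl_measure_def by (rule AE_density) measurable
  also have "\<dots> \<longleftrightarrow> (AE x in lebesgue_on S. P x)"
  proof
    assume "AE x in lebesgue_on S. 0 < ennreal (r x) \<longrightarrow> P x"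
    with r_pos show "AE x in lebesgue_on S. P x" by eventually_elim simp
  qed (auto elim: AE_mp)
  finally show ?thesis .
qed

lemma integrable_M:
  fixes f :: "real \<Rightarrow> 'b::{banach,second_countable_topology}"
  assumes "f \<in> borel_measurable (lebesgue_on S)"
  shows "integrable M f \<longleftrightarrow> integrable (lebesgue_on S) (\<lambda>x. r x *\<^sub>R f x)"
  unfolding sl_measure_def using assms r_pos
  by (intro integrable_density) (auto elim: eventually_mono)

lemma integral_M:
  fixes f :: "real \<Rightarrow> 'b::{banach,second_countable_topology}"
  assumes "f \<in> borel_measurable (lebesgue_on S)"
  shows "integral\<^sup>L M f = integral\<^sup>L (lebesgue_on S) (\<lambda>x. r x *\<^sub>R f x)"
  unfolding sl_measure_def using assms r_pos
  by (intro integral_density) (auto elim: eventually_mono)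

lemma borel_measurable_AC:
  assumes "f \<in> AC_loc S" shows "f \<in> borel_measurable M"
  unfolding measurable_M
  by (rule continuous_imp_measurable_on_sets_lebesgue[OF AC_continuous_on_S[OF assms]]) simp

end

section \<open>Square integrable functions\<close>

lemma L2_fun_lincomb:
  assumes "f \<in> L2_fun M" "g \<in> L2_fun M"
  shows "(\<lambda>x. \<alpha> * f x + \<beta> * g x) \<in> L2_fun M"
proof -
  have m: "f \<in> borel_measurable M" "g \<in> borel_measurable M"
    and i: "integrable M (\<lambda>x. (cmod (f x))\<^sup>2)" "integrable M (\<lambda>x. (cmod (g x))\<^sup>2)"
    using assms by (auto simp: L2_fun_def)
  have "integrable M (\<lambda>x. 2 * (cmod \<alpha>)\<^sup>2 * (cmod (f x))\<^sup>2 + 2 * (cmod \<beta>)\<^sup>2 * (cmod (g x))\<^sup>2)"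
    using i by (intro Bochner_Integration.integrable_add integrable_mult_right)
  then have "integrable M (\<lambda>x. (cmod (\<alpha> * f x + \<beta> * g x))\<^sup>2)"
  proof (rule Bochner_Integration.integrable_bound)
    show "AE x in M. norm ((cmod (\<alpha> * f x + \<beta> * g x))\<^sup>2) \<le>
        norm (2 * (cmod \<alpha>)\<^sup>2 * (cmod (f x))\<^sup>2 + 2 * (cmod \<beta>)\<^sup>2 * (cmod (g x))\<^sup>2)"
    proof (rule AE_I2)
      fix x
      have "(cmod (\<alpha> * f x + \<beta> * g x))\<^sup>2 \<le> (cmod \<alpha> * cmod (f x) + cmod \<beta> * cmod (g x))\<^sup>2"
        by (intro power_mono) (metis norm_mult norm_triangle_ineq, simp)
      also have "\<dots> \<le> 2 * (cmod \<alpha> * cmod (f x))\<^sup>2 + 2 * (cmod \<beta> * cmod (g x))\<^sup>2"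
        using zero_le_power2[of "cmod \<alpha> * cmod (f x) - cmod \<beta> * cmod (g x)"]
        by (simp add: power2_eq_square algebra_simps)
      finally show "norm ((cmod (\<alpha> * f x + \<beta> * g x))\<^sup>2) \<le>
        norm (2 * (cmod \<alpha>)\<^sup>2 * (cmod (f x))\<^sup>2 + 2 * (cmod \<beta>)\<^sup>2 * (cmod (g x))\<^sup>2)"
        by (simp add: power_mult_distrib)
    qed
  qed (use m in measurable)
  then show ?thesis using m by (simp add: L2_fun_def)
qed

lemma L2_fun_cnj: "f \<in> L2_fun M \<Longrightarrow> (\<lambda>x. cnj (f x)) \<in> L2_fun M"
  using borel_measurable_continuous_on[of cnj f M] by (auto simp: L2_fun_def intro: continuous_intros)

lemma L2_fun_mult_integrable:
  assumes "f \<in> L2_fun M" "g \<in> L2_fun M"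
  shows "integrable M (\<lambda>x. f x * g x)"
proof -
  have m: "f \<in> borel_measurable M" "g \<in> borel_measurable M"
    and i: "integrable M (\<lambda>x. (cmod (f x))\<^sup>2)" "integrable M (\<lambda>x. (cmod (g x))\<^sup>2)"
    using assms by (auto simp: L2_fun_def)
  have "integrable M (\<lambda>x. (cmod (f x))\<^sup>2 + (cmod (g x))\<^sup>2)" using i by simp
  then show ?thesis
  proof (rule Bochner_Integration.integrable_bound)
    show "AE x in M. norm (f x * g x) \<le> norm ((cmod (f x))\<^sup>2 + (cmod (g x))\<^sup>2)"
    proof (rule AE_I2)
      fix x
      have "2 * (cmod (f x) * cmod (g x)) \<le> (cmod (f x))\<^sup>2 + (cmod (g x))\<^sup>2"
        using zero_le_power2[of "cmod (f x) - cmod (g x)"] by (simp add: power2_eq_square algebra_simps)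
      moreover have "0 \<le> cmod (f x) * cmod (g x)" by simp
      ultimately show "norm (f x * g x) \<le> norm ((cmod (f x))\<^sup>2 + (cmod (g x))\<^sup>2)"
        unfolding norm_mult real_norm_def by linarith
    qed
  qed (use m in measurable)
qed

section \<open>The Lagrange identity\<close>

context sturm_liouville_expression
begin

abbreviation "bracket \<equiv> lagrange_bracket \<tau>"

text \<open>The derivative of \<open>[f,g]\<close> with respect to \<open>r dx\<close>.\<close>

definition lagrange_density :: "(real \<Rightarrow> complex) \<Rightarrow> (real \<Rightarrow> complex) \<Rightarrow> real \<Rightarrow> complex" where
  "lagrange_density f g x = expr f x * cnj (g x) - f x * cnj (expr g x)"

lemma bracket_AC:
  assumes "f \<in> sl_domain \<tau>" "g \<in> sl_domain \<tau>"
  shows "bracket f g \<in> AC_loc S"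
proof -
  have "(\<lambda>x. 1 * (f x * cnj (qder g x)) + (-1) * (qder f x * cnj (g x))) \<in> AC_loc S"
    by (intro AC_loc_lincomb AC_loc_mult AC_loc_cnj sl_domain_AC[OF assms(1)] sl_domain_AC[OF assms(2)]
        quasi_deriv_AC[OF assms(1)] quasi_deriv_AC[OF assms(2)])
  then show ?thesis by (simp add: lagrange_bracket_def[abs_def])
qed

text \<open>The products of \<open>p f'\<close> with \<open>g'\<close> cancel, and so do the terms with \<open>q\<close>, because \<open>p\<close> and
  \<open>q\<close> are real.\<close>

lemma bracket_deriv:
  assumes f: "f \<in> sl_domain \<tau>" and g: "g \<in> sl_domain \<tau>"
  shows "AE x in lebesgue_on S. (bracket f g has_vector_derivative r x *\<^sub>R lagrange_density f g x) (at x)"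
  using sl_domain_has_derivative[OF f] sl_domain_has_derivative[OF g] quasi_deriv_has_derivative[OF f] quasi_deriv_has_derivative[OF g] p_pos
proof eventually_elim
  case (elim x)
  let ?f' = "qder f x / complex_of_real (p x)" and ?g' = "qder g x / complex_of_real (p x)"
  let ?f'' = "complex_of_real (q x) * f x - complex_of_real (r x) * expr f x"
  let ?g'' = "complex_of_real (q x) * g x - complex_of_real (r x) * expr g x"
  have "((\<lambda>x. f x * cnj (qder g x) - qder f x * cnj (g x)) has_vector_derivative
      (f x * cnj ?g'' + ?f' * cnj (qder g x)) - (qder f x * cnj ?g' + ?f'' * cnj (g x))) (at x)"
    using elim by (intro has_vector_derivative_diff has_vector_derivative_mult has_vector_derivative_cnj_comp)
  moreover have "(f x * cnj ?g'' + ?f' * cnj (qder g x)) - (qder f x * cnj ?g' + ?f'' * cnj (g x)) =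
      r x *\<^sub>R lagrange_density f g x"
    by (simp add: lagrange_density_def scaleR_conv_of_real algebra_simps)
  ultimately show ?case by (simp add: lagrange_bracket_def[abs_def])
qed

lemma dom_maxD: assumes "f \<in> dom_max \<tau>"
  shows "f \<in> sl_domain \<tau>" "f \<in> L2_fun M" "expr f \<in> L2_fun M"
  using assms by (auto simp: dom_max_def)

lemma lagrange_density_integrable:
  assumes "f \<in> dom_max \<tau>" "g \<in> dom_max \<tau>"
  shows "integrable M (lagrange_density f g)"
    "integrable (lebesgue_on S) (\<lambda>x. r x *\<^sub>R lagrange_density f g x)"
proof -
  show i: "integrable M (lagrange_density f g)"
    unfolding lagrange_density_def[abs_def]
    using assms by (intro Bochner_Integration.integrable_diff L2_fun_mult_integrable L2_fun_cnj dom_maxD)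
  then show "integrable (lebesgue_on S) (\<lambda>x. r x *\<^sub>R lagrange_density f g x)"
    using integrable_M measurable_M by (metis borel_measurable_integrable)
qed

lemma bracket_diff:
  assumes f: "f \<in> dom_max \<tau>" and g: "g \<in> dom_max \<tau>" and cd: "c \<in> S" "d \<in> S" "c \<le> d"
  shows "bracket f g d - bracket f g c = (LINT x|lebesgue_on S. indicator {c..d} x *\<^sub>R (r x *\<^sub>R lagrange_density f g x))"
proof -
  let ?V = "\<lambda>x. r x *\<^sub>R lagrange_density f g x"
  have sub: "{c..d} \<subseteq> S" using S_interval cd by blast
  have "(?V has_integral bracket f g d - bracket f g c) {c..d}"
    using f g by (intro AC_loc_has_integral[OF open_S bracket_AC bracket_deriv] dom_maxD cd sub)
  moreover have "?V absolutely_integrable_on S"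
    using lagrange_density_integrable(2)[OF f g] by (simp add: integrable_restrict_space set_integrable_def)
  then have "?V absolutely_integrable_on {c..d}"
    by (rule set_integrable_subset) (use sub in auto)
  then have "(?V has_integral (LINT x : {c..d} | lebesgue. ?V x)) {c..d}"
    by (rule has_integral_set_lebesgue)
  ultimately have "bracket f g d - bracket f g c = (LINT x : {c..d} | lebesgue. ?V x)"
    by (rule has_integral_unique)
  also have "\<dots> = (LINT x|lebesgue. indicator S x *\<^sub>R (indicator {c..d} x *\<^sub>R ?V x))"
    unfolding set_lebesgue_integral_def using sub
    by (intro Bochner_Integration.integral_cong) (auto simp: indicator_def)
  also have "\<dots> = (LINT x|lebesgue_on S. indicator {c..d} x *\<^sub>R ?V x)"
    by (rule integral_restrict_space[symmetric]) simp
  finally show ?thesis .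
qed

lemma real_of_ereal_S:
  assumes "e \<in> S"
  shows "ereal e < y \<Longrightarrow> y < right_end \<tau> \<Longrightarrow> real_of_ereal y \<in> S \<and> ereal (real_of_ereal y) = y"
    "left_end \<tau> < y \<Longrightarrow> y < ereal e \<Longrightarrow> real_of_ereal y \<in> S \<and> ereal (real_of_ereal y) = y"
proof -
  have e: "left_end \<tau> < ereal e" "ereal e < right_end \<tau>" using assms by (auto simp: sl_int_def)
  have *: "real_of_ereal y \<in> S \<and> ereal (real_of_ereal y) = y" if y: "left_end \<tau> < y" "y < right_end \<tau>"
  proof -
    have "y \<noteq> \<infinity>" "y \<noteq> -\<infinity>" using y by auto
    then show ?thesis using y by (cases y) (auto simp: sl_int_def)
  qed
  show "ereal e < y \<Longrightarrow> y < right_end \<tau> \<Longrightarrow> real_of_ereal y \<in> S \<and> ereal (real_of_ereal y) = y"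
    by (rule *[OF less_trans[OF e(1)]])
  show "left_end \<tau> < y \<Longrightarrow> y < ereal e \<Longrightarrow> real_of_ereal y \<in> S \<and> ereal (real_of_ereal y) = y"
    by (rule *[OF _ less_trans[OF _ e(2)]])
qed

lemma S_nonempty: obtains e where "e \<in> S"
  using ereal_dense2[OF ends_less] that by (auto simp: sl_int_def)

lemma eventually_right_end: "\<forall>\<^sub>F y in at_left (right_end \<tau>). real_of_ereal y \<in> S"
proof -
  obtain e where e: "e \<in> S" using S_nonempty .
  then have "ereal e < right_end \<tau>" by (simp add: sl_int_def)
  then show ?thesis
    using real_of_ereal_S(1)[OF e] by (auto simp: eventually_at_left)
qed

lemma eventually_left_end: "\<forall>\<^sub>F y in at_right (left_end \<tau>). real_of_ereal y \<in> S"
proof -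
  obtain e where e: "e \<in> S" using S_nonempty .
  then have "left_end \<tau> < ereal e" by (simp add: sl_int_def)
  then show ?thesis
    using real_of_ereal_S(2)[OF e] by (auto simp: eventually_at_right)
qed

lemma endpoint_filters_nontrivial: "at_left (right_end \<tau>) \<noteq> bot" "at_right (left_end \<tau>) \<noteq> bot"
proof -
  show "at_left (right_end \<tau>) \<noteq> bot"
  proof
    assume "at_left (right_end \<tau>) = bot"
    then have "\<forall>\<^sub>F y in at_left (right_end \<tau>). False" by simp
    then show False unfolding eventually_at_left[OF ends_less] using dense by blast
  qed
  show "at_right (left_end \<tau>) \<noteq> bot"
  proof
    assume "at_right (left_end \<tau>) = bot"
    then have "\<forall>\<^sub>F y in at_right (left_end \<tau>). False" by simp
    then show False unfolding eventually_at_right[OF ends_less] using dense by blast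
  qed
qed

lemma indicator_scaleR_measurable:
  fixes V :: "real \<Rightarrow> complex"
  assumes "V \<in> borel_measurable (lebesgue_on S)" "A \<in> sets borel"
  shows "(\<lambda>x. indicator A x *\<^sub>R V x) \<in> borel_measurable (lebesgue_on S)"
proof (rule borel_measurable_scaleR[OF _ assms(1)])
  show "indicat_real A \<in> borel_measurable (lebesgue_on S)"
    using assms(2) by (intro measurable_restrict_space1 measurable_completion) simp
qed

lemma truncated_integral_tendsto:
  fixes V :: "real \<Rightarrow> complex" and A :: "nat \<Rightarrow> real set"
  assumes V: "integrable (lebesgue_on S) V" and borel: "\<And>n. A n \<in> sets borel" "B \<in> sets borel"
    and ev: "\<And>x. x \<in> S \<Longrightarrow> \<forall>\<^sub>F n in sequentially. x \<in> A n \<longleftrightarrow> x \<in> B"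
  shows "(\<lambda>n. LINT x|lebesgue_on S. indicator (A n) x *\<^sub>R V x) \<longlonglongrightarrow>
      (LINT x|lebesgue_on S. indicator B x *\<^sub>R V x)"
proof (rule integral_dominated_convergence[where w = "\<lambda>x. norm (V x)"])
  note meas = indicator_scaleR_measurable[OF borel_measurable_integrable[OF V]]
  show "(\<lambda>x. indicator B x *\<^sub>R V x) \<in> borel_measurable (lebesgue_on S)"
    "(\<lambda>x. indicator (A n) x *\<^sub>R V x) \<in> borel_measurable (lebesgue_on S)" for n
    by (rule meas[OF borel(2)], rule meas[OF borel(1)])
  show "integrable (lebesgue_on S) (\<lambda>x. norm (V x))" using V by (rule integrable_norm)
  show "AE x in lebesgue_on S. norm (indicator (A n) x *\<^sub>R V x) \<le> norm (V x)" for n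
    by (rule AE_I2) (auto simp: indicator_def)
  show "AE x in lebesgue_on S. (\<lambda>n. indicator (A n) x *\<^sub>R V x) \<longlonglongrightarrow> indicator B x *\<^sub>R V x"
  proof (rule AE_I2)
    fix x assume "x \<in> space (lebesgue_on S)"
    then have "\<forall>\<^sub>F n in sequentially. x \<in> A n \<longleftrightarrow> x \<in> B" using ev by simp
    then have "\<forall>\<^sub>F n in sequentially. indicator (A n) x *\<^sub>R V x = indicator B x *\<^sub>R V x"
      by eventually_elim (simp add: indicator_def)
    then show "(\<lambda>n. indicator (A n) x *\<^sub>R V x) \<longlonglongrightarrow> indicator B x *\<^sub>R V x"
      by (rule tendsto_eventually)
  qed
qed

text \<open>The bracket at \<open>t\<close> is its value at \<open>e\<close> plus the integral of the integrable Lagrange density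
  over \<open>{e..t}\<close>, so its limit exists by dominated convergence.\<close>

lemma bracket_right_tendsto:
  assumes f: "f \<in> dom_max \<tau>" and g: "g \<in> dom_max \<tau>" and e: "e \<in> S"
  shows "((bracket f g \<circ> real_of_ereal) \<longlongrightarrow>
     bracket f g e + (LINT x|lebesgue_on S. indicator {e..} x *\<^sub>R (r x *\<^sub>R lagrange_density f g x)))
     (at_left (right_end \<tau>))"
proof (rule tendsto_at_left_sequentially[of "ereal e"])
  show "ereal e < right_end \<tau>" using e by (simp add: sl_int_def)
  fix s assume s: "\<And>n. s n < right_end \<tau>" "\<And>n. ereal e < s n" "incseq s" "s \<longlonglongrightarrow> right_end \<tau>"
  let ?V = "\<lambda>x. r x *\<^sub>R lagrange_density f g x"
  define t where "t n = real_of_ereal (s n)" for n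
  have t: "t n \<in> S" "ereal (t n) = s n" for n
    using real_of_ereal_S(1)[OF e s(2) s(1)] by (auto simp: t_def)
  have et: "e \<le> t n" for n using s(2)[of n] t(2)[of n] by (metis ereal_less_eq(3) less_imp_le)
  have "(\<lambda>n. LINT x|lebesgue_on S. indicator {e..t n} x *\<^sub>R ?V x) \<longlonglongrightarrow>
      (LINT x|lebesgue_on S. indicator {e..} x *\<^sub>R ?V x)"
  proof (rule truncated_integral_tendsto[OF lagrange_density_integrable(2)[OF f g]])
    fix x assume "x \<in> S"
    then have "ereal x < right_end \<tau>" by (simp add: sl_int_def)
    then have "\<forall>\<^sub>F n in sequentially. ereal x < s n" using s(4) by (rule order_tendstoD(1)[rotated])
    then show "\<forall>\<^sub>F n in sequentially. x \<in> {e..t n} \<longleftrightarrow> x \<in> {e..}"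
    proof eventually_elim
      case (elim n)
      then have "x \<le> t n" using t(2)[of n] by (metis ereal_less_eq(3) less_imp_le)
      then show ?case by simp
    qed
  qed simp_all
  then have "(\<lambda>n. bracket f g e + (LINT x|lebesgue_on S. indicator {e..t n} x *\<^sub>R ?V x)) \<longlonglongrightarrow>
      bracket f g e + (LINT x|lebesgue_on S. indicator {e..} x *\<^sub>R ?V x)"
    by (intro tendsto_add tendsto_const)
  moreover have "bracket f g e + (LINT x|lebesgue_on S. indicator {e..t n} x *\<^sub>R ?V x) = (bracket f g \<circ> real_of_ereal) (s n)" for n
    using bracket_diff[OF f g e t(1) et, of n] by (simp add: t_def algebra_simps)
  ultimately show "(\<lambda>n. (bracket f g \<circ> real_of_ereal) (s n)) \<longlonglongrightarrow> bracket f g e + (LINT x|lebesgue_on S. indicator {e..} x *\<^sub>R ?V x)"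
    by simp
qed

lemma bracket_left_tendsto:
  assumes f: "f \<in> dom_max \<tau>" and g: "g \<in> dom_max \<tau>" and e: "e \<in> S"
  shows "((bracket f g \<circ> real_of_ereal) \<longlongrightarrow>
     bracket f g e - (LINT x|lebesgue_on S. indicator {..e} x *\<^sub>R (r x *\<^sub>R lagrange_density f g x)))
     (at_right (left_end \<tau>))"
proof (rule tendsto_at_right_sequentially[of _ "ereal e"])
  show "left_end \<tau> < ereal e" using e by (simp add: sl_int_def)
  fix s assume s: "\<And>n. left_end \<tau> < s n" "\<And>n. s n < ereal e" "decseq s" "s \<longlonglongrightarrow> left_end \<tau>"
  let ?V = "\<lambda>x. r x *\<^sub>R lagrange_density f g x"
  define t where "t n = real_of_ereal (s n)" for n
  have t: "t n \<in> S" "ereal (t n) = s n" for n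
    using real_of_ereal_S(2)[OF e s(1) s(2)] by (auto simp: t_def)
  have et: "t n \<le> e" for n using s(2)[of n] t(2)[of n] by (metis ereal_less_eq(3) less_imp_le)
  have "(\<lambda>n. LINT x|lebesgue_on S. indicator {t n..e} x *\<^sub>R ?V x) \<longlonglongrightarrow>
      (LINT x|lebesgue_on S. indicator {..e} x *\<^sub>R ?V x)"
  proof (rule truncated_integral_tendsto[OF lagrange_density_integrable(2)[OF f g]])
    fix x assume "x \<in> S"
    then have "left_end \<tau> < ereal x" by (simp add: sl_int_def)
    then have "\<forall>\<^sub>F n in sequentially. s n < ereal x" using s(4) by (rule order_tendstoD(2)[rotated])
    then show "\<forall>\<^sub>F n in sequentially. x \<in> {t n..e} \<longleftrightarrow> x \<in> {..e}"
    proof eventually_elim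
      case (elim n)
      then have "t n \<le> x" using t(2)[of n] by (metis ereal_less_eq(3) less_imp_le)
      then show ?case by simp
    qed
  qed simp_all
  then have "(\<lambda>n. bracket f g e - (LINT x|lebesgue_on S. indicator {t n..e} x *\<^sub>R ?V x)) \<longlonglongrightarrow>
      bracket f g e - (LINT x|lebesgue_on S. indicator {..e} x *\<^sub>R ?V x)"
    by (intro tendsto_diff tendsto_const)
  moreover have "bracket f g e - (LINT x|lebesgue_on S. indicator {t n..e} x *\<^sub>R ?V x) = (bracket f g \<circ> real_of_ereal) (s n)" for n
    using bracket_diff[OF f g t(1) e et, of n] by (simp add: t_def algebra_simps)
  ultimately show "(\<lambda>n. (bracket f g \<circ> real_of_ereal) (s n)) \<longlonglongrightarrow> bracket f g e - (LINT x|lebesgue_on S. indicator {..e} x *\<^sub>R ?V x)"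
    by simp
qed

abbreviation "bracket_l \<equiv> bracket_left \<tau>"
abbreviation "bracket_r \<equiv> bracket_right \<tau>"

lemma bracket_limits:
  assumes "f \<in> dom_max \<tau>" "g \<in> dom_max \<tau>"
  shows "((bracket f g \<circ> real_of_ereal) \<longlongrightarrow> bracket_r f g) (at_left (right_end \<tau>))"
    "((bracket f g \<circ> real_of_ereal) \<longlongrightarrow> bracket_l f g) (at_right (left_end \<tau>))"
proof -
  obtain e where e: "e \<in> S" using S_nonempty .
  show "((bracket f g \<circ> real_of_ereal) \<longlongrightarrow> bracket_r f g) (at_left (right_end \<tau>))"
    using bracket_right_tendsto[OF assms e] tendsto_Lim[OF endpoint_filters_nontrivial(1) bracket_right_tendsto[OF assms e]]
    by (simp add: bracket_right_def)
  show "((bracket f g \<circ> real_of_ereal) \<longlongrightarrow> bracket_l f g) (at_right (left_end \<tau>))"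
    using bracket_left_tendsto[OF assms e] tendsto_Lim[OF endpoint_filters_nontrivial(2) bracket_left_tendsto[OF assms e]]
    by (simp add: bracket_left_def)
qed

theorem lagrange_identity:
  assumes f: "f \<in> dom_max \<tau>" and g: "g \<in> dom_max \<tau>"
  shows "bracket_r f g - bracket_l f g = (LINT x|M. expr f x * cnj (g x) - f x * cnj (expr g x))"
proof -
  obtain e where e: "e \<in> S" using S_nonempty .
  let ?V = "\<lambda>x. r x *\<^sub>R lagrange_density f g x"
  have V: "integrable (lebesgue_on S) ?V" by (rule lagrange_density_integrable[OF f g])
  have ind: "integrable (lebesgue_on S) (\<lambda>x. indicator A x *\<^sub>R ?V x)" if "A \<in> sets borel" for A
    by (rule Bochner_Integration.integrable_bound[OF V indicator_scaleR_measurable[OF borel_measurable_integrable[OF V] that]])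
      (auto simp: indicator_def)
  have "bracket_r f g = bracket f g e + (LINT x|lebesgue_on S. indicator {e..} x *\<^sub>R ?V x)"
    by (rule tendsto_unique[OF endpoint_filters_nontrivial(1) bracket_limits(1)[OF f g] bracket_right_tendsto[OF f g e]])
  moreover have "bracket_l f g = bracket f g e - (LINT x|lebesgue_on S. indicator {..e} x *\<^sub>R ?V x)"
    by (rule tendsto_unique[OF endpoint_filters_nontrivial(2) bracket_limits(2)[OF f g] bracket_left_tendsto[OF f g e]])
  ultimately have "bracket_r f g - bracket_l f g = (LINT x|lebesgue_on S. indicator {e..} x *\<^sub>R ?V x)
      + (LINT x|lebesgue_on S. indicator {..e} x *\<^sub>R ?V x)" by simp
  also have "\<dots> = (LINT x|lebesgue_on S. indicator {e..} x *\<^sub>R ?V x + indicator {..e} x *\<^sub>R ?V x)"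
    by (rule Bochner_Integration.integral_add[symmetric]; rule ind; simp)
  also have "\<dots> = (LINT x|lebesgue_on S. ?V x)"
  proof (rule integral_cong_AE)
    have "AE x in lebesgue_on S. x \<noteq> e"
      unfolding AE_lebesgue_on_iff_negligible[OF S_sets] by (rule negligible_subset[of "{e}"]) auto
    then show "AE x in lebesgue_on S. indicator {e..} x *\<^sub>R ?V x + indicator {..e} x *\<^sub>R ?V x = ?V x"
      by eventually_elim (auto simp: indicator_def)
  qed (use V ind[of "{e..}"] ind[of "{..e}"] in \<open>auto intro!: borel_measurable_add dest: borel_measurable_integrable\<close>)
  also have "\<dots> = (LINT x|M. lagrange_density f g x)"
    using integral_M[of "lagrange_density f g"] lagrange_density_integrable(1)[OF f g] measurable_M
    by (metis borel_measurable_integrable)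
  finally show ?thesis by (simp add: lagrange_density_def)
qed

end

context sturm_liouville_expression
begin

section \<open>The maximal domain\<close>

lemma L2_fun_cong_AE:
  assumes "f \<in> L2_fun M" "AE x in M. f x = g x"
  shows "g \<in> L2_fun M"
proof -
  have m: "g \<in> borel_measurable M"
    using assms borel_measurable_lebesgue_on_AE[OF S_sets, of f g]
    by (simp add: L2_fun_def measurable_M AE_M)
  have "integrable M (\<lambda>x. (cmod (f x))\<^sup>2) \<longleftrightarrow> integrable M (\<lambda>x. (cmod (g x))\<^sup>2)"
    using assms m by (intro integrable_cong_AE) (auto simp: L2_fun_def elim: eventually_mono)
  then show ?thesis using m assms(1) by (simp add: L2_fun_def)
qed

lemma AE_M_S: "AE x in M. x \<in> S"
  using AE_S by (simp add: AE_M)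

lemma dom_max_lincomb:
  fixes \<alpha> \<beta> :: complex
  assumes f: "f \<in> dom_max \<tau>" and g: "g \<in> dom_max \<tau>"
  shows "(\<lambda>x. \<alpha> * f x + \<beta> * g x) \<in> dom_max \<tau>"
    "AE x in M. expr (\<lambda>x. \<alpha> * f x + \<beta> * g x) x = \<alpha> * expr f x + \<beta> * expr g x"
proof -
  note l = sl_domain_lincomb[OF dom_maxD(1)[OF f] dom_maxD(1)[OF g], where \<alpha> = \<alpha> and \<beta> = \<beta>]
  show e: "AE x in M. expr (\<lambda>x. \<alpha> * f x + \<beta> * g x) x = \<alpha> * expr f x + \<beta> * expr g x"
    using l(3) by (simp add: AE_M)
  have "expr (\<lambda>x. \<alpha> * f x + \<beta> * g x) \<in> L2_fun M"
    by (rule L2_fun_cong_AE[OF L2_fun_lincomb[OF dom_maxD(3)[OF f] dom_maxD(3)[OF g], of \<alpha> \<beta>]])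
      (use e in \<open>auto elim: eventually_mono\<close>)
  then show "(\<lambda>x. \<alpha> * f x + \<beta> * g x) \<in> dom_max \<tau>"
    using l(1) L2_fun_lincomb[OF dom_maxD(2)[OF f] dom_maxD(2)[OF g], of \<alpha> \<beta>] by (simp add: dom_max_def)
qed

lemma dom_max_cnj:
  assumes f: "f \<in> dom_max \<tau>"
  shows "(\<lambda>x. cnj (f x)) \<in> dom_max \<tau>" "AE x in M. expr (\<lambda>x. cnj (f x)) x = cnj (expr f x)"
proof -
  note l = sl_domain_cnj[OF dom_maxD(1)[OF f]]
  show e: "AE x in M. expr (\<lambda>x. cnj (f x)) x = cnj (expr f x)"
    using l(3) by (simp add: AE_M)
  have "expr (\<lambda>x. cnj (f x)) \<in> L2_fun M"
    by (rule L2_fun_cong_AE[OF L2_fun_cnj[OF dom_maxD(3)[OF f]]])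
      (use e in \<open>auto elim: eventually_mono\<close>)
  then show "(\<lambda>x. cnj (f x)) \<in> dom_max \<tau>"
    using l(1) L2_fun_cnj[OF dom_maxD(2)[OF f]] by (simp add: dom_max_def)
qed

lemma quasi_deriv_of_real:
  assumes "\<phi> \<in> sl_domain \<tau>" "\<And>x. x \<in> S \<Longrightarrow> \<phi> x \<in> \<real>" "x \<in> S"
  shows "cnj (qder \<phi> x) = qder \<phi> x"
proof -
  have "qder (\<lambda>x. cnj (\<phi> x)) x = qder \<phi> x"
    by (rule sl_domain_cong(2)[OF _ assms(1,3)]) (use assms(2) in \<open>simp add: Reals_cnj_iff\<close>)
  then show ?thesis using sl_domain_cnj(2)[OF assms(1,3)] by simp
qed

section \<open>Brackets at an endpoint\<close>

text \<open>The two endpoints enter the argument in the same way. All that matters about the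
  filter \<open>at_left (right_end \<tau>)\<close>, and likewise about \<open>at_right (left_end \<tau>)\<close>, is that it is
  nontrivial, lives on the interval, and makes every bracket converge.\<close>

definition endpoint :: "ereal filter \<Rightarrow> bool" where
  "endpoint F \<longleftrightarrow> F \<noteq> bot \<and> (\<forall>\<^sub>F y in F. real_of_ereal y \<in> S) \<and>
     (\<forall>f\<in>dom_max \<tau>. \<forall>g\<in>dom_max \<tau>. \<exists>L. ((bracket f g \<circ> real_of_ereal) \<longlongrightarrow> L) F)"

definition blim :: "ereal filter \<Rightarrow> (real \<Rightarrow> complex) \<Rightarrow> (real \<Rightarrow> complex) \<Rightarrow> complex" where
  "blim F f g = Lim F (bracket f g \<circ> real_of_ereal)"

lemma endpoint_right: "endpoint (at_left (right_end \<tau>))" and endpoint_left: "endpoint (at_right (left_end \<tau>))"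
  unfolding endpoint_def using endpoint_filters_nontrivial eventually_right_end eventually_left_end bracket_limits by blast+

lemma bracket_right_eq_blim: "bracket_r f g = blim (at_left (right_end \<tau>)) f g" and bracket_left_eq_blim: "bracket_l f g = blim (at_right (left_end \<tau>)) f g"
  by (simp_all add: bracket_right_def bracket_left_def blim_def)

lemma blim_tendsto:
  assumes "endpoint F" "f \<in> dom_max \<tau>" "g \<in> dom_max \<tau>"
  shows "((\<lambda>y. bracket f g (real_of_ereal y)) \<longlongrightarrow> blim F f g) F"
proof -
  obtain L where "((bracket f g \<circ> real_of_ereal) \<longlongrightarrow> L) F" using assms unfolding endpoint_def by blast
  moreover from this have "blim F f g = L"
    using assms(1) unfolding blim_def endpoint_def by (intro tendsto_Lim) auto
  ultimately show ?thesis by (simp add: comp_def)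
qed

lemma blim_eqI:
  assumes F: "endpoint F" and L: "((\<lambda>y. G (real_of_ereal y)) \<longlongrightarrow> L) F" and eq: "\<And>x. x \<in> S \<Longrightarrow> bracket f g x = G x"
  shows "blim F f g = L"
proof -
  have "\<forall>\<^sub>F y in F. G (real_of_ereal y) = (bracket f g \<circ> real_of_ereal) y"
    using F unfolding endpoint_def by (auto elim!: eventually_mono simp: eq)
  then have "((bracket f g \<circ> real_of_ereal) \<longlongrightarrow> L) F"
    by (rule Lim_transform_eventually[OF L])
  then show ?thesis using F unfolding blim_def endpoint_def by (intro tendsto_Lim) auto
qed

lemma blim_cong:
  assumes F: "endpoint F" and f: "f \<in> dom_max \<tau>" "\<And>x. x \<in> S \<Longrightarrow> f x = f' x" and g: "g \<in> dom_max \<tau>"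
  shows "blim F f' g = blim F f g"
proof (rule blim_eqI[OF F blim_tendsto[OF F f(1) g]])
  fix x assume x: "x \<in> S"
  then show "bracket f' g x = bracket f g x"
    using sl_domain_cong(2)[OF f(2) dom_maxD(1)[OF f(1)] x] f(2)[OF x] by (simp add: lagrange_bracket_def)
qed

lemma blim_lincomb:
  fixes \<alpha> \<beta> :: complex
  assumes F: "endpoint F" and f: "f \<in> dom_max \<tau>" "f' \<in> dom_max \<tau>" and g: "g \<in> dom_max \<tau>"
  shows "blim F (\<lambda>x. \<alpha> * f x + \<beta> * f' x) g = \<alpha> * blim F f g + \<beta> * blim F f' g"
proof (rule blim_eqI[OF F])
  show "((\<lambda>y. (\<lambda>x. \<alpha> * bracket f g x + \<beta> * bracket f' g x) (real_of_ereal y)) \<longlongrightarrow> \<alpha> * blim F f g + \<beta> * blim F f' g) F"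
    by (intro tendsto_intros blim_tendsto F f g)
  fix x assume x: "x \<in> S"
  show "bracket (\<lambda>x. \<alpha> * f x + \<beta> * f' x) g x = \<alpha> * bracket f g x + \<beta> * bracket f' g x"
    using sl_domain_lincomb(2)[OF dom_maxD(1)[OF f(1)] dom_maxD(1)[OF f(2)] x, where \<alpha> = \<alpha> and \<beta> = \<beta>]
    by (simp add: lagrange_bracket_def algebra_simps)
qed

lemma blim_cnj:
  assumes F: "endpoint F" and f: "f \<in> dom_max \<tau>" and \<phi>: "\<phi> \<in> dom_max \<tau>" "\<And>x. x \<in> S \<Longrightarrow> \<phi> x \<in> \<real>"
  shows "blim F (\<lambda>x. cnj (f x)) \<phi> = cnj (blim F f \<phi>)"
proof (rule blim_eqI[OF F])
  show "((\<lambda>y. (\<lambda>x. cnj (bracket f \<phi> x)) (real_of_ereal y)) \<longlongrightarrow> cnj (blim F f \<phi>)) F"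
    by (intro tendsto_cnj blim_tendsto F f \<phi>)
  fix x assume x: "x \<in> S"
  have "cnj (\<phi> x) = \<phi> x" "cnj (qder \<phi> x) = qder \<phi> x"
    using quasi_deriv_of_real[OF dom_maxD(1)[OF \<phi>(1)] \<phi>(2) x] \<phi>(2)[OF x] by (auto simp: Reals_cnj_iff)
  then show "bracket (\<lambda>x. cnj (f x)) \<phi> x = cnj (bracket f \<phi> x)"
    using sl_domain_cnj(2)[OF dom_maxD(1)[OF f] x] by (simp add: lagrange_bracket_def)
qed

text \<open>Pointwise this is the Pluecker relation
  \<open>W(f,g) W(\<psi>,\<phi>) = W(f,\<psi>) W(g,\<phi>) - W(f,\<phi>) W(g,\<psi>)\<close> between the \<open>2\<times>2\<close> minors of four
  vectors \<open>(f, p f')\<close> in the plane, with \<open>g\<close> replaced by its conjugate; reality of \<open>\<phi>\<close> and \<open>\<psi>\<close> permits moving the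
  conjugation onto the brackets.\<close>

lemma blim_pluecker:
  assumes F: "endpoint F" and f: "f \<in> dom_max \<tau>" and g: "g \<in> dom_max \<tau>"
    and \<phi>: "\<phi> \<in> dom_max \<tau>" "\<And>x. x \<in> S \<Longrightarrow> \<phi> x \<in> \<real>" and \<psi>: "\<psi> \<in> dom_max \<tau>" "\<And>x. x \<in> S \<Longrightarrow> \<psi> x \<in> \<real>"
    and one: "blim F \<psi> \<phi> = 1"
  shows "blim F f g = blim F f \<psi> * cnj (blim F g \<phi>) - blim F f \<phi> * cnj (blim F g \<psi>)"
proof -
  have nb: "F \<noteq> bot" using F by (simp add: endpoint_def)
  let ?r = "real_of_ereal"
  have "((\<lambda>y. bracket f \<psi> (?r y) * cnj (bracket g \<phi> (?r y)) - bracket f \<phi> (?r y) * cnj (bracket g \<psi> (?r y))) \<longlongrightarrow>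
      blim F f \<psi> * cnj (blim F g \<phi>) - blim F f \<phi> * cnj (blim F g \<psi>)) F"
    by (intro tendsto_intros tendsto_cnj blim_tendsto F f g \<phi> \<psi>)
  moreover have "\<forall>\<^sub>F y in F. bracket f \<psi> (?r y) * cnj (bracket g \<phi> (?r y)) - bracket f \<phi> (?r y) * cnj (bracket g \<psi> (?r y))
      = bracket f g (?r y) * bracket \<psi> \<phi> (?r y)"
  proof -
    have "bracket f \<psi> x * cnj (bracket g \<phi> x) - bracket f \<phi> x * cnj (bracket g \<psi> x) = bracket f g x * bracket \<psi> \<phi> x" if x: "x \<in> S" for x
    proof -
      have "cnj (\<phi> x) = \<phi> x" "cnj (qder \<phi> x) = qder \<phi> x" "cnj (\<psi> x) = \<psi> x" "cnj (qder \<psi> x) = qder \<psi> x"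
        using quasi_deriv_of_real[OF dom_maxD(1)[OF \<phi>(1)] \<phi>(2) x] \<phi>(2)[OF x] quasi_deriv_of_real[OF dom_maxD(1)[OF \<psi>(1)] \<psi>(2) x] \<psi>(2)[OF x]
        by (auto simp: Reals_cnj_iff)
      then show ?thesis by (simp add: lagrange_bracket_def algebra_simps)
    qed
    then show ?thesis using F unfolding endpoint_def by (auto elim!: eventually_mono)
  qed
  ultimately have "((\<lambda>y. bracket f g (?r y) * bracket \<psi> \<phi> (?r y)) \<longlongrightarrow>
      blim F f \<psi> * cnj (blim F g \<phi>) - blim F f \<phi> * cnj (blim F g \<psi>)) F"
    by (rule Lim_transform_eventually)
  moreover have "((\<lambda>y. bracket f g (?r y) * bracket \<psi> \<phi> (?r y)) \<longlongrightarrow> blim F f g * 1) F"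
    unfolding one[symmetric] by (intro tendsto_intros blim_tendsto F f g \<phi> \<psi>)
  ultimately show ?thesis using tendsto_unique[OF nb] by fastforce
qed

section \<open>Solutions in the limit circle case\<close>

lemma r_integrable_Icc:
  assumes "c \<in> S" "d \<in> S"
  shows "integrable (lebesgue_on S) (\<lambda>x. indicator {c..d} x * r x)"
proof (cases "c \<le> d")
  case True
  have sub: "{c..d} \<subseteq> S" using S_interval assms by blast
  then have "r absolutely_integrable_on {c..d}" using r_loc True by (simp add: L1_loc_def)
  then have "integrable lebesgue (\<lambda>x. indicator {c..d} x *\<^sub>R r x)" by (simp add: set_integrable_def)
  moreover have "(\<lambda>x. indicator {c..d} x *\<^sub>R r x) = (\<lambda>x. indicator S x *\<^sub>R (indicator {c..d} x * r x))"
    using sub by (auto simp: indicator_def fun_eq_iff)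
  ultimately have "integrable lebesgue (\<lambda>x. indicator S x *\<^sub>R (indicator {c..d} x * r x))" by (simp only:)
  then show ?thesis by (subst integrable_restrict_space) simp_all
qed simp

text \<open>The limit circle hypotheses control a solution near the endpoints. In between it is bounded, and \<open>r\<close>
  is integrable there.\<close>

lemma solution_dom_max:
  assumes "limit_circle_left \<tau>" "limit_circle_right \<tau>" and u: "sl_solution \<tau> z u"
  shows "u \<in> dom_max \<tau>" "AE x in M. expr u x = z * u x"
proof -
  have dom: "u \<in> sl_domain \<tau>" and eq: "AE x in M. expr u x = z * u x"
    using u by (auto simp: sl_solution_def AE_M)
  show "AE x in M. expr u x = z * u x" by fact
  obtain c where c: "c \<in> S" "set_integrable M {..<c} (\<lambda>x. (cmod (u x))\<^sup>2)"
    using assms(1) u by (auto simp: limit_circle_left_def)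
  obtain d where d: "d \<in> S" "set_integrable M {d<..} (\<lambda>x. (cmod (u x))\<^sup>2)"
    using assms(2) u by (auto simp: limit_circle_right_def)
  have meas: "u \<in> borel_measurable M" by (rule borel_measurable_AC[OF sl_domain_AC[OF dom]])
  have sub: "{c..d} \<subseteq> S" using S_interval c(1) d(1) by blast
  have "bounded (u ` {c..d})"
    by (intro compact_imp_bounded compact_continuous_image continuous_on_subset[OF AC_continuous_on_S[OF sl_domain_AC[OF dom]] sub]) simp
  then obtain B where B: "\<And>x. x \<in> {c..d} \<Longrightarrow> cmod (u x) \<le> B"
    unfolding bounded_iff by blast
  have mid: "integrable M (\<lambda>x. indicator {c..d} x * B\<^sup>2)"
  proof -
    have "(\<lambda>x. indicator {c..d} x * B\<^sup>2) \<in> borel_measurable (lebesgue_on S)"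
      by (intro measurable_restrict_space1 measurable_completion) simp
    moreover have "integrable (lebesgue_on S) (\<lambda>x. indicator {c..d} x * r x * B\<^sup>2)"
      by (intro integrable_mult_left r_integrable_Icc c d)
    ultimately show ?thesis
      by (subst integrable_M) (simp_all add: mult_ac)
  qed
  have "integrable M (\<lambda>x. indicator {..<c} x *\<^sub>R (cmod (u x))\<^sup>2 + indicator {d<..} x *\<^sub>R (cmod (u x))\<^sup>2 + indicator {c..d} x * B\<^sup>2)"
    using c(2) d(2) mid unfolding set_integrable_def by (intro Bochner_Integration.integrable_add)
  then have "integrable M (\<lambda>x. (cmod (u x))\<^sup>2)"
  proof (rule Bochner_Integration.integrable_bound)
    show "(\<lambda>x. (cmod (u x))\<^sup>2) \<in> borel_measurable M" using meas by measurable
    show "AE x in M. norm ((cmod (u x))\<^sup>2) \<le>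
      norm (indicator {..<c} x *\<^sub>R (cmod (u x))\<^sup>2 + indicator {d<..} x *\<^sub>R (cmod (u x))\<^sup>2 + indicator {c..d} x * B\<^sup>2)"
    proof (rule AE_I2)
      fix x
      have "(cmod (u x))\<^sup>2 \<le> B\<^sup>2" if "x \<in> {c..d}" using B[OF that] by (intro power_mono) auto
      then show "norm ((cmod (u x))\<^sup>2) \<le>
        norm (indicator {..<c} x *\<^sub>R (cmod (u x))\<^sup>2 + indicator {d<..} x *\<^sub>R (cmod (u x))\<^sup>2 + indicator {c..d} x * B\<^sup>2)"
        by (auto simp: indicator_def)
    qed
  qed
  then have u2: "u \<in> L2_fun M" using meas by (simp add: L2_fun_def)
  have "(\<lambda>x. z * u x + 0 * u x) \<in> L2_fun M" by (rule L2_fun_lincomb[OF u2 u2])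
  then have "expr u \<in> L2_fun M"
    by (rule L2_fun_cong_AE) (use eq in \<open>auto elim: eventually_mono\<close>)
  then show "u \<in> dom_max \<tau>" using dom u2 by (simp add: dom_max_def)
qed

end

section \<open>Classes in \<open>L\<^sup>2\<close>\<close>

lemma L2_class_cong:
  assumes "AE x in M. f x = g x"
  shows "L2_class M f = L2_class M g"
proof -
  have "(AE x in M. h x = f x) \<longleftrightarrow> (AE x in M. h x = g x)" for h
    using assms by (auto elim: AE_mp)
  then show ?thesis by (simp add: L2_class_def)
qed

lemma L2_rep_class:
  assumes "f \<in> L2_fun M"
  shows "L2_rep (L2_class M f) \<in> L2_fun M" "AE x in M. L2_rep (L2_class M f) x = f x"
proof -
  have "f \<in> L2_class M f" using assms by (simp add: L2_class_def)
  then have "L2_rep (L2_class M f) \<in> L2_class M f"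
    unfolding L2_rep_def by (rule someI[of "\<lambda>h. h \<in> L2_class M f"])
  then show "L2_rep (L2_class M f) \<in> L2_fun M" "AE x in M. L2_rep (L2_class M f) x = f x"
    by (auto simp: L2_class_def)
qed

lemma L2_class_eq_iff:
  assumes "f \<in> L2_fun M"
  shows "L2_class M f = L2_class M g \<longleftrightarrow> (AE x in M. f x = g x)"
proof
  assume "L2_class M f = L2_class M g"
  moreover have "f \<in> L2_class M f" using assms by (simp add: L2_class_def)
  ultimately show "AE x in M. f x = g x" by (simp add: L2_class_def)
qed (rule L2_class_cong)

lemma L2_add_class:
  assumes "f \<in> L2_fun M" "g \<in> L2_fun M"
  shows "L2_add M (L2_class M f) (L2_class M g) = L2_class M (\<lambda>x. f x + g x)"
  unfolding L2_add_def
proof (rule L2_class_cong)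
  show "AE x in M. L2_rep (L2_class M f) x + L2_rep (L2_class M g) x = f x + g x"
    using L2_rep_class(2)[OF assms(1)] L2_rep_class(2)[OF assms(2)] by eventually_elim simp
qed

lemma L2_scale_class:
  assumes "f \<in> L2_fun M"
  shows "L2_scale M c (L2_class M f) = L2_class M (\<lambda>x. c * f x)"
  unfolding L2_scale_def
proof (rule L2_class_cong)
  show "AE x in M. c * L2_rep (L2_class M f) x = c * f x"
    using L2_rep_class(2)[OF assms(1)] by eventually_elim simp
qed

lemma L2_inner_class:
  assumes "f \<in> L2_fun M" "g \<in> L2_fun M"
  shows "L2_inner M (L2_class M f) (L2_class M g) = (LINT x|M. cnj (f x) * g x)"
  unfolding L2_inner_def
proof (rule integral_cong_AE)
  note r = L2_rep_class[OF assms(1)] L2_rep_class[OF assms(2)]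
  show "AE x in M. cnj (L2_rep (L2_class M f) x) * L2_rep (L2_class M g) x = cnj (f x) * g x"
    using r(2,4) by eventually_elim simp
  show "(\<lambda>x. cnj (L2_rep (L2_class M f) x) * L2_rep (L2_class M g) x) \<in> borel_measurable M"
    by (rule borel_measurable_integrable[OF L2_fun_mult_integrable[OF L2_fun_cnj[OF r(1)] r(3)]])
  show "(\<lambda>x. cnj (f x) * g x) \<in> borel_measurable M"
    by (rule borel_measurable_integrable[OF L2_fun_mult_integrable[OF L2_fun_cnj[OF assms(1)] assms(2)]])
qed

lemma L2_norm_class_cnj:
  assumes "f \<in> L2_fun M"
  shows "L2_norm M (L2_class M (\<lambda>x. cnj (f x))) = L2_norm M (L2_class M f)"
proof -
  have "(LINT x|M. cnj (cnj (f x)) * cnj (f x)) = (LINT x|M. cnj (f x) * f x)"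
    by (simp add: mult.commute)
  then show ?thesis
    using L2_inner_class[OF L2_fun_cnj[OF assms] L2_fun_cnj[OF assms]] L2_inner_class[OF assms assms]
    by (simp add: L2_norm_def)
qed

lemma L2_spaceE:
  assumes "G \<in> L2_space M" obtains g where "g \<in> L2_fun M" "G = L2_class M g"
  using assms by (auto simp: L2_space_def)

lemma L2_class_in_space: "f \<in> L2_fun M \<Longrightarrow> L2_class M f \<in> L2_space M"
  by (simp add: L2_space_def)

section \<open>Restrictions of the maximal operator\<close>

context sturm_liouville_expression
begin

abbreviation "cls \<equiv> L2_class M"

lemma dom_max_eq_on_S:
  assumes "y \<in> dom_max \<tau>" "y' \<in> dom_max \<tau>" "AE x in M. y x = y' x" "x \<in> S"
  shows "y x = y' x"
  by (rule continuous_AE_eq_imp_eq[OF open_S AC_continuous_on_S[OF sl_domain_AC[OF dom_maxD(1)[OF assms(1)]]]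
      AC_continuous_on_S[OF sl_domain_AC[OF dom_maxD(1)[OF assms(2)]]] _ assms(4)]) (use assms(3) in \<open>simp add: AE_M\<close>)

text \<open>All representatives of a class in the domain agree on the interval by continuity, so the choice
  inside the definition of \<open>T_max\<close> is harmless.\<close>

lemma T_max_class:
  assumes y: "y \<in> dom_max \<tau>"
  shows "T_max \<tau> (cls y) = Some (cls (expr y))"
proof -
  define y' where "y' = (SOME y'. y' \<in> dom_max \<tau> \<and> cls y = cls y')"
  have y': "y' \<in> dom_max \<tau>" "cls y = cls y'"
    using someI[of "\<lambda>y'. y' \<in> dom_max \<tau> \<and> cls y = cls y'" y] y by (auto simp: y'_def)
  have "AE x in M. y x = y' x" using y'(2) L2_class_eq_iff[OF dom_maxD(2)[OF y]] by simp
  then have "AE x in M. expr y' x = expr y x"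
    unfolding AE_M by (intro sl_domain_cong(3)[OF _ dom_maxD(1)[OF y]] dom_max_eq_on_S[OF y y'(1)]) (simp_all add: AE_M)
  then have "cls (expr y') = cls (expr y)" by (rule L2_class_cong)
  then show ?thesis using y by (simp add: T_max_def y'_def[symmetric])
qed

lemma T_max_restr_class: "D \<subseteq> dom_max \<tau> \<Longrightarrow> y \<in> D \<Longrightarrow> T_max_restr \<tau> D (cls y) = Some (cls (expr y))"
  using T_max_class by (auto simp: T_max_restr_def)

lemma dom_T_max_restr: "D \<subseteq> dom_max \<tau> \<Longrightarrow> dom (T_max_restr \<tau> D) = cls ` D"
  using T_max_class by (auto simp: T_max_restr_def dom_def restrict_map_def)

lemma shift_L2: "y \<in> dom_max \<tau> \<Longrightarrow> (\<lambda>x. expr y x - z * y x) \<in> L2_fun M"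
  using L2_fun_lincomb[OF dom_maxD(3) dom_maxD(2), of y y 1 "- z"] by simp

lemma op_shift_class:
  assumes D: "D \<subseteq> dom_max \<tau>" and y: "y \<in> D"
  shows "op_shift M (T_max_restr \<tau> D) z (cls y) = Some (cls (\<lambda>x. expr y x - z * y x))"
proof -
  have y': "y \<in> dom_max \<tau>" using D y by blast
  have "(\<lambda>x. - z * y x + 0 * y x) \<in> L2_fun M"
    by (rule L2_fun_lincomb[OF dom_maxD(2)[OF y'] dom_maxD(2)[OF y']])
  then have zy: "(\<lambda>x. - z * y x) \<in> L2_fun M" by simp
  have mem: "cls y \<in> L2_space M" by (rule L2_class_in_space[OF dom_maxD(2)[OF y']])
  have "op_shift M (T_max_restr \<tau> D) z (cls y) = Some (L2_add M (cls (expr y)) (cls (\<lambda>x. - z * y x)))"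
    using mem y T_max_restr_class[OF D y] L2_scale_class[OF dom_maxD(2)[OF y'], of "- z"]
    by (auto simp: op_shift_def op_add_def op_scale_def op_id_def dom_def)
  also have "\<dots> = Some (cls (\<lambda>x. expr y x - z * y x))"
    using L2_add_class[OF dom_maxD(3)[OF y'] zy] by simp
  finally show ?thesis .
qed

lemma dom_op_shift:
  assumes D: "D \<subseteq> dom_max \<tau>"
  shows "dom (op_shift M (T_max_restr \<tau> D) z) = cls ` D"
proof -
  have "cls ` D \<subseteq> L2_space M" using D dom_maxD(2) L2_class_in_space by blast
  then show ?thesis
    using dom_T_max_restr[OF D]
    by (auto simp: op_shift_def op_add_def op_scale_def op_id_def dom_def split: if_splits)
qed

lemma ran_op_shift:
  assumes D: "D \<subseteq> dom_max \<tau>"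
  shows "ran (op_shift M (T_max_restr \<tau> D) z) = (\<lambda>y. cls (\<lambda>x. expr y x - z * y x)) ` D"
proof -
  have "ran (op_shift M (T_max_restr \<tau> D) z) = (\<lambda>F. the (op_shift M (T_max_restr \<tau> D) z F)) ` dom (op_shift M (T_max_restr \<tau> D) z)"
    by (force simp: ran_def dom_def image_iff)
  then show ?thesis
    unfolding dom_op_shift[OF D] image_image using op_shift_class[OF D] by (auto simp: image_iff)
qed

text \<open>Boundary conditions are conditions on functions, so the resolvent set is used through
  representatives: here injectivity, in the next lemma surjectivity.\<close>

lemma inj_op_shift_iff:
  assumes D: "D \<subseteq> dom_max \<tau>"
  shows "inj_on (op_shift M (T_max_restr \<tau> D) z) (dom (op_shift M (T_max_restr \<tau> D) z)) \<longleftrightarrow>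
    (\<forall>y\<in>D. \<forall>y'\<in>D. (AE x in M. expr y x - z * y x = expr y' x - z * y' x) \<longrightarrow> (AE x in M. y x = y' x))"
proof -
  have 1: "op_shift M (T_max_restr \<tau> D) z (cls y) = op_shift M (T_max_restr \<tau> D) z (cls y') \<longleftrightarrow>
      (AE x in M. expr y x - z * y x = expr y' x - z * y' x)" if "y \<in> D" "y' \<in> D" for y y'
  proof -
    have "y \<in> dom_max \<tau>" using that D by blast
    from L2_class_eq_iff[OF shift_L2[OF this]] show ?thesis
      by (simp add: op_shift_class[OF D that(1)] op_shift_class[OF D that(2)])
  qed
  have 2: "cls y = cls y' \<longleftrightarrow> (AE x in M. y x = y' x)" if "y \<in> D" for y y'
    using that D dom_maxD(2) by (intro L2_class_eq_iff) blast
  show ?thesis unfolding dom_op_shift[OF D] inj_on_def ball_simps using 1 2 by auto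
qed

lemma range_op_shift_iff:
  assumes D: "D \<subseteq> dom_max \<tau>"
  shows "ran (op_shift M (T_max_restr \<tau> D) z) = L2_space M \<longleftrightarrow>
    (\<forall>g\<in>L2_fun M. \<exists>y\<in>D. AE x in M. expr y x - z * y x = g x)"
proof -
  have 1: "cls g = cls (\<lambda>x. expr y x - z * y x) \<longleftrightarrow> (AE x in M. expr y x - z * y x = g x)" if "y \<in> D" for y g
    using L2_class_eq_iff[OF shift_L2, of y z g] that D by (auto simp: eq_commute[of "cls g"])
  define A where "A y = cls (\<lambda>x. expr y x - z * y x)" for y
  have "A ` D \<subseteq> L2_space M"
    using D by (auto simp: A_def intro!: L2_class_in_space shift_L2)
  then have "A ` D = L2_space M \<longleftrightarrow> L2_space M \<subseteq> A ` D" by (simp add: set_eq_subset)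
  also have "\<dots> \<longleftrightarrow> (\<forall>g\<in>L2_fun M. \<exists>y\<in>D. cls g = A y)"
    by (simp add: L2_space_def image_subset_iff image_iff)
  also have "\<dots> \<longleftrightarrow> (\<forall>g\<in>L2_fun M. \<exists>y\<in>D. AE x in M. expr y x - z * y x = g x)"
    unfolding A_def using 1 by (intro ball_cong bex_cong refl)
  finally show ?thesis unfolding ran_op_shift[OF D] A_def .
qed

lemma resolvent_op_class:
  assumes D: "D \<subseteq> dom_max \<tau>"
    and inj: "inj_on (op_shift M (T_max_restr \<tau> D) z) (dom (op_shift M (T_max_restr \<tau> D) z))"
    and y: "y \<in> D" "AE x in M. expr y x - z * y x = g x"
  shows "resolvent_op M (T_max_restr \<tau> D) z (cls g) = Some (cls y)"
proof -
  let ?A = "op_shift M (T_max_restr \<tau> D) z"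
  have Ay: "?A (cls y) = Some (cls g)"
    using op_shift_class[OF D y(1)] L2_class_cong[OF y(2)] by simp
  have "(THE F. ?A F = Some (cls g)) = cls y"
  proof (rule the_equality)
    show "?A (cls y) = Some (cls g)" by (rule Ay)
    fix F assume "?A F = Some (cls g)"
    then show "F = cls y" using inj Ay by (metis domI inj_onD)
  qed
  moreover have "cls g \<in> ran ?A" using Ay by (auto simp: ran_def)
  ultimately show ?thesis by (simp add: resolvent_op_def op_inv_def)
qed

lemma resolvent_setD:
  assumes D: "D \<subseteq> dom_max \<tau>" and z: "z \<in> resolvent_set M (T_max_restr \<tau> D)"
  shows resolvent_set_inj: "\<And>y y' x. y \<in> D \<Longrightarrow> y' \<in> D \<Longrightarrow>
        AE x in M. expr y x - z * y x = expr y' x - z * y' x \<Longrightarrow> x \<in> S \<Longrightarrow> y x = y' x"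
    and resolvent_set_surj: "\<And>g. g \<in> L2_fun M \<Longrightarrow> \<exists>y\<in>D. AE x in M. expr y x - z * y x = g x"
    and resolvent_set_class: "\<And>y g. y \<in> D \<Longrightarrow> AE x in M. expr y x - z * y x = g x \<Longrightarrow>
        resolvent_op M (T_max_restr \<tau> D) z (cls g) = Some (cls y)"
    and resolvent_set_None: "\<And>G. G \<notin> L2_space M \<Longrightarrow> resolvent_op M (T_max_restr \<tau> D) z G = None"
proof -
  have inj: "inj_on (op_shift M (T_max_restr \<tau> D) z) (dom (op_shift M (T_max_restr \<tau> D) z))"
    and ran: "ran (op_shift M (T_max_restr \<tau> D) z) = L2_space M"
    using z by (auto simp: resolvent_set_def)
  show "y x = y' x" if "y \<in> D" "y' \<in> D" "AE x in M. expr y x - z * y x = expr y' x - z * y' x" "x \<in> S" for y y' x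
  proof -
    have "AE x in M. y x = y' x"
      using inj that(1-3) unfolding inj_op_shift_iff[OF D] by blast
    then show ?thesis using dom_max_eq_on_S[of y y'] that D by blast
  qed
  show "\<exists>y\<in>D. AE x in M. expr y x - z * y x = g x" if "g \<in> L2_fun M" for g
    using ran that unfolding range_op_shift_iff[OF D] by blast
  show "resolvent_op M (T_max_restr \<tau> D) z (cls g) = Some (cls y)"
    if "y \<in> D" "AE x in M. expr y x - z * y x = g x" for y g
    by (rule resolvent_op_class[OF D inj that])
  show "resolvent_op M (T_max_restr \<tau> D) z G = None" if "G \<notin> L2_space M" for G
    using that ran by (simp add: resolvent_op_def op_inv_def)
qed

text \<open>On a domain that is closed under it, conjugation is an isometry that commutes with \<open>\<tau>\<close>, so the
  resolvent at \<open>cnj z\<close> is the resolvent at \<open>z\<close> conjugated on both sides.\<close>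

lemma resolvent_set_cnj:
  assumes D: "D \<subseteq> dom_max \<tau>" and cD: "\<And>y. y \<in> D \<Longrightarrow> (\<lambda>x. cnj (y x)) \<in> D"
    and z: "z \<in> resolvent_set M (T_max_restr \<tau> D)"
  shows "cnj z \<in> resolvent_set M (T_max_restr \<tau> D)"
proof -
  have shift: "AE x in M. expr (\<lambda>x. cnj (y x)) x - w * cnj (y x) = cnj (expr y x - cnj w * y x)"
    if "y \<in> D" for y w
    using dom_max_cnj(2)[of y] that D by (auto elim: eventually_mono)
  have inj: "inj_on (op_shift M (T_max_restr \<tau> D) (cnj z)) (dom (op_shift M (T_max_restr \<tau> D) (cnj z)))"
    unfolding inj_op_shift_iff[OF D]
  proof (intro ballI impI)
    fix y y' assume y: "y \<in> D" "y' \<in> D" and eq: "AE x in M. expr y x - cnj z * y x = expr y' x - cnj z * y' x"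
    have "AE x in M. expr (\<lambda>x. cnj (y x)) x - z * cnj (y x) = expr (\<lambda>x. cnj (y' x)) x - z * cnj (y' x)"
      using shift[OF y(1), of z] shift[OF y(2), of z] eq by eventually_elim simp
    then have "cnj (y x) = cnj (y' x)" if "x \<in> S" for x
      using resolvent_set_inj[OF D z cD[OF y(1)] cD[OF y(2)]] that by blast
    then show "AE x in M. y x = y' x" using AE_M_S by (auto elim!: eventually_mono)
  qed
  have surj: "\<exists>y\<in>D. (AE x in M. expr y x - z * y x = cnj (g x)) \<and> (AE x in M. expr (\<lambda>x. cnj (y x)) x - cnj z * cnj (y x) = g x)"
    if "g \<in> L2_fun M" for g
  proof -
    from resolvent_set_surj[OF D z L2_fun_cnj[OF that]]
    obtain y where y: "y \<in> D" "AE x in M. expr y x - z * y x = cnj (g x)" by blast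
    have "AE x in M. expr (\<lambda>x. cnj (y x)) x - cnj z * cnj (y x) = g x"
      using shift[OF y(1), of "cnj z"] y(2) by eventually_elim simp
    then show ?thesis using y by blast
  qed
  have ran: "ran (op_shift M (T_max_restr \<tau> D) (cnj z)) = L2_space M"
    unfolding range_op_shift_iff[OF D] using surj cD by blast
  obtain C where C: "\<And>G. G \<in> L2_space M \<Longrightarrow> L2_norm M (the (resolvent_op M (T_max_restr \<tau> D) z G)) \<le> C * L2_norm M G"
    using z by (auto simp: resolvent_set_def)
  have "L2_norm M (the (resolvent_op M (T_max_restr \<tau> D) (cnj z) G)) \<le> C * L2_norm M G" if G: "G \<in> L2_space M" for G
  proof -
    obtain g where g: "g \<in> L2_fun M" "G = cls g" using G by (rule L2_spaceE)
    obtain y where y: "y \<in> D" "AE x in M. expr y x - z * y x = cnj (g x)"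
      "AE x in M. expr (\<lambda>x. cnj (y x)) x - cnj z * cnj (y x) = g x" using surj[OF g(1)] by blast
    have y2: "y \<in> L2_fun M" using y(1) D dom_maxD(2) by blast
    have "resolvent_op M (T_max_restr \<tau> D) z (cls (\<lambda>x. cnj (g x))) = Some (cls y)"
      by (rule resolvent_set_class[OF D z y(1,2)])
    then have "L2_norm M (cls y) \<le> C * L2_norm M (cls (\<lambda>x. cnj (g x)))"
      using C[OF L2_class_in_space[OF L2_fun_cnj[OF g(1)]]] by simp
    moreover have "resolvent_op M (T_max_restr \<tau> D) (cnj z) (cls g) = Some (cls (\<lambda>x. cnj (y x)))"
      by (rule resolvent_op_class[OF D inj cD[OF y(1)] y(3)])
    ultimately show ?thesis
      using L2_norm_class_cnj[OF g(1)] L2_norm_class_cnj[OF y2] by (simp add: g(2))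
  qed
  then show ?thesis using inj ran by (auto simp: resolvent_set_def)
qed


section \<open>Comparison of two restrictions\<close>

text \<open>Both operators act as \<open>\<tau>\<close>, so only domains have to be compared. The hypothesis on \<open>D\<close> ensures that a
  class which meets both \<open>D\<close> and \<open>D'\<close> has one representative in both.\<close>

lemma maximal_common_part_restr:
  assumes D: "D \<subseteq> dom_max \<tau>" and D': "D' \<subseteq> dom_max \<tau>"
    and cong: "\<And>y y'. y \<in> D \<Longrightarrow> y' \<in> dom_max \<tau> \<Longrightarrow> (\<And>x. x \<in> S \<Longrightarrow> y x = y' x) \<Longrightarrow> y' \<in> D"
  shows "maximal_common_part (T_max_restr \<tau> D) (T_max_restr \<tau> D') = T_max_restr \<tau> (D \<inter> D')"
proof -
  have "cls ` D \<inter> cls ` D' \<subseteq> cls ` (D \<inter> D')"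
  proof
    fix F assume "F \<in> cls ` D \<inter> cls ` D'"
    then obtain y y' where y: "y \<in> D" "F = cls y" and y': "y' \<in> D'" "F = cls y'" by blast
    have dm: "y \<in> dom_max \<tau>" "y' \<in> dom_max \<tau>" using y y' D D' by auto
    have "AE x in M. y x = y' x" using L2_class_eq_iff[OF dom_maxD(2)[OF dm(1)], of y'] y y' by simp
    then have "y' \<in> D" by (intro cong[OF y(1) dm(2)] dom_max_eq_on_S[OF dm])
    then show "F \<in> cls ` (D \<inter> D')" using y' by blast
  qed
  then have common: "cls ` D \<inter> cls ` D' = cls ` (D \<inter> D')" by blast
  have "{F \<in> dom (T_max_restr \<tau> D) \<inter> dom (T_max_restr \<tau> D'). T_max_restr \<tau> D F = T_max_restr \<tau> D' F} = cls ` (D \<inter> D')"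
  proof -
    have "T_max_restr \<tau> D F = T_max_restr \<tau> D' F" if "F \<in> cls ` D \<inter> cls ` D'" for F
      using that by (simp add: T_max_restr_def)
    then show ?thesis
      unfolding dom_T_max_restr[OF D] dom_T_max_restr[OF D'] common[symmetric] by blast
  qed
  then have "maximal_common_part (T_max_restr \<tau> D) (T_max_restr \<tau> D') = T_max_restr \<tau> D |` (cls ` (D \<inter> D'))"
    by (simp add: maximal_common_part_def)
  also have "\<dots> = T_max_restr \<tau> (D \<inter> D')"
  proof -
    have "cls ` D \<inter> cls ` (D \<inter> D') = cls ` (D \<inter> D')" by blast
    then show ?thesis by (simp add: T_max_restr_def)
  qed
  finally show ?thesis .
qed

text \<open>In the Lagrange identity for \<open>f\<^sub>0\<close> and \<open>u\<close> the terms with \<open>z\<close> cancel, because \<open>u\<close> belongs to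
  the conjugate spectral parameter. Only \<open>g\<close> times the conjugate of \<open>u\<close> remains.\<close>

lemma resolvent_pairing:
  assumes f0: "f0 \<in> dom_max \<tau>" "AE x in M. expr f0 x - z * f0 x = g x"
    and u: "u \<in> dom_max \<tau>" "AE x in M. expr u x = cnj z * u x" and g: "g \<in> L2_fun M"
  shows "L2_inner M (cls u) (cls g) = bracket_r f0 u - bracket_l f0 u"
proof -
  have "L2_inner M (cls u) (cls g) = (LINT x|M. cnj (u x) * g x)"
    by (rule L2_inner_class[OF dom_maxD(2)[OF u(1)] g])
  also have "\<dots> = (LINT x|M. expr f0 x * cnj (u x) - f0 x * cnj (expr u x))"
  proof (rule integral_cong_AE)
    show "(\<lambda>x. cnj (u x) * g x) \<in> borel_measurable M"
      by (rule borel_measurable_integrable[OF L2_fun_mult_integrable[OF L2_fun_cnj[OF dom_maxD(2)[OF u(1)]] g]])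
    show "(\<lambda>x. expr f0 x * cnj (u x) - f0 x * cnj (expr u x)) \<in> borel_measurable M"
      using borel_measurable_integrable[OF lagrange_density_integrable(1)[OF f0(1) u(1)]]
      by (simp add: lagrange_density_def[abs_def])
    show "AE x in M. cnj (u x) * g x = expr f0 x * cnj (u x) - f0 x * cnj (expr u x)"
      using f0(2) u(2)
    proof eventually_elim
      case (elim x)
      then have "expr f0 x = g x + z * f0 x" by (simp add: algebra_simps)
      then show ?case using elim(2) by (simp add: algebra_simps)
    qed
  qed
  also have "\<dots> = bracket_r f0 u - bracket_l f0 u" by (rule lagrange_identity[OF f0(1) u(1), symmetric])
  finally show ?thesis .
qed

end

lemma coupled_bc_iff:
  fixes R :: "real^2^2"
  assumes "R $ 1 $ 2 = 0"
  shows "((vector [b1, b2] :: complex^2) = e *s ((\<chi> i j. complex_of_real (R $ i $ j)) *v vector [a1, a2])) \<longleftrightarrow>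
    b1 = e * of_real (R $ 1 $ 1) * a1 \<and> b2 = e * (of_real (R $ 2 $ 1) * a1 + of_real (R $ 2 $ 2) * a2)"
  using assms by (simp add: vec_eq_iff forall_2 matrix_vector_mult_def sum_2 vector_2 mult.assoc)

theorem theorem4p7:
  fixes \<tau> :: sturm_liouville
    and \<phi>a \<psi>a \<phi>b \<psi>b :: "real \<Rightarrow> complex"
    and u1 u2 :: "complex \<Rightarrow> real \<Rightarrow> complex"
    and \<eta> :: real and R :: "real^2^2"
  assumes "sl_coefficients \<tau>"
    and "limit_circle_left \<tau>" and "limit_circle_right \<tau>"
    and "bc_basis_left \<tau> \<phi>a \<psi>a" and "bc_basis_right \<tau> \<phi>b \<psi>b"
    and "\<eta> \<in> {0..<pi}" and "det R = 1"
    and "\<And>z. z \<in> resolvent_set (sl_measure \<tau>) (T_zero \<tau> \<phi>a \<phi>b) \<Longrightarrow>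
           sl_solution \<tau> z (u1 z) \<and> bracket_left \<tau> (u1 z) \<phi>a = 0 \<and> bracket_right \<tau> (u1 z) \<phi>b = 1"
    and "\<And>z. z \<in> resolvent_set (sl_measure \<tau>) (T_zero \<tau> \<phi>a \<phi>b) \<Longrightarrow>
           sl_solution \<tau> z (u2 z) \<and> bracket_left \<tau> (u2 z) \<phi>a = 1 \<and> bracket_right \<tau> (u2 z) \<phi>b = 0"
    and "R $ 1 $ 2 = 0"
  shows "maximal_common_part (T_coupled \<tau> \<phi>a \<psi>a \<phi>b \<psi>b R \<eta>) (T_zero \<tau> \<phi>a \<phi>b) =
           T_max_restr \<tau> (common_dom \<tau> \<phi>a \<psi>a \<phi>b \<psi>b R \<eta>)
       \<and> (\<forall>z \<in> resolvent_set (sl_measure \<tau>) (T_coupled \<tau> \<phi>a \<psi>a \<phi>b \<psi>b R \<eta>) \<inter>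
                resolvent_set (sl_measure \<tau>) (T_zero \<tau> \<phi>a \<phi>b).
            k_coupled \<tau> \<psi>a \<psi>b u1 u2 R \<eta> z \<noteq> 0 \<and>
            resolvent_op (sl_measure \<tau>) (T_coupled \<tau> \<phi>a \<psi>a \<phi>b \<psi>b R \<eta>) z =
              op_add (sl_measure \<tau>)
                (resolvent_op (sl_measure \<tau>) (T_zero \<tau> \<phi>a \<phi>b) z)
                (op_scale (sl_measure \<tau>) (inverse (k_coupled \<tau> \<psi>a \<psi>b u1 u2 R \<eta> z))
                  (rank_one (sl_measure \<tau>)
                    (L2_class (sl_measure \<tau>) (u_coupled u1 u2 R \<eta> (cnj z)))
                    (L2_class (sl_measure \<tau>) (u_coupled u1 u2 R \<eta> z)))))"
proof -
  interpret sturm_liouville_expression \<tau> using assms(1) by unfold_locales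
  define E where "E = exp (\<i> * complex_of_real \<eta>)"
  define R11 R21 R22 where "R11 = complex_of_real (R $ 1 $ 1)"
    and "R21 = complex_of_real (R $ 2 $ 1)" and "R22 = complex_of_real (R $ 2 $ 2)"
  have E: "exp (- \<i> * complex_of_real \<eta>) = inverse E" "E \<noteq> 0" "cnj (inverse E) = E"
    by (simp_all add: E_def exp_minus exp_cnj flip: exp_minus)
  have RR: "R11 * R22 = 1"
    using assms(7,10) by (simp add: det_2 R11_def R22_def flip: of_real_mult)
  have cR: "cnj R22 = R22" by (simp add: R22_def)
  let ?L = "at_right (left_end \<tau>)" and ?R = "at_left (right_end \<tau>)"
  note eL = endpoint_left and eR = endpoint_right
  have bas: "\<phi>a \<in> dom_max \<tau>" "\<psi>a \<in> dom_max \<tau>" "\<phi>b \<in> dom_max \<tau>" "\<psi>b \<in> dom_max \<tau>"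
    "\<And>x. x \<in> S \<Longrightarrow> \<phi>a x \<in> \<real>" "\<And>x. x \<in> S \<Longrightarrow> \<psi>a x \<in> \<real>" "\<And>x. x \<in> S \<Longrightarrow> \<phi>b x \<in> \<real>" "\<And>x. x \<in> S \<Longrightarrow> \<psi>b x \<in> \<real>"
    "blim ?L \<psi>a \<phi>a = 1" "blim ?R \<psi>b \<phi>b = 1"
    using assms(4,5) by (auto simp: bc_basis_left_def bc_basis_right_def bracket_left_eq_blim bracket_right_eq_blim)
  define D0 where "D0 = {g \<in> dom_max \<tau>. bracket_l g \<phi>a = 0 \<and> bracket_r g \<phi>b = 0}"
  define DR where "DR = {g \<in> dom_max \<tau>. bracket_r g \<phi>b = E * R11 * bracket_l g \<phi>a \<and>
      bracket_r g \<psi>b = E * (R21 * bracket_l g \<phi>a + R22 * bracket_l g \<psi>a)}"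
  have T0: "T_zero \<tau> \<phi>a \<phi>b = T_max_restr \<tau> D0" by (simp add: T_zero_def D0_def)
  have TR: "T_coupled \<tau> \<phi>a \<psi>a \<phi>b \<psi>b R \<eta> = T_max_restr \<tau> DR"
    by (simp add: T_coupled_def DR_def coupled_bc_iff[OF assms(10)] E_def R11_def R21_def R22_def)
  have sub: "D0 \<subseteq> dom_max \<tau>" "DR \<subseteq> dom_max \<tau>" by (auto simp: D0_def DR_def)
  have lin: "bracket_r (\<lambda>x. \<alpha> * f x + \<beta> * f' x) g = \<alpha> * bracket_r f g + \<beta> * bracket_r f' g"
    "bracket_l (\<lambda>x. \<alpha> * f x + \<beta> * f' x) g = \<alpha> * bracket_l f g + \<beta> * bracket_l f' g"
    if "f \<in> dom_max \<tau>" "f' \<in> dom_max \<tau>" "g \<in> dom_max \<tau>" for f f' g and \<alpha> \<beta> :: complex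
    using blim_lincomb[OF eR that] blim_lincomb[OF eL that] by (simp_all add: bracket_right_eq_blim bracket_left_eq_blim)
  have cong: "bracket_r f' g = bracket_r f g" "bracket_l f' g = bracket_l f g"
    if "f \<in> dom_max \<tau>" "\<And>x. x \<in> S \<Longrightarrow> f x = f' x" "g \<in> dom_max \<tau>" for f f' g
    using blim_cong[OF eR that] blim_cong[OF eL that] by (simp_all add: bracket_right_eq_blim bracket_left_eq_blim)

  have common: "maximal_common_part (T_max_restr \<tau> DR) (T_max_restr \<tau> D0) =
      T_max_restr \<tau> (common_dom \<tau> \<phi>a \<psi>a \<phi>b \<psi>b R \<eta>)"
  proof -
    have "DR \<inter> D0 = common_dom \<tau> \<phi>a \<psi>a \<phi>b \<psi>b R \<eta>"
      by (auto simp: DR_def D0_def common_dom_def E_def R22_def)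
    moreover have "y' \<in> DR" if "y \<in> DR" "y' \<in> dom_max \<tau>" "\<And>x. x \<in> S \<Longrightarrow> y x = y' x" for y y'
      using that(1,2) cong[of y y' _, OF _ that(3)] bas sub(2) by (auto simp: DR_def)
    ultimately show ?thesis using maximal_common_part_restr[OF sub(2,1)] by simp
  qed

  have "k_coupled \<tau> \<psi>a \<psi>b u1 u2 R \<eta> z \<noteq> 0 \<and>
      resolvent_op M (T_max_restr \<tau> DR) z =
      op_add M (resolvent_op M (T_max_restr \<tau> D0) z)
        (op_scale M (inverse (k_coupled \<tau> \<psi>a \<psi>b u1 u2 R \<eta> z))
          (rank_one M (cls (u_coupled u1 u2 R \<eta> (cnj z))) (cls (u_coupled u1 u2 R \<eta> z))))"
    if zR: "z \<in> resolvent_set M (T_max_restr \<tau> DR)" and z0: "z \<in> resolvent_set M (T_max_restr \<tau> D0)" for z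
  proof -
    define v where "v = u_coupled u1 u2 R \<eta>"
    define k where "k = k_coupled \<tau> \<psi>a \<psi>b u1 u2 R \<eta> z"
    have u1: "u1 w \<in> dom_max \<tau>" "AE x in M. expr (u1 w) x = w * u1 w x" "bracket_l (u1 w) \<phi>a = 0" "bracket_r (u1 w) \<phi>b = 1"
      and u2: "u2 w \<in> dom_max \<tau>" "AE x in M. expr (u2 w) x = w * u2 w x" "bracket_l (u2 w) \<phi>a = 1" "bracket_r (u2 w) \<phi>b = 0"
      if "w \<in> resolvent_set M (T_max_restr \<tau> D0)" for w
      using solution_dom_max[OF assms(2,3)] assms(8,9)[of w] that unfolding T0 by auto
    have v_eq: "v w = (\<lambda>x. (inverse E * R22) * u2 w x + 1 * u1 w x)" for w
      by (simp add: v_def u_coupled_def fun_eq_iff E_def exp_minus R22_def)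
    have v: "v w \<in> dom_max \<tau>" "AE x in M. expr (v w) x = w * v w x" "bracket_l (v w) \<phi>a = inverse E * R22" "bracket_r (v w) \<phi>b = 1"
      if w: "w \<in> resolvent_set M (T_max_restr \<tau> D0)" for w
    proof -
      show "v w \<in> dom_max \<tau>" unfolding v_eq by (rule dom_max_lincomb(1)[OF u2(1)[OF w] u1(1)[OF w]])
      show "bracket_l (v w) \<phi>a = inverse E * R22" "bracket_r (v w) \<phi>b = 1"
        unfolding v_eq lin[OF u2(1)[OF w] u1(1)[OF w] bas(1)] lin[OF u2(1)[OF w] u1(1)[OF w] bas(3)]
        using u1[OF w] u2[OF w] by simp_all
      show "AE x in M. expr (v w) x = w * v w x"
        unfolding v_eq
        using dom_max_lincomb(2)[OF u2(1)[OF w] u1(1)[OF w], of "inverse E * R22" 1] u1(2)[OF w] u2(2)[OF w]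
        by eventually_elim (simp add: algebra_simps)
    qed
    have k_eq: "k = R21 * R22 + E * R22 * bracket_l (v z) \<psi>a - bracket_r (v z) \<psi>b"
      by (simp add: k_def k_coupled_def v_def E_def R21_def R22_def)
    have zc: "cnj z \<in> resolvent_set M (T_max_restr \<tau> D0)"
    proof (rule resolvent_set_cnj[OF sub(1) _ z0])
      fix y assume "y \<in> D0"
      then show "(\<lambda>x. cnj (y x)) \<in> D0"
        using dom_max_cnj(1)[of y] blim_cnj[OF eL, of y \<phi>a] blim_cnj[OF eR, of y \<phi>b] bas
        by (simp add: D0_def bracket_left_eq_blim bracket_right_eq_blim)
    qed
    \<comment> \<open>If \<open>k = 0\<close>, the two coupled boundary conditions hold for \<open>v z\<close> itself, which would be an eigenfunction.\<close>
    have "k \<noteq> 0"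
    proof
      assume "k = 0"
      have zero: "(\<lambda>x. 0 * v z x + 0 * v z x) \<in> DR"
        using dom_max_lincomb(1)[OF v(1)[OF z0] v(1)[OF z0], of 0 0] lin[OF v(1)[OF z0] v(1)[OF z0], of _ 0 0] bas
        by (simp add: DR_def)
      have vR: "v z \<in> DR"
      proof -
        have "E * R11 * (inverse E * R22) = 1" using RR E(2) by (simp add: field_simps)
        moreover have "E * (R21 * (inverse E * R22) + R22 * bracket_l (v z) \<psi>a) = R21 * R22 + E * R22 * bracket_l (v z) \<psi>a"
          using E(2) by (simp add: field_simps)
        moreover have "bracket_r (v z) \<psi>b = R21 * R22 + E * R22 * bracket_l (v z) \<psi>a"
          using \<open>k = 0\<close> unfolding k_eq by (simp add: algebra_simps)
        ultimately show ?thesis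
          using v(1)[OF z0] unfolding DR_def by (simp add: v(3,4)[OF z0])
      qed
      have "AE x in M. expr (v z) x - z * v z x = expr (\<lambda>x. 0 * v z x + 0 * v z x) x - z * (0 * v z x + 0 * v z x)"
        using v(2)[OF z0] dom_max_lincomb(2)[OF v(1)[OF z0] v(1)[OF z0], of 0 0] by eventually_elim simp
      then have "v z x = 0 * v z x + 0 * v z x" if "x \<in> S" for x
        using resolvent_set_inj[OF sub(2) zR vR zero] that by blast
      then have "bracket_r (\<lambda>x. 0 * v z x + 0 * v z x) \<phi>b = bracket_r (v z) \<phi>b"
        by (intro cong v(1)[OF z0] bas)
      moreover have "bracket_r (\<lambda>x. 0 * v z x + 0 * v z x) \<phi>b = 0"
        using lin[OF v(1)[OF z0] v(1)[OF z0] bas(3), of 0 0] by simp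
      ultimately show False using v(4)[OF z0] by simp
    qed
    have "resolvent_op M (T_max_restr \<tau> DR) z G =
      op_add M (resolvent_op M (T_max_restr \<tau> D0) z) (op_scale M (inverse k) (rank_one M (cls (v (cnj z))) (cls (v z)))) G" for G
    proof (cases "G \<in> L2_space M")
      case False
      then show ?thesis
        using resolvent_set_None[OF sub(2) zR] resolvent_set_None[OF sub(1) z0]
        by (simp add: op_add_def domIff)
    next
      case True
      then obtain g where g: "g \<in> L2_fun M" "G = cls g" by (rule L2_spaceE)
      obtain f where f: "f \<in> DR" "AE x in M. expr f x - z * f x = g x"
        using resolvent_set_surj[OF sub(2) zR g(1)] by blast
      obtain f0 where f0: "f0 \<in> D0" "AE x in M. expr f0 x - z * f0 x = g x"
        using resolvent_set_surj[OF sub(1) z0 g(1)] by blast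
      have fd: "f \<in> dom_max \<tau>" and f0d: "f0 \<in> dom_max \<tau>" using f f0 sub by auto
      define c where "c = bracket_r f \<phi>b"
      have blf: "bracket_l f \<phi>a = inverse E * R22 * c"
      proof -
        have "inverse E * R22 * c = inverse E * E * (R11 * R22) * bracket_l f \<phi>a"
          using f(1) by (simp add: DR_def c_def mult_ac)
        then show ?thesis using RR E(2) by simp
      qed
      define h where "h = (\<lambda>x. 1 * f x + (- c) * v z x)"
      have h: "h \<in> dom_max \<tau>" "AE x in M. expr h x - z * h x = g x"
      proof -
        show "h \<in> dom_max \<tau>" unfolding h_def by (rule dom_max_lincomb(1)[OF fd v(1)[OF z0]])
        show "AE x in M. expr h x - z * h x = g x"
          using dom_max_lincomb(2)[OF fd v(1)[OF z0], of 1 "- c"] v(2)[OF z0] f(2)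
          unfolding h_def by eventually_elim (simp add: algebra_simps)
      qed
      \<comment> \<open>\<open>h = f - c v\<close> satisfies the boundary conditions of \<open>T\<^sub>0\<^sub>,\<^sub>0\<close> and is mapped to the same \<open>g\<close>, so it is \<open>f\<^sub>0\<close>.\<close>
      have "h \<in> D0"
        using h(1) lin[OF fd v(1)[OF z0], of _ 1 "- c"] bas v(3,4)[OF z0] blf
        by (simp add: D0_def h_def c_def)
      then have "h x = f0 x" if "x \<in> S" for x
      proof (rule resolvent_set_inj[OF sub(1) z0 _ f0(1) _ that])
        show "AE x in M. expr h x - z * h x = expr f0 x - z * f0 x"
          using h(2) f0(2) by eventually_elim simp
      qed
      then have f_eq: "f x = 1 * f0 x + c * v z x" if "x \<in> S" for x
        using that by (simp add: h_def algebra_simps)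
      have brf: "bracket_r f \<psi>b = bracket_r f0 \<psi>b + c * bracket_r (v z) \<psi>b" "bracket_l f \<psi>a = bracket_l f0 \<psi>a + c * bracket_l (v z) \<psi>a"
        using cong[OF fd f_eq, of \<psi>b] cong[OF fd f_eq, of \<psi>a] bas
          lin[OF f0d v(1)[OF z0], of _ 1 c] by simp_all
      \<comment> \<open>The inner product reduces to brackets of \<open>f0\<close> with \<open>\<psi>a\<close> and \<open>\<psi>b\<close>, on which the second coupled condition is an equation.\<close>
      have pair: "L2_inner M (cls (v (cnj z))) (cls g) = c * k"
      proof -
        have pb: "bracket_r f0 (v (cnj z)) = bracket_r f0 \<psi>b"
          using blim_pluecker[OF eR f0d v(1)[OF zc] bas(3,7,4,8,10)] f0(1) v(4)[OF zc]
          by (simp add: D0_def bracket_right_eq_blim)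
        have "cnj (bracket_l (v (cnj z)) \<phi>a) = E * R22"
          unfolding v(3)[OF zc] using E(3) cR by simp
        then have pa: "bracket_l f0 (v (cnj z)) = bracket_l f0 \<psi>a * (E * R22)"
          using blim_pluecker[OF eL f0d v(1)[OF zc] bas(1,5,2,6,9)] f0(1)
          by (simp add: D0_def bracket_left_eq_blim)
        have "L2_inner M (cls (v (cnj z))) (cls g) = bracket_r f0 (v (cnj z)) - bracket_l f0 (v (cnj z))"
          by (rule resolvent_pairing[OF f0d f0(2) v(1,2)[OF zc] g(1)])
        also have "\<dots> = bracket_r f0 \<psi>b - E * R22 * bracket_l f0 \<psi>a" unfolding pa pb by simp
        also have "\<dots> = c * k"
        proof -
          have "bracket_r f \<psi>b = E * (R21 * (inverse E * R22 * c) + R22 * bracket_l f \<psi>a)"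
            using f(1) unfolding blf[symmetric] by (simp add: DR_def)
          also have "\<dots> = R21 * R22 * c + E * R22 * bracket_l f \<psi>a"
            using E(2) by (simp add: distrib_left)
          finally show ?thesis unfolding brf k_eq by (simp add: algebra_simps)
        qed
        finally show ?thesis .
      qed
      have "resolvent_op M (T_max_restr \<tau> DR) z G = Some (cls f)"
        unfolding g(2) by (rule resolvent_set_class[OF sub(2) zR f])
      also have "cls f = cls (\<lambda>x. f0 x + c * v z x)"
        by (rule L2_class_cong) (use AE_M_S f_eq in \<open>auto elim!: eventually_mono\<close>)
      also have "\<dots> = L2_add M (cls f0) (L2_scale M (inverse k) (L2_scale M (c * k) (cls (v z))))"
      proof -
        have 1: "(\<lambda>x. d * v z x) \<in> L2_fun M" for d
          using L2_fun_lincomb[OF dom_maxD(2)[OF v(1)[OF z0]] dom_maxD(2)[OF v(1)[OF z0]], of d 0] by simp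
        have "(\<lambda>x. inverse k * (c * k * v z x)) = (\<lambda>x. c * v z x)" using \<open>k \<noteq> 0\<close> by (simp add: fun_eq_iff)
        then have "L2_scale M (inverse k) (L2_scale M (c * k) (cls (v z))) = cls (\<lambda>x. c * v z x)"
          using L2_scale_class[OF dom_maxD(2)[OF v(1)[OF z0]]] L2_scale_class[OF 1[of "c * k"]] by simp
        then show ?thesis using L2_add_class[OF dom_maxD(2)[OF f0d] 1[of c]] by simp
      qed
      finally show ?thesis
        using resolvent_set_class[OF sub(1) z0 f0] True
        by (simp add: op_add_def op_scale_def rank_one_def g(2) pair domIff)
    qed
    then show ?thesis using \<open>k \<noteq> 0\<close> by (auto simp: k_def v_def)
  qed
  then show ?thesis using common unfolding TR T0 by blast
qed

end
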